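(* Let $M$ be a connected smooth manifold of dimension two and let $F: TM\setminus 0\to\mathbb{R}_{>0}$ be a strictly convex Finsler metric on $M$ (defined fiber-globally, i.e. on all nonzero tangent vectors). If $F$ is both Douglas and generalized Berwald, then $F$ is Berwald or $F$ is a Randers metric.
   Context: Notation: $(x^i)$ are local coordinates on $M$, $(x^i,y^i)$ the induced coordinates on $TM$; subscripts such as $F_{y^i}$, $E_{x^j}$ denote partial derivatives; repeated indices are summed. $TM\setminus 0$ is the tangent bundle with the zero section removed. All affine connections are smooth. A strictly convex Finsler metric on $M$ is a smooth function $F:TM\setminus 0\to\mathbb{R}_{>0}$ such that $F(x,\lambda y)=\lambda F(x,y)$ for all $\lambda>0$, and the matrix $g_{ij}(x,y)=\tfrac12\frac{\partial^2F^2}{\partial y^i\partial y^j}(x,y)$ is positive definite for all $(x,y)\in TM\setminus 0$. (It need not satisfy $F(x,-y)=F(x,y)$.) The geodesic spray of $F$ is the vector field $S_F=y^i\partial_{x^i}-2G^i(x,y)\partial_{y^i}$ on $TM\setminus 0$, where $2G^i=g^{ij}\big(E_{x^\ell y^j}y^\ell-E_{x^j}\big)$, $E=\tfrac12F^2$, and $(g^{ij})$ is the inverse matrix of $(g_{ij})$. Geodesics of $F$ are the projections to $M$ of integral curves of $S_F$, i.e. the solutions of $\ddot c^i+2G^i(c,\dot c)=0$ with $\dot c\neq 0$. For an affine connection $\nabla$ with Christoffel symbols $\Gamma^i_{jk}$, a vector field $X$ along a curve $c$ is parallel if $\dot X^i+\Gamma^i_{jk}(c)\dot c^jX^k=0$.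 The parallel transport of $\nabla$ preserves $F$ if $F(c(t),X(t))$ is constant in $t$ for every curve $c$ and every nowhere vanishing parallel vector field $X$ along $c$. $F$ is Berwald if one of the following two equivalent properties holds: (a) its geodesics coincide with the geodesics of an affine connection; (b) there exists a torsion-free affine connection whose parallel transport preserves $F$. $F$ is Douglas if its geodesics coincide, up to orientation preserving reparametrization, with the geodesics of an affine connection (which may be taken torsion-free). Equivalently, there is a torsion-free affine connection with Christoffel symbols ${}^D\Gamma^i_{jk}$ such that in all local coordinates $2G^i(x,y)={}^D\Gamma^i_{jk}(x)y^jy^k+\rho(x,y)y^i$ for some function $\rho$ on $TM\setminus 0$. $F$ is generalized Berwald if there exists an affine connection on $M$, possibly with torsion, whose parallel transport preserves $F$. $F$ is a Randers metric if $F=\alpha+\beta$, where $\alpha(x,y)=\sqrt{\alpha_{ij}(x)y^iy^j}$ is the norm of a Riemannian metric on $M$ and $\beta=\beta_i(x)y^i$ is a 1-form on $M$. *)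

theory Defs
  imports "HOL-Analysis.Analysis"
begin

section \<open>Smooth maps between normed spaces\<close>

text \<open>Only used for open \<open>S\<close> in a finite-dimensional space, where \<open>C_diff_on k\<close> is the usual class
  $C^k$.\<close>

fun C_diff_on :: "nat \<Rightarrow> 'a::real_normed_vector set \<Rightarrow> ('a \<Rightarrow> 'b::real_normed_vector) \<Rightarrow> bool" where
  "C_diff_on 0 S f \<longleftrightarrow> continuous_on S f"
| "C_diff_on (Suc k) S f \<longleftrightarrow> (\<forall>x\<in>S. f differentiable (at x)) \<and>
     (\<forall>v. C_diff_on k S (\<lambda>x. frechet_derivative f (at x) v))"

definition smooth_on :: "'a::real_normed_vector set \<Rightarrow> ('a \<Rightarrow> 'b::real_normed_vector) \<Rightarrow> bool" where
  "smooth_on S f \<longleftrightarrow> (\<forall>k. C_diff_on k S f)"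

definition pderiv_at :: "'n \<Rightarrow> (real^'n::finite \<Rightarrow> 'b::real_normed_vector) \<Rightarrow> real^'n \<Rightarrow> 'b" where
  "pderiv_at i f x = frechet_derivative f (at x) (axis i 1)"


section \<open>Smooth manifolds\<close>

text \<open>A chart is a pair of its domain and its coordinate map; the values of the map outside the domain
  are irrelevant. The dimension is \<open>CARD('n)\<close>.\<close>

type_synonym ('m, 'n) chart = "'m set \<times> ('m \<Rightarrow> real^'n)"

abbreviation cdom :: "('m, 'n) chart \<Rightarrow> 'm set" where
  "cdom \<phi> \<equiv> fst \<phi>"

abbreviation cmap :: "('m, 'n) chart \<Rightarrow> 'm \<Rightarrow> real^'n" where
  "cmap \<phi> \<equiv> snd \<phi>"

definition cran :: "('m, 'n) chart \<Rightarrow> (real^'n) set" where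
  "cran \<phi> = cmap \<phi> ` cdom \<phi>"

definition cinv :: "('m, 'n) chart \<Rightarrow> real^'n \<Rightarrow> 'm" where
  "cinv \<phi> = inv_into (cdom \<phi>) (cmap \<phi>)"

definition transition :: "('m, 'n) chart \<Rightarrow> ('m, 'n) chart \<Rightarrow> real^'n \<Rightarrow> real^'n" where
  "transition \<phi> \<psi> = cmap \<psi> \<circ> cinv \<phi>"

definition is_chart :: "'m topology \<Rightarrow> ('m, 'n::finite) chart \<Rightarrow> bool" where
  "is_chart X \<phi> \<longleftrightarrow> openin X (cdom \<phi>) \<and> open (cran \<phi>) \<and>
     homeomorphic_map (subtopology X (cdom \<phi>)) (top_of_set (cran \<phi>)) (cmap \<phi>)"

definition smoothly_compatible :: "('m, 'n::finite) chart \<Rightarrow> ('m, 'n) chart \<Rightarrow> bool" where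
  "smoothly_compatible \<phi> \<psi> \<longleftrightarrow>
     smooth_on (cmap \<phi> ` (cdom \<phi> \<inter> cdom \<psi>)) (transition \<phi> \<psi>) \<and>
     smooth_on (cmap \<psi> ` (cdom \<phi> \<inter> cdom \<psi>)) (transition \<psi> \<phi>)"

text \<open>The smooth structure \<open>A\<close> is a maximal atlas, so that quantification over \<open>A\<close> is
  quantification over all local coordinates.\<close>

definition smooth_manifold :: "'m topology \<Rightarrow> ('m, 'n::finite) chart set \<Rightarrow> bool" where
  "smooth_manifold X A \<longleftrightarrow>
     Hausdorff_space X \<and> second_countable X \<and>
     (\<forall>\<phi>\<in>A. is_chart X \<phi>) \<and> (\<Union>\<phi>\<in>A. cdom \<phi>) = topspace X \<and>
     (\<forall>\<phi>\<in>A. \<forall>\<psi>\<in>A. smoothly_compatible \<phi> \<psi>) \<and>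
     (\<forall>\<kappa>. is_chart X \<kappa> \<and> (\<forall>\<phi>\<in>A. smoothly_compatible \<phi> \<kappa>) \<longrightarrow> \<kappa> \<in> A)"


section \<open>Tangent vectors\<close>

text \<open>A tangent vector at \<open>p\<close> assigns to every chart around \<open>p\<close> a component vector, subject to the
  vector transformation law (and \<open>0\<close> to all other charts, to make it unique as a function).
  So \<open>v \<phi> $ i\<close> is the induced coordinate $y^i$ of \<open>v\<close> in the chart \<open>\<phi>\<close>.\<close>

type_synonym ('m, 'n) tvec = "('m, 'n) chart \<Rightarrow> real^'n"

definition tangent_space :: "('m, 'n::finite) chart set \<Rightarrow> 'm \<Rightarrow> ('m, 'n) tvec set" where
  "tangent_space A p = {v.
     (\<forall>\<phi>. \<not> (\<phi> \<in> A \<and> p \<in> cdom \<phi>) \<longrightarrow> v \<phi> = 0) \<and>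
     (\<forall>\<phi>\<in>A. \<forall>\<psi>\<in>A. p \<in> cdom \<phi> \<inter> cdom \<psi> \<longrightarrow>
        v \<psi> = frechet_derivative (transition \<phi> \<psi>) (at (cmap \<phi> p)) (v \<phi>))}"

text \<open>The tangent vector $y^i \partial_{x^i}$ at \<open>p\<close>, where $(x^i)$ are the coordinates of \<open>\<phi>\<close>.\<close>

definition coord_vec :: "('m, 'n::finite) chart set \<Rightarrow> ('m, 'n) chart \<Rightarrow> 'm \<Rightarrow> real^'n \<Rightarrow> ('m, 'n) tvec" where
  "coord_vec A \<phi> p y = (\<lambda>\<psi>. if \<psi> \<in> A \<and> p \<in> cdom \<psi>
     then frechet_derivative (transition \<phi> \<psi>) (at (cmap \<phi> p)) y else 0)"

text \<open>The expression of a function on $TM \setminus 0$ in the induced coordinates $(x^i, y^i)$.\<close>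

definition in_coords ::
  "('m, 'n::finite) chart set \<Rightarrow> ('m \<Rightarrow> ('m, 'n) tvec \<Rightarrow> real) \<Rightarrow> ('m, 'n) chart \<Rightarrow> real^'n \<Rightarrow> real^'n \<Rightarrow> real" where
  "in_coords A F \<phi> x y = F (cinv \<phi> x) (coord_vec A \<phi> (cinv \<phi> x) y)"


section \<open>Finsler metrics and their geodesic spray\<close>

text \<open>A function on $TM \setminus 0$ is a function of a point and a tangent vector there; its values at
  zero vectors and outside of the tangent spaces are never used.\<close>

definition px :: "'n \<Rightarrow> (real^'n::finite \<Rightarrow> real^'n \<Rightarrow> real) \<Rightarrow> real^'n \<Rightarrow> real^'n \<Rightarrow> real" where
  "px i f = (\<lambda>x y. pderiv_at i (\<lambda>x'. f x' y) x)"

definition py :: "'n \<Rightarrow> (real^'n::finite \<Rightarrow> real^'n \<Rightarrow> real) \<Rightarrow> real^'n \<Rightarrow> real^'n \<Rightarrow> real" where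
  "py i f = (\<lambda>x y. pderiv_at i (\<lambda>y'. f x y') y)"

definition fundamental_tensor :: "(real^'n::finite \<Rightarrow> real^'n \<Rightarrow> real) \<Rightarrow> real^'n \<Rightarrow> real^'n \<Rightarrow> real^'n^'n" where
  "fundamental_tensor f x y = (\<chi> i j. (1/2) * py i (py j (\<lambda>x y. (f x y)\<^sup>2)) x y)"

definition finsler_metric :: "('m, 'n::finite) chart set \<Rightarrow> ('m \<Rightarrow> ('m, 'n) tvec \<Rightarrow> real) \<Rightarrow> bool" where
  "finsler_metric A F \<longleftrightarrow> (\<forall>\<phi>\<in>A.
     smooth_on (cran \<phi> \<times> (UNIV - {0})) (\<lambda>(x, y). in_coords A F \<phi> x y) \<and>
     (\<forall>x\<in>cran \<phi>. \<forall>y. y \<noteq> 0 \<longrightarrow>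
        in_coords A F \<phi> x y > 0 \<and>
        (\<forall>l>0. in_coords A F \<phi> x (l *\<^sub>R y) = l * in_coords A F \<phi> x y) \<and>
        (\<forall>z. z \<noteq> 0 \<longrightarrow> z \<bullet> (fundamental_tensor (in_coords A F \<phi>) x y *v z) > 0)))"

text \<open>The vector with entries $2G^i = g^{ij}(E_{x^\ell y^j}y^\ell - E_{x^j})$, $E = F^2/2$.\<close>

definition finsler_spray ::
  "('m, 'n::finite) chart set \<Rightarrow> ('m \<Rightarrow> ('m, 'n) tvec \<Rightarrow> real) \<Rightarrow> ('m, 'n) chart \<Rightarrow> real^'n \<Rightarrow> real^'n \<Rightarrow> real^'n" where
  "finsler_spray A F \<phi> x y =
     (let f = in_coords A F \<phi>; E = (\<lambda>x y. (1/2) * (f x y)\<^sup>2) in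
      \<chi> i. \<Sum>j\<in>UNIV. matrix_inv (fundamental_tensor f x y) $ i $ j *
             ((\<Sum>l\<in>UNIV. px l (py j E) x y * y $ l) - px j E x y))"


section \<open>Affine connections\<close>

text \<open>An affine connection is given by its Christoffel symbols \<open>\<Gamma> \<phi> x i j k\<close> $= \Gamma^i_{jk}(x)$ in every
  chart \<open>\<phi>\<close>, subject to their inhomogeneous transformation law under coordinate changes. No symmetry
  in \<open>j\<close>, \<open>k\<close> is assumed, i.e. torsion is allowed.\<close>

type_synonym ('m, 'n) christoffel = "('m, 'n) chart \<Rightarrow> real^'n \<Rightarrow> 'n \<Rightarrow> 'n \<Rightarrow> 'n \<Rightarrow> real"

definition affine_connection :: "('m, 'n::finite) chart set \<Rightarrow> ('m, 'n) christoffel \<Rightarrow> bool" where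
  "affine_connection A \<Gamma> \<longleftrightarrow>
     (\<forall>\<phi>\<in>A. \<forall>i j k. smooth_on (cran \<phi>) (\<lambda>x. \<Gamma> \<phi> x i j k)) \<and>
     (\<forall>\<phi>\<in>A. \<forall>\<psi>\<in>A. \<forall>x\<in>cmap \<phi> ` (cdom \<phi> \<inter> cdom \<psi>). \<forall>a j k.
        (let \<tau> = transition \<phi> \<psi> in
         (\<Sum>i\<in>UNIV. pderiv_at i \<tau> x $ a * \<Gamma> \<phi> x i j k) =
         pderiv_at j (pderiv_at k \<tau>) x $ a +
         (\<Sum>b\<in>UNIV. \<Sum>c\<in>UNIV. \<Gamma> \<psi> (\<tau> x) a b c * pderiv_at j \<tau> x $ b * pderiv_at k \<tau> x $ c)))"

definition torsion_free :: "('m, 'n::finite) chart set \<Rightarrow> ('m, 'n) christoffel \<Rightarrow> bool" where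
  "torsion_free A \<Gamma> \<longleftrightarrow> (\<forall>\<phi>\<in>A. \<forall>x\<in>cran \<phi>. \<forall>i j k. \<Gamma> \<phi> x i j k = \<Gamma> \<phi> x i k j)"

definition connection_spray ::
  "('m, 'n::finite) christoffel \<Rightarrow> ('m, 'n) chart \<Rightarrow> real^'n \<Rightarrow> real^'n \<Rightarrow> real^'n" where
  "connection_spray \<Gamma> \<phi> x y = (\<chi> i. \<Sum>j\<in>UNIV. \<Sum>k\<in>UNIV. \<Gamma> \<phi> x i j k * y $ j * y $ k)"


section \<open>Curves, geodesics and parallel transport\<close>

definition open_interval :: "real set \<Rightarrow> bool" where
  "open_interval I \<longleftrightarrow> open I \<and> is_interval I \<and> I \<noteq> {}"

definition smooth_curve :: "'m topology \<Rightarrow> ('m, 'n::finite) chart set \<Rightarrow> real set \<Rightarrow> (real \<Rightarrow> 'm) \<Rightarrow> bool" where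
  "smooth_curve X A I c \<longleftrightarrow> open_interval I \<and> continuous_map (top_of_set I) X c \<and>
     (\<forall>\<phi>\<in>A. smooth_on {t\<in>I. c t \<in> cdom \<phi>} (cmap \<phi> \<circ> c))"

definition velocity :: "('m, 'n::finite) chart \<Rightarrow> (real \<Rightarrow> 'm) \<Rightarrow> real \<Rightarrow> real^'n" where
  "velocity \<phi> c t = vector_derivative (cmap \<phi> \<circ> c) (at t)"

text \<open>Solutions of $\ddot c^i + P^i(c, \dot c) = 0$ with $\dot c \neq 0$. For \<open>P = finsler_spray A F\<close> these are
  the geodesics of \<open>F\<close>, for \<open>P = connection_spray \<Gamma>\<close> the nonconstant geodesics of the connection.\<close>

definition geodesic ::
  "'m topology \<Rightarrow> ('m, 'n::finite) chart set \<Rightarrow> (('m, 'n) chart \<Rightarrow> real^'n \<Rightarrow> real^'n \<Rightarrow> real^'n) \<Rightarrow>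
   real set \<Rightarrow> (real \<Rightarrow> 'm) \<Rightarrow> bool" where
  "geodesic X A P I c \<longleftrightarrow> smooth_curve X A I c \<and>
     (\<forall>\<phi>\<in>A. \<forall>t\<in>I. c t \<in> cdom \<phi> \<longrightarrow>
        velocity \<phi> c t \<noteq> 0 \<and>
        vector_derivative (velocity \<phi> c) (at t) + P \<phi> (cmap \<phi> (c t)) (velocity \<phi> c t) = 0)"

definition pos_reparam :: "real set \<Rightarrow> real set \<Rightarrow> (real \<Rightarrow> real) \<Rightarrow> bool" where
  "pos_reparam J I h \<longleftrightarrow> open_interval J \<and> h ` J = I \<and> smooth_on J h \<and> (\<forall>s\<in>J. deriv h s > 0)"

definition vector_field_along ::
  "('m, 'n::finite) chart set \<Rightarrow> real set \<Rightarrow> (real \<Rightarrow> 'm) \<Rightarrow> (real \<Rightarrow> ('m, 'n) tvec) \<Rightarrow> bool" where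
  "vector_field_along A I c V \<longleftrightarrow> (\<forall>t\<in>I. V t \<in> tangent_space A (c t)) \<and>
     (\<forall>\<phi>\<in>A. smooth_on {t\<in>I. c t \<in> cdom \<phi>} (\<lambda>t. V t \<phi>))"

definition parallel_along ::
  "('m, 'n::finite) chart set \<Rightarrow> ('m, 'n) christoffel \<Rightarrow> real set \<Rightarrow> (real \<Rightarrow> 'm) \<Rightarrow> (real \<Rightarrow> ('m, 'n) tvec) \<Rightarrow> bool" where
  "parallel_along A \<Gamma> I c V \<longleftrightarrow> vector_field_along A I c V \<and>
     (\<forall>\<phi>\<in>A. \<forall>t\<in>I. c t \<in> cdom \<phi> \<longrightarrow> (\<forall>i.
        vector_derivative (\<lambda>s. V s \<phi>) (at t) $ i +
        (\<Sum>j\<in>UNIV. \<Sum>k\<in>UNIV. \<Gamma> \<phi> (cmap \<phi> (c t)) i j k * velocity \<phi> c t $ j * V t \<phi> $ k) = 0))"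

definition transport_preserves ::
  "'m topology \<Rightarrow> ('m, 'n::finite) chart set \<Rightarrow> ('m, 'n) christoffel \<Rightarrow> ('m \<Rightarrow> ('m, 'n) tvec \<Rightarrow> real) \<Rightarrow> bool" where
  "transport_preserves X A \<Gamma> F \<longleftrightarrow> (\<forall>I c V.
     smooth_curve X A I c \<and> parallel_along A \<Gamma> I c V \<and> (\<forall>t\<in>I. V t \<noteq> (\<lambda>_. 0)) \<longrightarrow>
     (\<lambda>t. F (c t) (V t)) constant_on I)"


section \<open>Special classes of Finsler metrics\<close>

text \<open>Of the two equivalent definitions of Berwald metrics (geodesics of \<open>F\<close> are those of an affine
  connection; \<open>F\<close> is preserved by a torsion-free connection) this is the second one.\<close>

definition berwald :: "'m topology \<Rightarrow> ('m, 'n::finite) chart set \<Rightarrow> ('m \<Rightarrow> ('m, 'n) tvec \<Rightarrow> real) \<Rightarrow> bool" where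
  "berwald X A F \<longleftrightarrow>
     (\<exists>\<Gamma>. affine_connection A \<Gamma> \<and> torsion_free A \<Gamma> \<and> transport_preserves X A \<Gamma> F)"

definition generalized_berwald :: "'m topology \<Rightarrow> ('m, 'n::finite) chart set \<Rightarrow> ('m \<Rightarrow> ('m, 'n) tvec \<Rightarrow> real) \<Rightarrow> bool" where
  "generalized_berwald X A F \<longleftrightarrow> (\<exists>\<Gamma>. affine_connection A \<Gamma> \<and> transport_preserves X A \<Gamma> F)"

definition douglas :: "'m topology \<Rightarrow> ('m, 'n::finite) chart set \<Rightarrow> ('m \<Rightarrow> ('m, 'n) tvec \<Rightarrow> real) \<Rightarrow> bool" where
  "douglas X A F \<longleftrightarrow> (\<exists>\<Gamma>. affine_connection A \<Gamma> \<and>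
     (\<forall>I c. geodesic X A (finsler_spray A F) I c \<longrightarrow>
        (\<exists>J h. pos_reparam J I h \<and> geodesic X A (connection_spray \<Gamma>) J (c \<circ> h))) \<and>
     (\<forall>I c. geodesic X A (connection_spray \<Gamma>) I c \<longrightarrow>
        (\<exists>J h. pos_reparam J I h \<and> geodesic X A (finsler_spray A F) J (c \<circ> h))))"

definition riemannian_metric ::
  "('m, 'n::finite) chart set \<Rightarrow> ('m \<Rightarrow> ('m, 'n) tvec \<Rightarrow> ('m, 'n) tvec \<Rightarrow> real) \<Rightarrow> bool" where
  "riemannian_metric A g \<longleftrightarrow> (\<forall>\<phi>\<in>A. \<exists>a :: real^'n \<Rightarrow> real^'n^'n.
     smooth_on (cran \<phi>) a \<and>
     (\<forall>x\<in>cran \<phi>. transpose (a x) = a x \<and> (\<forall>z. z \<noteq> 0 \<longrightarrow> z \<bullet> (a x *v z) > 0)) \<and>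
     (\<forall>p\<in>cdom \<phi>. \<forall>v\<in>tangent_space A p. \<forall>w\<in>tangent_space A p.
        g p v w = v \<phi> \<bullet> (a (cmap \<phi> p) *v w \<phi>)))"

definition one_form :: "('m, 'n::finite) chart set \<Rightarrow> ('m \<Rightarrow> ('m, 'n) tvec \<Rightarrow> real) \<Rightarrow> bool" where
  "one_form A \<beta> \<longleftrightarrow> (\<forall>\<phi>\<in>A. \<exists>b :: real^'n \<Rightarrow> real^'n. smooth_on (cran \<phi>) b \<and>
     (\<forall>p\<in>cdom \<phi>. \<forall>v\<in>tangent_space A p. \<beta> p v = b (cmap \<phi> p) \<bullet> v \<phi>))"

definition randers :: "'m topology \<Rightarrow> ('m, 'n::finite) chart set \<Rightarrow> ('m \<Rightarrow> ('m, 'n) tvec \<Rightarrow> real) \<Rightarrow> bool" where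
  "randers X A F \<longleftrightarrow> (\<exists>g \<beta>. riemannian_metric A g \<and> one_form A \<beta> \<and>
     (\<forall>p\<in>topspace X. \<forall>v\<in>tangent_space A p. v \<noteq> (\<lambda>_. 0) \<longrightarrow> F p v = sqrt (g p v v) + \<beta> p v))"

end

(* Let t be the torsion vector of the metric connection, N its Christoffel symbols and D those of
   the connection from the Douglas condition.  Invariance of F under parallel transport expresses
   the x-derivatives of F through its y-derivatives; inserted into the spray this turns the Douglas
   condition at a point x into the relation

     dF(t) = C h,   F_{y^i y^j} = h w_i w_j,   w = (y^2, -y^1),

   on T_xM - 0, with C the cubic form -w((D - N)(y, y)).  On the lines +-n + R t both dF(t) and its
   reflection solve the same equation u = c u' with a cubic polynomial c, and their limits at the two
   ends are F(t), F(-t) in opposite order.  If t does not vanish, this forces, after a shift of the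
   line, c(s) = s (1 + a s^2) with a > 0, and integrating twice gives F = alpha + beta on T_xM.
   Being a Randers norm is a closed condition on the fibre, and it is preserved by the linear
   parallel transport, so on a connected surface one fibre with nonzero t makes F a Randers metric,
   while t = 0 everywhere means that the metric connection is torsion-free. *)

theory Submission
  imports Defs
begin

section \<open>Calculus of smooth maps\<close>

text \<open>The fibre relation becomes an ordinary differential equation because w(t) is constant on
  lines parallel to t: there u = dF(t) has derivative h w(t)^2, which is positive by strict
  convexity. With the origin moved to the zero of u, comparing difference quotients gives the cubic
  the form s (1 + b s + a s^2). The obstacle is b. The quantity (u/s)^2 (1 + b s + a s^2) has
  derivative - b (u/s)^2 and tends at each end to a times the squared limit of u. So the sign of b
  decides at which end this value is larger. The reflected line obeys the same equation with F(t)
  and F(-t) interchanged, and would give the opposite answer; hence b = 0. This comparison is where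
  F is used on the whole fibre rather than on a half plane.

  Both hypotheses speak of curves only. To get equations at a point, geodesics and parallel fields
  with prescribed initial values have to be constructed, whence the local existence theory. A
  reparametrized geodesic gives the spray only at some positive multiple of the given vector; the
  relation is homogeneous, so this suffices.\<close>

lemma frechet_derivative_cong_open:
  assumes "open S" "x \<in> S" "\<And>x. x \<in> S \<Longrightarrow> f x = g x"
  shows "frechet_derivative f (at x) = frechet_derivative g (at x)"
proof -
  have "(f has_derivative f') (at x) \<longleftrightarrow> (g has_derivative f') (at x)" for f'
    using has_derivative_transform_within_open[OF _ assms(1,2), of f f' UNIV g]
      has_derivative_transform_within_open[OF _ assms(1,2), of g f' UNIV f] assms(3) by metis
  then show ?thesis unfolding frechet_derivative_def by simp
qed

lemma differentiable_cong_open: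
  assumes "open S" "x \<in> S" "\<And>x. x \<in> S \<Longrightarrow> f x = g x" "f differentiable (at x)"
  shows "g differentiable (at x)"
  using assms has_derivative_transform_within_open[OF _ assms(1,2), of f _ UNIV g]
  unfolding differentiable_def by metis

lemma C_diff_on_cong:
  assumes "open S" "\<And>x. x \<in> S \<Longrightarrow> f x = g x" "C_diff_on k S f"
  shows "C_diff_on k S g"
  using assms(2,3)
proof (induction k arbitrary: f g)
  case 0
  then show ?case using continuous_on_cong by (metis C_diff_on.simps(1))
next
  case (Suc k)
  have "C_diff_on k S (\<lambda>x. frechet_derivative g (at x) v)" for v
    using Suc.IH[of "\<lambda>x. frechet_derivative f (at x) v" "\<lambda>x. frechet_derivative g (at x) v"]
      frechet_derivative_cong_open[OF assms(1), of _ f g] Suc.prems by auto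
  moreover have "g differentiable (at x)" if "x \<in> S" for x
    using differentiable_cong_open[OF assms(1) that, of f g] Suc.prems that by auto
  ultimately show ?case by simp
qed

lemma C_diff_on_SucD: "C_diff_on (Suc k) S f \<Longrightarrow> C_diff_on k S f"
proof (induction k arbitrary: f)
  case 0
  then show ?case
    by (auto intro!: continuous_at_imp_continuous_on differentiable_imp_continuous_within)
next
  case (Suc k)
  then show ?case by (metis C_diff_on.simps(2))
qed

lemma C_diff_on_le:
  assumes "C_diff_on m S f" "k \<le> m"
  shows "C_diff_on k S f"
  using assms(2) by (induction rule: inc_induct) (use assms(1) in \<open>blast intro: C_diff_on_SucD\<close>)+

lemma C_diff_on_subset: "C_diff_on k S f \<Longrightarrow> T \<subseteq> S \<Longrightarrow> C_diff_on k T f"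
  by (induction k arbitrary: f) (auto intro: continuous_on_subset)

text \<open>Accepts any formula \<open>f'\<close> for the derivative, which is the form in which the
  sum, product and chain rules deliver it.\<close>

lemma C_diff_on_SucI:
  assumes "open S" "\<And>x. x \<in> S \<Longrightarrow> (f has_derivative f' x) (at x)"
    "\<And>v. C_diff_on k S (\<lambda>x. f' x v)"
  shows "C_diff_on (Suc k) S f"
proof -
  have "C_diff_on k S (\<lambda>x. frechet_derivative f (at x) v)" for v
    by (rule C_diff_on_cong[OF assms(1) _ assms(3)[of v]]) (metis assms(2) frechet_derivative_at)
  then show ?thesis using assms(2) by (auto simp: differentiable_def)
qed

lemma C_diff_on_SucD_deriv:
  assumes "C_diff_on (Suc k) S f" "x \<in> S"
  shows "(f has_derivative frechet_derivative f (at x)) (at x)"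
  using assms frechet_derivative_works by auto

lemma C_diff_on_const: "open S \<Longrightarrow> C_diff_on k S (\<lambda>x. c)"
proof (induction k arbitrary: c)
  case (Suc k)
  then show ?case by (intro C_diff_on_SucI[where f'="\<lambda>_ _. 0"]) auto
qed simp

lemma C_diff_on_linear:
  assumes "bounded_linear L" "open S" "C_diff_on k S f"
  shows "C_diff_on k S (\<lambda>x. L (f x))"
  using assms(3)
proof (induction k arbitrary: f)
  case 0
  then show ?case using bounded_linear.continuous_on[OF assms(1)] by simp
next
  case (Suc k)
  show ?case
  proof (rule C_diff_on_SucI[OF assms(2)])
    show "((\<lambda>x. L (f x)) has_derivative (\<lambda>v. L (frechet_derivative f (at x) v))) (at x)"
      if "x \<in> S" for x
      using bounded_linear.has_derivative[OF assms(1) C_diff_on_SucD_deriv[OF Suc.prems that]] .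
    show "C_diff_on k S (\<lambda>x. L (frechet_derivative f (at x) v))" for v
      using Suc by auto
  qed
qed

lemma C_diff_on_ident: "open S \<Longrightarrow> C_diff_on k S (\<lambda>x. x)"
proof (cases k)
  case (Suc m)
  assume "open S"
  then show ?thesis unfolding Suc
    by (intro C_diff_on_SucI[where f'="\<lambda>_ v. v"]) (auto intro: C_diff_on_const)
qed auto

lemma C_diff_on_add:
  assumes "open S" "C_diff_on k S f" "C_diff_on k S g"
  shows "C_diff_on k S (\<lambda>x. f x + g x)"
  using assms(2,3)
proof (induction k arbitrary: f g)
  case 0
  then show ?case by (auto intro: continuous_intros)
next
  case (Suc k)
  show ?case
  proof (rule C_diff_on_SucI[OF assms(1)])
    show "((\<lambda>x. f x + g x) has_derivative
      (\<lambda>v. frechet_derivative f (at x) v + frechet_derivative g (at x) v)) (at x)" if "x \<in> S" for x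
      using has_derivative_add[OF C_diff_on_SucD_deriv[OF Suc.prems(1) that] C_diff_on_SucD_deriv[OF Suc.prems(2) that]] .
    show "C_diff_on k S (\<lambda>x. frechet_derivative f (at x) v + frechet_derivative g (at x) v)" for v
      using Suc by auto
  qed
qed

lemma C_diff_on_sum:
  assumes "open S" "\<And>i. i \<in> I \<Longrightarrow> C_diff_on k S (f i)"
  shows "C_diff_on k S (\<lambda>x. \<Sum>i\<in>I. f i x)"
  using assms(2)
  by (induction I rule: infinite_finite_induct) (auto intro: C_diff_on_const C_diff_on_add assms(1))

lemma C_diff_on_bilinear:
  assumes "bounded_bilinear B" "open S" "C_diff_on k S f" "C_diff_on k S g"
  shows "C_diff_on k S (\<lambda>x. B (f x) (g x))"
  using assms(3,4)
proof (induction k arbitrary: f g)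
  case 0
  then show ?case using bounded_bilinear.continuous_on[OF assms(1)] by simp
next
  case (Suc k)
  show ?case
  proof (rule C_diff_on_SucI[OF assms(2)])
    show "((\<lambda>x. B (f x) (g x)) has_derivative
      (\<lambda>v. B (f x) (frechet_derivative g (at x) v) + B (frechet_derivative f (at x) v) (g x))) (at x)"
      if "x \<in> S" for x
      using bounded_bilinear.FDERIV[OF assms(1) C_diff_on_SucD_deriv[OF Suc.prems(1) that]
          C_diff_on_SucD_deriv[OF Suc.prems(2) that]] .
    show "C_diff_on k S (\<lambda>x. B (f x) (frechet_derivative g (at x) v) +
        B (frechet_derivative f (at x) v) (g x))" for v
      using Suc.prems C_diff_on_SucD[OF Suc.prems(1)] C_diff_on_SucD[OF Suc.prems(2)]
      by (intro C_diff_on_add[OF assms(2)] Suc.IH) auto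
  qed
qed

text \<open>Induction needs the derivative of the composite to be built from functions of lower
  class. Expanding \<open>?Df x v\<close> in a basis turns it into a finite sum of products of a
  coordinate of \<open>?Df x v\<close> with a partial derivative of \<open>g\<close> along
  \<open>f\<close>. This is why the middle space is Euclidean.\<close>

lemma C_diff_on_compose:
  fixes f :: "'a::real_normed_vector \<Rightarrow> 'b::euclidean_space"
  assumes "open S" "open T" "f ` S \<subseteq> T" "C_diff_on k S f" "C_diff_on k T g"
  shows "C_diff_on k S (\<lambda>x. g (f x))"
  using assms(4,5)
proof (induction k arbitrary: g)
  case 0
  then show ?case using continuous_on_compose2 assms(3) by (metis C_diff_on.simps(1))
next
  case (Suc k)
  let ?Df = "\<lambda>x. frechet_derivative f (at x)" and ?Dg = "\<lambda>y. frechet_derivative g (at y)"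
  have *: "((\<lambda>x. g (f x)) has_derivative (\<lambda>v. \<Sum>b\<in>Basis. (?Df x v \<bullet> b) *\<^sub>R ?Dg (f x) b)) (at x)"
    if "x \<in> S" for x
  proof -
    have df: "(f has_derivative ?Df x) (at x)" and dg: "(g has_derivative ?Dg (f x)) (at (f x))"
      using C_diff_on_SucD_deriv Suc.prems that assms(3) by blast+
    have "?Dg (f x) (?Df x v) = (\<Sum>b\<in>Basis. (?Df x v \<bullet> b) *\<^sub>R ?Dg (f x) b)" for v
    proof -
      have l: "linear (?Dg (f x))" using dg has_derivative_linear by blast
      have "?Dg (f x) (?Df x v) = ?Dg (f x) (\<Sum>b\<in>Basis. (?Df x v \<bullet> b) *\<^sub>R b)"
        by (simp add: euclidean_representation)
      also have "\<dots> = (\<Sum>b\<in>Basis. (?Df x v \<bullet> b) *\<^sub>R ?Dg (f x) b)"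
        unfolding linear_sum[OF l] linear_cmul[OF l] ..
      finally show ?thesis .
    qed
    then show ?thesis using has_derivative_compose[OF df dg] by simp
  qed
  show ?case
  proof (rule C_diff_on_SucI[OF assms(1) *])
    show "C_diff_on k S (\<lambda>x. \<Sum>b\<in>Basis. (?Df x v \<bullet> b) *\<^sub>R ?Dg (f x) b)" for v
    proof (intro C_diff_on_sum C_diff_on_bilinear[OF bounded_bilinear_scaleR] assms(1))
      show "C_diff_on k S (\<lambda>x. ?Df x v \<bullet> b)" for b
        using Suc.prems(1) by (intro C_diff_on_linear[OF bounded_linear_inner_left] assms(1)) auto
      show "C_diff_on k S (\<lambda>x. ?Dg (f x) b)" for b
        using Suc.prems C_diff_on_SucD[OF Suc.prems(1)] by (intro Suc.IH) auto
    qed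
  qed auto
qed

lemma C_diff_on_continuous_on: "C_diff_on k S f \<Longrightarrow> continuous_on S f"
  using C_diff_on_le[of k S f 0] by simp

lemma smooth_on_cong:
  "open S \<Longrightarrow> (\<And>x. x \<in> S \<Longrightarrow> f x = g x) \<Longrightarrow> smooth_on S f \<Longrightarrow> smooth_on S g"
  unfolding smooth_on_def using C_diff_on_cong by blast

lemma smooth_on_subset: "smooth_on S f \<Longrightarrow> T \<subseteq> S \<Longrightarrow> smooth_on T f"
  unfolding smooth_on_def using C_diff_on_subset by blast

lemma smooth_on_const: "open S \<Longrightarrow> smooth_on S (\<lambda>x. c)"
  unfolding smooth_on_def using C_diff_on_const by blast

lemma smooth_on_ident: "open S \<Longrightarrow> smooth_on S (\<lambda>x. x)"
  unfolding smooth_on_def using C_diff_on_ident by blast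

lemma smooth_on_linear: "bounded_linear L \<Longrightarrow> open S \<Longrightarrow> smooth_on S f \<Longrightarrow> smooth_on S (\<lambda>x. L (f x))"
  unfolding smooth_on_def using C_diff_on_linear by blast

lemma smooth_on_add: "open S \<Longrightarrow> smooth_on S f \<Longrightarrow> smooth_on S g \<Longrightarrow> smooth_on S (\<lambda>x. f x + g x)"
  unfolding smooth_on_def using C_diff_on_add by blast

lemma smooth_on_sum: "open S \<Longrightarrow> (\<And>i. i \<in> I \<Longrightarrow> smooth_on S (f i)) \<Longrightarrow> smooth_on S (\<lambda>x. \<Sum>i\<in>I. f i x)"
  unfolding smooth_on_def using C_diff_on_sum[of S I _ f] by blast

lemma smooth_on_bilinear:
  "bounded_bilinear B \<Longrightarrow> open S \<Longrightarrow> smooth_on S f \<Longrightarrow> smooth_on S g \<Longrightarrow> smooth_on S (\<lambda>x. B (f x) (g x))"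
  unfolding smooth_on_def using C_diff_on_bilinear by blast

lemmas smooth_on_mult = smooth_on_bilinear[OF bounded_bilinear_mult]
lemmas smooth_on_scaleR = smooth_on_bilinear[OF bounded_bilinear_scaleR]

lemma smooth_on_compose:
  fixes f :: "'a::real_normed_vector \<Rightarrow> 'b::euclidean_space"
  assumes "open S" "open T" "f ` S \<subseteq> T" "smooth_on S f" "smooth_on T g"
  shows "smooth_on S (\<lambda>x. g (f x))"
  using assms C_diff_on_compose[OF assms(1-3)] unfolding smooth_on_def by blast

lemma smooth_on_Pair:
  assumes "open S" "smooth_on S f" "smooth_on S g"
  shows "smooth_on S (\<lambda>x. (f x, g x))"
proof -
  have "smooth_on S (\<lambda>x. (f x, 0) + (0, g x))"
    by (intro smooth_on_add assms smooth_on_linear[where L="\<lambda>y. (y, 0)"] smooth_on_linear[where L="\<lambda>y. (0, y)"]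
        bounded_linear_Pair bounded_linear_ident bounded_linear_zero)
  then show ?thesis by simp
qed

lemma smooth_on_vec_nth: "open S \<Longrightarrow> smooth_on S f \<Longrightarrow> smooth_on S (\<lambda>x. f x $ i)"
  by (rule smooth_on_linear[OF bounded_linear_vec_nth])

lemma smooth_on_vec:
  assumes "open S" "\<And>i. smooth_on S (\<lambda>x. f x $ i)"
  shows "smooth_on S (f :: _ \<Rightarrow> real^'n)"
proof -
  have "smooth_on S (\<lambda>x. \<Sum>i\<in>UNIV. f x $ i *\<^sub>R (axis i 1 :: real^'n))"
    by (intro smooth_on_sum smooth_on_scaleR smooth_on_const assms)
  moreover have "(\<Sum>i\<in>UNIV. f x $ i *\<^sub>R (axis i 1 :: real^'n)) = f x" for x
    using basis_expansion[of "f x"] by (simp add: scalar_mult_eq_scaleR)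
  ultimately show ?thesis by simp
qed

lemma smooth_on_has_derivative:
  "smooth_on S f \<Longrightarrow> x \<in> S \<Longrightarrow> (f has_derivative frechet_derivative f (at x)) (at x)"
  unfolding smooth_on_def using C_diff_on_SucD_deriv by blast

lemma smooth_on_frechet: "smooth_on S f \<Longrightarrow> smooth_on S (\<lambda>x. frechet_derivative f (at x) v)"
  unfolding smooth_on_def by (metis C_diff_on.simps(2))

lemma smooth_on_continuous_on: "smooth_on S f \<Longrightarrow> continuous_on S f"
  unfolding smooth_on_def using C_diff_on_continuous_on by blast

lemma linear_sum_axis:
  fixes L :: "real^'n::finite \<Rightarrow> 'b::real_vector"
  assumes L: "linear L"
  shows "L h = (\<Sum>k\<in>UNIV. h $ k *\<^sub>R L (axis k 1))"
proof -
  have "L h = L (\<Sum>k\<in>UNIV. h $ k *\<^sub>R axis k 1)"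
    using basis_expansion[of h] by (simp add: scalar_mult_eq_scaleR)
  then show ?thesis unfolding linear_sum[OF L] linear_cmul[OF L] .
qed

text \<open>The mean value theorem is used twice: in \<open>s\<close> for the increment in direction
  \<open>w\<close>, then in \<open>t\<close> for the derivative in direction \<open>v\<close>. The
  left side is symmetric in \<open>v\<close> and \<open>w\<close>, the right side is not; the
  symmetry of mixed derivatives comes from this.\<close>

lemma second_difference:
  fixes f :: "'a::real_normed_vector \<Rightarrow> real"
  assumes S: "\<And>s t. 0 \<le> s \<Longrightarrow> s \<le> h \<Longrightarrow> 0 \<le> t \<Longrightarrow> t \<le> h \<Longrightarrow> x + s *\<^sub>R v + t *\<^sub>R w \<in> S"
    and f: "C_diff_on 2 S f" and h: "h > 0"
  shows "\<exists>s t. 0 \<le> s \<and> s \<le> h \<and> 0 \<le> t \<and> t \<le> h \<and>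
    f (x + h *\<^sub>R v + h *\<^sub>R w) - f (x + h *\<^sub>R v) - f (x + h *\<^sub>R w) + f x =
    h * h * frechet_derivative (\<lambda>x. frechet_derivative f (at x) v) (at (x + s *\<^sub>R v + t *\<^sub>R w)) w"
proof -
  define Df where "Df = (\<lambda>x. frechet_derivative f (at x) v)"
  define Dff where "Dff = (\<lambda>x. frechet_derivative Df (at x) w)"
  have f1: "(f has_derivative frechet_derivative f (at y)) (at y)"
    and f2: "(Df has_derivative frechet_derivative Df (at y)) (at y)" if "y \<in> S" for y
    using f that C_diff_on_SucD_deriv[of "Suc 0" S f y] C_diff_on_SucD_deriv[of 0 S Df y]
    unfolding Df_def by (auto simp: numeral_2_eq_2)
  have d1: "((\<lambda>s. f (x + s *\<^sub>R v + t *\<^sub>R w)) has_field_derivative Df (x + s *\<^sub>R v + t *\<^sub>R w)) (at s)"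
    if "0 \<le> s" "s \<le> h" "0 \<le> t" "t \<le> h" for s t
  proof -
    have "((\<lambda>s. x + s *\<^sub>R v + t *\<^sub>R w) has_derivative (\<lambda>r. r *\<^sub>R v)) (at s)"
      by (auto intro!: derivative_eq_intros)
    note r = has_derivative_compose[OF this f1[OF S[OF that]]]
    have "linear (frechet_derivative f (at (x + s *\<^sub>R v + t *\<^sub>R w)))"
      using f1[OF S[OF that]] has_derivative_linear by blast
    then show ?thesis using r unfolding has_field_derivative_def Df_def
      by (simp add: linear_cmul mult.commute[of _ "frechet_derivative _ _ _"] mult_commute_abs)
  qed
  have d2: "((\<lambda>t. Df (x + s *\<^sub>R v + t *\<^sub>R w)) has_field_derivative Dff (x + s *\<^sub>R v + t *\<^sub>R w)) (at t)"
    if "0 \<le> s" "s \<le> h" "0 \<le> t" "t \<le> h" for s t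
  proof -
    have "((\<lambda>t. x + s *\<^sub>R v + t *\<^sub>R w) has_derivative (\<lambda>r. r *\<^sub>R w)) (at t)"
      by (auto intro!: derivative_eq_intros)
    note r = has_derivative_compose[OF this f2[OF S[OF that]]]
    have "linear (frechet_derivative Df (at (x + s *\<^sub>R v + t *\<^sub>R w)))"
      using f2[OF S[OF that]] has_derivative_linear by blast
    then show ?thesis using r unfolding has_field_derivative_def Dff_def
      by (simp add: linear_cmul mult_commute_abs)
  qed
  define D where "D s = f (x + s *\<^sub>R v + h *\<^sub>R w) - f (x + s *\<^sub>R v + 0 *\<^sub>R w)" for s
  have "(D has_field_derivative Df (x + s *\<^sub>R v + h *\<^sub>R w) - Df (x + s *\<^sub>R v + 0 *\<^sub>R w)) (at s)"
    if "0 \<le> s" "s \<le> h" for s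
    unfolding D_def using h by (intro DERIV_diff d1 that) auto
  from MVT2[OF h this] obtain s where s: "0 < s" "s < h"
    "D h - D 0 = h * (Df (x + s *\<^sub>R v + h *\<^sub>R w) - Df (x + s *\<^sub>R v + 0 *\<^sub>R w))" by auto
  from MVT2[OF h d2[of s]] s obtain t where t: "0 < t" "t < h"
    "Df (x + s *\<^sub>R v + h *\<^sub>R w) - Df (x + s *\<^sub>R v + 0 *\<^sub>R w) = h * Dff (x + s *\<^sub>R v + t *\<^sub>R w)" by auto
  show ?thesis
    using s t unfolding D_def Dff_def Df_def by (intro exI[of _ s] exI[of _ t]) auto
qed

text \<open>Evaluating one second difference in both orders makes the two mixed derivatives agree at
  a pair of points arbitrarily close to \<open>x\<close>; continuity of both then excludes a gap at
  \<open>x\<close>.\<close>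

lemma mixed_derivative_symmetric:
  fixes f :: "'a::real_normed_vector \<Rightarrow> real"
  assumes S: "open S" "x \<in> S" and f: "C_diff_on 2 S f"
  shows "frechet_derivative (\<lambda>x. frechet_derivative f (at x) v) (at x) w =
    frechet_derivative (\<lambda>x. frechet_derivative f (at x) w) (at x) v" (is "?A x = ?B x")
proof (rule ccontr)
  assume ne: "?A x \<noteq> ?B x"
  define e where "e = \<bar>?A x - ?B x\<bar> / 2"
  have e: "e > 0" using ne by (simp add: e_def)
  have cA: "continuous_on S ?A" and cB: "continuous_on S ?B" using f by (auto simp: numeral_2_eq_2)
  obtain d0 where d0: "d0 > 0" "ball x d0 \<subseteq> S" using S openE by blast
  obtain d1 where d1: "d1 > 0" "\<And>y. y \<in> S \<Longrightarrow> dist y x < d1 \<Longrightarrow> dist (?A y) (?A x) < e"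
    using cA S(2) e unfolding continuous_on_iff by metis
  obtain d2 where d2: "d2 > 0" "\<And>y. y \<in> S \<Longrightarrow> dist y x < d2 \<Longrightarrow> dist (?B y) (?B x) < e"
    using cB S(2) e unfolding continuous_on_iff by metis
  define d where "d = min d0 (min d1 d2)"
  have d: "d > 0" using d0 d1 d2 by (simp add: d_def)
  \<comment> \<open>Small enough for the whole parallelogram with sides \<open>h v\<close> and
    \<open>h w\<close> to stay within distance \<open>d\<close> of \<open>x\<close>; the summand 1
    covers \<open>v = w = 0\<close>.\<close>
  define h where "h = d / (2 * (norm v + norm w + 1))"
  have nvw: "norm v + norm w + 1 > 0" by (smt (verit) norm_ge_zero)
  then have h: "h > 0" using d by (simp add: h_def)
  have hs: "h * norm v + h * norm w < d"
  proof -
    have "h * (norm v + norm w + 1) = d / 2" using nvw by (simp add: h_def divide_simps)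
    then show ?thesis using h d by (simp add: algebra_simps)
  qed
  have near: "dist (x + s *\<^sub>R v + t *\<^sub>R w) x < d" if "0 \<le> s" "s \<le> h" "0 \<le> t" "t \<le> h" for s t
  proof -
    have "norm (s *\<^sub>R v + t *\<^sub>R w) \<le> s * norm v + t * norm w"
      using norm_triangle_ineq[of "s *\<^sub>R v" "t *\<^sub>R w"] that by simp
    also have "\<dots> \<le> h * norm v + h * norm w" using that by (intro add_mono mult_right_mono) auto
    finally show ?thesis using hs by (simp add: dist_norm add.assoc)
  qed
  have inS: "x + s *\<^sub>R v + t *\<^sub>R w \<in> S" if "0 \<le> s" "s \<le> h" "0 \<le> t" "t \<le> h" for s t
    using near[OF that] d0 by (auto simp: d_def dist_commute subset_iff)
  obtain s t where st: "0 \<le> s" "s \<le> h" "0 \<le> t" "t \<le> h"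
    "f (x + h *\<^sub>R v + h *\<^sub>R w) - f (x + h *\<^sub>R v) - f (x + h *\<^sub>R w) + f x = h * h * ?A (x + s *\<^sub>R v + t *\<^sub>R w)"
    using second_difference[OF inS f h] by auto
  have inS': "x + s *\<^sub>R w + t *\<^sub>R v \<in> S" if "0 \<le> s" "s \<le> h" "0 \<le> t" "t \<le> h" for s t
    using inS[of t s] that by (simp add: algebra_simps)
  obtain s' t' where st': "0 \<le> s'" "s' \<le> h" "0 \<le> t'" "t' \<le> h"
    "f (x + h *\<^sub>R w + h *\<^sub>R v) - f (x + h *\<^sub>R w) - f (x + h *\<^sub>R v) + f x = h * h * ?B (x + s' *\<^sub>R w + t' *\<^sub>R v)"
    using second_difference[OF inS' f h] by auto
  have "h * h * ?A (x + s *\<^sub>R v + t *\<^sub>R w) = h * h * ?B (x + t' *\<^sub>R v + s' *\<^sub>R w)"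
    using st(5) st'(5) by (simp add: algebra_simps)
  then have eq: "?A (x + s *\<^sub>R v + t *\<^sub>R w) = ?B (x + t' *\<^sub>R v + s' *\<^sub>R w)" using h by simp
  have "dist (?A (x + s *\<^sub>R v + t *\<^sub>R w)) (?A x) < e"
    using d1(2) inS near st by (auto simp: d_def)
  moreover have "dist (?B (x + t' *\<^sub>R v + s' *\<^sub>R w)) (?B x) < e"
    using d2(2) inS near st' by (auto simp: d_def)
  ultimately show False using eq unfolding e_def dist_real_def by (simp add: abs_if split: if_splits)
qed

section \<open>Local existence for ordinary differential equations\<close>

text \<open>Continuity is asked only along basis vectors because \<open>C_diff_on\<close> provides
  derivatives one direction at a time. The sum of the suprema of these partial derivatives over the
  compact ball bounds the operator norm.\<close>

lemma frechet_continuous_imp_lipschitz_cball: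
  fixes f :: "'a::euclidean_space \<Rightarrow> 'b::real_normed_vector"
  assumes df: "\<And>x. x \<in> cball z r \<Longrightarrow> (f has_derivative f' x) (at x)"
    and cont: "\<And>b. b \<in> Basis \<Longrightarrow> continuous_on (cball z r) (\<lambda>x. f' x b)"
  shows "\<exists>L. \<forall>x\<in>cball z r. \<forall>y\<in>cball z r. norm (f x - f y) \<le> L * norm (x - y)"
proof -
  have "\<exists>B. \<forall>x\<in>cball z r. norm (f' x b) \<le> B" if "b \<in> Basis" for b
  proof -
    have "bounded ((\<lambda>x. f' x b) ` cball z r)"
      by (intro compact_imp_bounded compact_continuous_image cont that compact_cball)
    then show ?thesis by (auto simp: bounded_iff)
  qed
  then obtain B where B: "\<And>b x. b \<in> Basis \<Longrightarrow> x \<in> cball z r \<Longrightarrow> norm (f' x b) \<le> B b" by metis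
  have "onorm (f' x) \<le> (\<Sum>b\<in>Basis. B b)" if x: "x \<in> cball z r" for x
  proof (rule onorm_le)
    fix h :: 'a
    have l: "linear (f' x)" using df[OF x] has_derivative_linear by blast
    have "f' x h = f' x (\<Sum>b\<in>Basis. (h \<bullet> b) *\<^sub>R b)" by (simp add: euclidean_representation)
    also have "\<dots> = (\<Sum>b\<in>Basis. (h \<bullet> b) *\<^sub>R f' x b)"
      unfolding linear_sum[OF l] linear_cmul[OF l] ..
    also have "norm \<dots> \<le> (\<Sum>b\<in>Basis. B b * norm h)"
    proof (rule sum_norm_le)
      fix b :: 'a assume b: "b \<in> Basis"
      have "norm ((h \<bullet> b) *\<^sub>R f' x b) = norm (f' x b) * \<bar>h \<bullet> b\<bar>" by simp
      also have "\<dots> \<le> B b * norm h"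
        using B[OF b x] Basis_le_norm[OF b, of h] order_trans[OF norm_ge_zero B[OF b x]]
        by (intro mult_mono) auto
      finally show "norm ((h \<bullet> b) *\<^sub>R f' x b) \<le> B b * norm h" .
    qed
    finally show "norm (f' x h) \<le> (\<Sum>b\<in>Basis. B b) * norm h"
      unfolding sum_distrib_right .
  qed
  note on = this
  have "norm (f x - f y) \<le> (\<Sum>b\<in>Basis. B b) * norm (x - y)"
    if "x \<in> cball z r" "y \<in> cball z r" for x y
    by (rule differentiable_bound[OF convex_cball has_derivative_at_withinI[OF df] on that])
  then show ?thesis by blast
qed

text \<open>The Picard operator is written as \<open>z\<close> plus the integral over \<open>[-T, t]\<close> minus the integral over
  \<open>[-T, 0]\<close>, which avoids oriented integrals for negative \<open>t\<close>.\<close>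

lemma picard:
  fixes f :: "'a::euclidean_space \<Rightarrow> 'a"
  assumes lip: "\<And>x y. x \<in> cball z r \<Longrightarrow> y \<in> cball z r \<Longrightarrow> norm (f x - f y) \<le> L * norm (x - y)"
    and f_cont: "continuous_on (cball z r) f"
    and M: "\<And>x. x \<in> cball z r \<Longrightarrow> norm (f x) \<le> M"
    and r: "r > 0" and L: "L \<ge> 0" and T: "T > 0" "3 * T * M \<le> r" "3 * T * L \<le> 1/2"
  shows "\<exists>u. u 0 = z \<and> (\<forall>t\<in>{-T<..<T}. u t \<in> cball z r \<and> (u has_vector_derivative f (u t)) (at t))"
proof -
  define B where "B = PiC UNIV (\<lambda>_::real. cball z r)"
  \<comment> \<open>Clamping the time makes every iterate a bounded continuous function on the whole
    line, so the contraction argument runs in the complete space of such functions.\<close>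
  define cl where "cl t = max (-T) (min T t)" for t :: real
  have cl: "-T \<le> cl t" "cl t \<le> T" for t using T by (auto simp: cl_def)
  have cl_id: "cl t = t" if "t \<in> {-T..T}" for t using that by (auto simp: cl_def)
  have inB: "apply_bcontfun u s \<in> cball z r" if "u \<in> B" for u s
    using that unfolding B_def by (auto simp: mem_PiC_iff)
  define g where "g u s = f (apply_bcontfun u s)" for u :: "real \<Rightarrow>\<^sub>C 'a" and s
  have g_cont: "continuous_on A (g u)" if "u \<in> B" for u A
    unfolding g_def
    by (rule continuous_on_compose2[OF f_cont]) (use inB[OF that] in auto)
  have g_int: "g u integrable_on {a..b}" if "u \<in> B" for u a b
    using g_cont[OF that] integrable_continuous_real by blast
  define P where "P u t = z + (integral {-T..cl t} (g u) - integral {-T..0} (g u))" for u t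
  have M0: "M \<ge> 0" using M[of z] r norm_ge_zero[of "f z"] by (metis centre_in_cball less_imp_le order_trans)
  have P_in: "P u t \<in> cball z r" if u: "u \<in> B" for u t
  proof -
    \<comment> \<open>The first integral extends over a length of at most \<open>2 * T\<close>, the
      second over \<open>T\<close>; this is the source of the factor 3 in the conditions on
      \<open>T\<close>.\<close>
    have "norm (integral {-T..cl t} (g u)) \<le> M * (cl t - - T)"
      by (rule integral_bound[OF cl(1) g_cont[OF u]]) (unfold g_def, rule M[OF inB[OF u]])
    moreover have "norm (integral {-T..0} (g u)) \<le> M * (0 - - T)"
      by (rule integral_bound[OF _ g_cont[OF u]]) (use T in simp, unfold g_def, rule M[OF inB[OF u]])
    moreover have "M * (cl t - - T) \<le> M * (2 * T)"
      using cl[of t] M0 by (intro mult_left_mono) auto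
    ultimately have "norm (integral {-T..cl t} (g u) - integral {-T..0} (g u)) \<le> r"
      using T(2) norm_triangle_ineq4[of "integral {-T..cl t} (g u)" "integral {-T..0} (g u)"]
      by (simp add: algebra_simps)
    then show ?thesis by (simp add: P_def dist_norm norm_minus_commute)
  qed
  have P_cont: "P u \<in> bcontfun" if u: "u \<in> B" for u
  proof (rule bcontfun_normI)
    show "continuous_on UNIV (P u)"
    proof -
      have "continuous_on UNIV cl" unfolding cl_def by (intro continuous_intros)
      moreover have "cl ` UNIV \<subseteq> {-T..T}" using cl by auto
      ultimately have "continuous_on UNIV (\<lambda>t. integral {-T..cl t} (g u))"
        by (rule continuous_on_compose2[OF indefinite_integral_continuous_1[OF g_int[OF u, of "-T" T]]])
      then show ?thesis unfolding P_def by (intro continuous_on_add continuous_on_diff continuous_on_const)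
    qed
    show "norm (P u t) \<le> norm z + r" for t
      using P_in[OF u, of t] norm_triangle_ineq[of z "P u t - z"]
      by (simp add: dist_norm norm_minus_commute)
  qed
  then have ap: "apply_bcontfun (Bcontfun (P u)) = P u" if "u \<in> B" for u
    using that by (simp add: Bcontfun_inverse)
  have "\<exists>!u\<in>B. Bcontfun (P u) = u"
  proof (rule Banach_fix[where c="1/2"])
    show "complete B" unfolding B_def complete_eq_closed by (intro closed_PiC) auto
    have "const_bcontfun z \<in> B" using r by (auto simp: B_def mem_PiC_iff)
    then show "B \<noteq> {}" by blast
    show "(\<lambda>u. Bcontfun (P u)) ` B \<subseteq> B"
      using P_in by (auto simp: B_def mem_PiC_iff ap[unfolded B_def])
    show "dist (Bcontfun (P u)) (Bcontfun (P v)) \<le> 1/2 * dist u v" if uv: "u \<in> B" "v \<in> B" for u v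
    proof (rule dist_bound)
      fix t
      define d where "d = L * dist u v"
      have d0: "d \<ge> 0" using L by (simp add: d_def)
      have gb: "norm (g u s - g v s) \<le> d" for s
      proof -
        have "norm (g u s - g v s) \<le> L * norm (apply_bcontfun u s - apply_bcontfun v s)"
          unfolding g_def by (intro lip inB uv)
        also have "\<dots> \<le> d" unfolding d_def
          using dist_bounded[of u s v] L by (intro mult_left_mono) (auto simp: dist_norm)
        finally show ?thesis .
      qed
      have c: "continuous_on A (\<lambda>s. g u s - g v s)" for A
        by (intro continuous_intros g_cont uv)
      have "norm (integral {-T..cl t} (\<lambda>s. g u s - g v s)) \<le> d * (cl t - - T)"
        by (rule integral_bound[OF cl(1) c gb])
      also have "\<dots> \<le> d * (2 * T)" using cl[of t] d0 by (intro mult_left_mono) auto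
      finally have "norm (integral {-T..cl t} (\<lambda>s. g u s - g v s)) \<le> 2 * (d * T)" by (simp add: mult.left_commute)
      moreover have "norm (integral {-T..0} (\<lambda>s. g u s - g v s)) \<le> d * (0 - - T)"
        by (rule integral_bound[OF _ c gb]) (use T in simp)
      ultimately have "norm (integral {-T..cl t} (\<lambda>s. g u s - g v s) - integral {-T..0} (\<lambda>s. g u s - g v s)) \<le> 3 * (d * T)"
        using norm_triangle_ineq4[of "integral {-T..cl t} (\<lambda>s. g u s - g v s)" "integral {-T..0} (\<lambda>s. g u s - g v s)"]
        by simp
      moreover have "P u t - P v t = integral {-T..cl t} (\<lambda>s. g u s - g v s) - integral {-T..0} (\<lambda>s. g u s - g v s)"
        unfolding P_def integral_diff[OF g_int[OF uv(1)] g_int[OF uv(2)]] by (simp only: algebra_simps)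
      ultimately have "dist (P u t) (P v t) \<le> 3 * (d * T)"
        unfolding dist_norm by (simp only:)
      also have "\<dots> = (3 * T * L) * dist u v" unfolding d_def by (simp add: algebra_simps)
      also have "\<dots> \<le> 1/2 * dist u v" by (rule mult_right_mono[OF T(3) zero_le_dist])
      finally show "dist (apply_bcontfun (Bcontfun (P u)) t) (apply_bcontfun (Bcontfun (P v)) t) \<le> 1/2 * dist u v"
        unfolding ap[OF uv(1)] ap[OF uv(2)] .
    qed
  qed auto
  then obtain u where u: "u \<in> B" "Bcontfun (P u) = u" by metis
  then have eq: "apply_bcontfun u = P u" using ap[OF u(1)] by simp
  show ?thesis
  proof (intro exI[of _ "apply_bcontfun u"] conjI ballI)
    show "apply_bcontfun u 0 = z" using T by (simp add: eq P_def cl_id)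
    fix t assume t: "t \<in> {-T<..<T}"
    show "apply_bcontfun u t \<in> cball z r" using inB u by blast
    have "((\<lambda>s. integral {-T..s} (g u)) has_vector_derivative g u t) (at t within {-T..T})"
      by (rule integral_has_vector_derivative[OF g_cont[OF u(1)]]) (use t in auto)
    then have "((\<lambda>s. integral {-T..s} (g u)) has_vector_derivative g u t) (at t)"
      using t at_within_Icc_at[of "-T" t T] by simp
    then have "((\<lambda>s. z + (integral {-T..s} (g u) - integral {-T..0} (g u))) has_vector_derivative g u t) (at t)"
      by (auto intro!: derivative_eq_intros)
    then have "(P u has_vector_derivative g u t) (at t)"
      by (rule has_vector_derivative_transform_within_open[where S="{-T<..<T}"])
         (use t in \<open>auto simp: P_def cl_id\<close>)
    then show "(apply_bcontfun u has_vector_derivative f (apply_bcontfun u t)) (at t)"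
      using eq by (simp add: g_def)
  qed
qed

text \<open>Bootstrapping: if \<open>u\<close> is of class k, then so is \<open>f (u t)\<close>,
  which is the derivative of \<open>u\<close>.\<close>

lemma ode_solution_smooth:
  fixes f :: "'a::euclidean_space \<Rightarrow> 'a"
  assumes "open S" "smooth_on S f" "open I"
    and u: "\<And>t. t \<in> I \<Longrightarrow> u t \<in> S" "\<And>t. t \<in> I \<Longrightarrow> (u has_vector_derivative f (u t)) (at t)"
  shows "smooth_on I u"
proof -
  have "C_diff_on k I u" for k
  proof (induction k)
    case 0
    show ?case
      using u(2) by (auto intro!: continuous_at_imp_continuous_on dest: has_vector_derivative_continuous)
  next
    case (Suc k)
    show ?case
    proof (rule C_diff_on_SucI[OF assms(3)])
      show "(u has_derivative (\<lambda>h. h *\<^sub>R f (u t))) (at t)" if "t \<in> I" for t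
        using u(2)[OF that] by (simp add: has_vector_derivative_def)
      have "C_diff_on k I (\<lambda>t. f (u t))"
        by (rule C_diff_on_compose[OF assms(3,1) _ Suc]) (use u(1) assms(2) in \<open>auto simp: smooth_on_def\<close>)
      then show "C_diff_on k I (\<lambda>t. v *\<^sub>R f (u t))" for v
        by (intro C_diff_on_linear[OF bounded_linear_scaleR_right] assms(3))
    qed
  qed
  then show ?thesis by (simp add: smooth_on_def)
qed

text \<open>One \<open>T\<close> serves all starting points near \<open>z0\<close>: the Lipschitz
  constant and the bound are taken on a ball of radius \<open>e\<close>, and the Picard iteration
  runs on balls of radius \<open>e / 2\<close> around the starting points. This uniformity later
  allows a whole neighbourhood to be reached within one fixed time interval.\<close>

lemma smooth_local_flow:
  fixes f :: "'a::euclidean_space \<Rightarrow> 'a"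
  assumes S: "open S" "z0 \<in> S" and f: "smooth_on S f"
  shows "\<exists>\<delta>>0. \<exists>T>0. \<forall>z\<in>ball z0 \<delta>. \<exists>u. u 0 = z \<and> smooth_on {-T<..<T} u \<and>
    (\<forall>t\<in>{-T<..<T}. u t \<in> S \<and> (u has_vector_derivative f (u t)) (at t))"
proof -
  obtain e where e: "e > 0" "cball z0 e \<subseteq> S" using S open_contains_cball by blast
  have "\<exists>L. \<forall>x\<in>cball z0 e. \<forall>y\<in>cball z0 e. norm (f x - f y) \<le> L * norm (x - y)"
  proof (rule frechet_continuous_imp_lipschitz_cball)
    show "(f has_derivative frechet_derivative f (at x)) (at x)" if "x \<in> cball z0 e" for x
      using smooth_on_has_derivative[OF f] that e(2) by blast
    show "continuous_on (cball z0 e) (\<lambda>x. frechet_derivative f (at x) b)" for b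
      using smooth_on_continuous_on[OF smooth_on_frechet[OF f]] e(2) continuous_on_subset by blast
  qed
  then obtain L where L: "\<And>x y. x \<in> cball z0 e \<Longrightarrow> y \<in> cball z0 e \<Longrightarrow> norm (f x - f y) \<le> L * norm (x - y)"
    by blast
  have cont: "continuous_on (cball z0 e) f"
    using smooth_on_continuous_on[OF f] e(2) continuous_on_subset by blast
  then have "bounded (f ` cball z0 e)"
    by (intro compact_imp_bounded compact_continuous_image compact_cball)
  then obtain M where M: "\<And>x. x \<in> cball z0 e \<Longrightarrow> norm (f x) \<le> M"
    unfolding bounded_iff by blast
  define \<delta> where "\<delta> = e / 2"
  \<comment> \<open>A common positive bound for \<open>M\<close> and the Lipschitz constant, so that
    one choice of \<open>T\<close> keeps the iterates in the ball and makes the iteration a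
    contraction.\<close>
  define K where "K = \<bar>M\<bar> + \<bar>L\<bar> + 1"
  define T where "T = min (\<delta> / (3 * K)) (1 / (6 * K))"
  have K: "K > 0" "M \<le> K" "\<bar>L\<bar> \<le> K" by (auto simp: K_def)
  have \<delta>: "\<delta> > 0" using e by (simp add: \<delta>_def)
  have T: "T > 0" using \<delta> K by (simp add: T_def)
  have TK: "3 * T * K \<le> \<delta>" "3 * T * K \<le> 1/2"
  proof -
    have "T \<le> \<delta> / (3 * K)" "T \<le> 1 / (6 * K)" by (auto simp: T_def)
    then show "3 * T * K \<le> \<delta>" "3 * T * K \<le> 1/2" using K(1) by (auto simp: field_simps)
  qed
  have "\<exists>u. u 0 = z \<and> smooth_on {-T<..<T} u \<and>
    (\<forall>t\<in>{-T<..<T}. u t \<in> S \<and> (u has_vector_derivative f (u t)) (at t))" if z: "z \<in> ball z0 \<delta>" for z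
  proof -
    have sub: "cball z \<delta> \<subseteq> cball z0 e"
    proof
      fix x assume "x \<in> cball z \<delta>"
      then show "x \<in> cball z0 e" using z dist_triangle[of z0 x z] by (auto simp: \<delta>_def)
    qed
    have "\<exists>u. u 0 = z \<and> (\<forall>t\<in>{-T<..<T}. u t \<in> cball z \<delta> \<and> (u has_vector_derivative f (u t)) (at t))"
    proof (rule picard[where L="\<bar>L\<bar>" and M=M])
      show "norm (f x - f y) \<le> \<bar>L\<bar> * norm (x - y)" if "x \<in> cball z \<delta>" "y \<in> cball z \<delta>" for x y
      proof -
        have "norm (f x - f y) \<le> L * norm (x - y)" using that sub L by blast
        also have "\<dots> \<le> \<bar>L\<bar> * norm (x - y)" by (intro mult_right_mono) auto
        finally show ?thesis .
      qed
      show "continuous_on (cball z \<delta>) f" using cont sub continuous_on_subset by blast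
      have "3 * T * M \<le> 3 * T * K" using T K by (intro mult_left_mono) auto
      then show "3 * T * M \<le> \<delta>" using TK by simp
      have "3 * T * \<bar>L\<bar> \<le> 3 * T * K" using T K by (intro mult_left_mono) auto
      then show "3 * T * \<bar>L\<bar> \<le> 1/2" using TK by simp
    qed (use sub M \<delta> T in auto)
    then obtain u where u: "u 0 = z" "\<And>t. t \<in> {-T<..<T} \<Longrightarrow> u t \<in> cball z \<delta>"
      "\<And>t. t \<in> {-T<..<T} \<Longrightarrow> (u has_vector_derivative f (u t)) (at t)" by blast
    have uS: "u t \<in> S" if "t \<in> {-T<..<T}" for t using u(2)[OF that] sub e(2) by blast
    show ?thesis
      using u uS ode_solution_smooth[OF S(1) f, of "{-T<..<T}" u] by (intro exI[of _ u]) auto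
  qed
  then show ?thesis using \<delta> T by blast
qed

section \<open>Convex norms on the plane satisfying a cubic relation\<close>

text \<open>Models the directional derivative of the norm along a line parallel to the torsion
  vector, with the parameter shifted so that \<open>p\<close> vanishes at 0 and the linear
  coefficient of the cubic is normalised to 1.\<close>

locale line_relation =
  fixes p p' :: "real \<Rightarrow> real" and a b m M :: real
  assumes deriv: "\<And>s. (p has_real_derivative p' s) (at s)"
    and pos: "\<And>s. p' s > 0"
    and rel: "\<And>s. p s = s * (1 + b * s + a * s\<^sup>2) * p' s"
    and lim_bot: "(p \<longlongrightarrow> m) at_bot" and lim_top: "(p \<longlongrightarrow> M) at_top"
begin

text \<open>For \<open>b = 0\<close> this is a first integral; otherwise it is strictly monotone on both sides of \<open>0\<close>.\<close>

definition N :: "real \<Rightarrow> real" where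
  "N s = (p s / s)\<^sup>2 * (1 + b * s + a * s\<^sup>2)"

lemma N_deriv:
  assumes "s \<noteq> 0"
  shows "(N has_real_derivative - b * (p s / s)\<^sup>2) (at s)"
proof -
  have "(N has_real_derivative 2 * (p s / s) * ((p' s * s - p s * 1) / (s * s)) * (1 + b * s + a * s\<^sup>2)
      + (p s / s)\<^sup>2 * (b + a * (2 * s))) (at s)"
  proof -
    have "((\<lambda>s. p s / s) has_real_derivative (p' s * s - p s * 1) / (s * s)) (at s)"
      using DERIV_divide[OF deriv DERIV_ident assms] .
    note 1 = DERIV_power[OF this, of 2]
    have 2: "((\<lambda>s. 1 + b * s + a * s\<^sup>2) has_real_derivative b + a * (2 * s)) (at s)"
      by (auto intro!: derivative_eq_intros)
    show ?thesis unfolding N_def by (rule DERIV_cong[OF DERIV_mult[OF 1 2]]) (simp add: mult_ac)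
  qed
  moreover have "2 * (p s / s) * ((p' s * s - p s * 1) / (s * s)) * (1 + b * s + a * s\<^sup>2)
      + (p s / s)\<^sup>2 * (b + a * (2 * s)) = - b * (p s / s)\<^sup>2"
  proof -
    define q where "q = 1 + b * s + a * s\<^sup>2"
    have r: "p s = s * q * p' s" using rel[of s] by (simp add: q_def)
    \<comment> \<open>With \<open>q\<close> the quadratic factor, the relation reads
      \<open>p s / s = q * p' s\<close>, so \<open>p' s * w\<close> is the derivative of
      \<open>p s / s\<close>. Since \<open>w = - b - a * s\<close>, all terms carry the common
      factor \<open>(q * p' s)\<close> squared and only \<open>- b\<close> survives.\<close>
    define w where "w = (1 - q) / s"
    have 1: "p s / s = q * p' s" using assms r by (simp add: field_simps)
    have 2: "(p' s * s - p s * 1) / (s * s) = p' s * w"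
      using assms r by (simp add: w_def field_simps)
    have w: "w = - b - a * s" using assms by (simp add: w_def q_def power2_eq_square field_simps)
    show ?thesis unfolding q_def[symmetric] 1 2 unfolding w
      by (simp add: power2_eq_square algebra_simps)
  qed
  ultimately show ?thesis by simp
qed

lemma p0: "p 0 = 0" using rel[of 0] by simp

lemma p_less: "s < t \<Longrightarrow> p s < p t"
  using DERIV_pos_imp_increasing[of s t p] deriv pos by blast

lemma p_ne: "s \<noteq> 0 \<Longrightarrow> p s \<noteq> 0"
  using p_less[of s 0] p_less[of 0 s] p0 by (metis less_irrefl linorder_neqE_linordered_idom)

lemma N_lim_0: "(N \<longlongrightarrow> (p' 0)\<^sup>2) (at 0)"
proof -
  have "((\<lambda>s. p s / s) \<longlongrightarrow> p' 0) (at 0)"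
    using deriv[of 0] p0 by (simp add: has_field_derivative_iff)
  then have "((\<lambda>s. (p s / s)\<^sup>2 * (1 + b * s + a * s\<^sup>2)) \<longlongrightarrow> (p' 0)\<^sup>2 * (1 + b * 0 + a * 0\<^sup>2)) (at 0)"
    by (intro tendsto_intros)
  then show ?thesis by (simp add: N_def[abs_def])
qed

text \<open>In this form the limits of \<open>N\<close> at both ends can be read off.\<close>

lemma N_alt: "s \<noteq> 0 \<Longrightarrow> N s = (p s)\<^sup>2 * (1 / s * (1 / s) + b * (1 / s) + a)"
  by (simp add: N_def field_simps power2_eq_square)

lemma N_lim_top: "(N \<longlongrightarrow> a * M\<^sup>2) at_top"
proof -
  have z: "((\<lambda>s::real. 1 / s) \<longlongrightarrow> 0) at_top"
    using tendsto_inverse_0_at_top[OF filterlim_ident] by (simp add: inverse_eq_divide)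
  have "((\<lambda>s. (p s)\<^sup>2 * (1 / s * (1 / s) + b * (1 / s) + a)) \<longlongrightarrow> M\<^sup>2 * (0 * 0 + b * 0 + a)) at_top"
    by (intro tendsto_intros z lim_top)
  moreover have "eventually (\<lambda>s. (p s)\<^sup>2 * (1 / s * (1 / s) + b * (1 / s) + a) = N s) at_top"
    by (rule eventually_mono[OF eventually_gt_at_top[of 0]]) (simp add: N_alt)
  ultimately show ?thesis by (auto simp: mult.commute dest: Lim_transform_eventually)
qed

lemma N_lim_bot: "(N \<longlongrightarrow> a * m\<^sup>2) at_bot"
proof -
  have z: "((\<lambda>s::real. 1 / s) \<longlongrightarrow> 0) at_bot"
    using tendsto_mono[OF at_bot_le_at_infinity tendsto_inverse_0[where 'a=real]]
    by (simp add: inverse_eq_divide[abs_def])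
  have "((\<lambda>s. (p s)\<^sup>2 * (1 / s * (1 / s) + b * (1 / s) + a)) \<longlongrightarrow> m\<^sup>2 * (0 * 0 + b * 0 + a)) at_bot"
    by (intro tendsto_intros z lim_bot)
  moreover have "eventually (\<lambda>s. (p s)\<^sup>2 * (1 / s * (1 / s) + b * (1 / s) + a) = N s) at_bot"
    by (rule eventually_mono[OF eventually_gt_at_bot[of 0]]) (simp add: N_alt)
  ultimately show ?thesis by (auto simp: mult.commute dest: Lim_transform_eventually)
qed

text \<open>\<open>N\<close> decreases strictly on either side of 0, and 0 itself is bridged by the
  common one-sided limit \<open>(p' 0)\<close> squared. The limits at the ends lie on the outer
  sides.\<close>

lemma decreasing:
  assumes b: "b > 0"
  shows "a * M\<^sup>2 < a * m\<^sup>2"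
proof -
  have dec: "N t < N s" if "s < t" "0 \<notin> {s..t}" for s t
  proof (rule DERIV_neg_imp_decreasing[OF that(1)])
    fix x assume "s \<le> x" "x \<le> t"
    then have "x \<noteq> 0" using that by auto
    then show "\<exists>y. (N has_real_derivative y) (at x) \<and> y < 0"
      using N_deriv[of x] p_ne[of x] b by (intro exI[of _ "- b * (p x / x)\<^sup>2"]) auto
  qed
  \<comment> \<open>Limits preserve only weak inequalities; the strict one is gained between 2 and
    1, and again between -1 and -2.\<close>
  have "a * M\<^sup>2 \<le> N 2"
    by (rule tendsto_upperbound[OF N_lim_top])
       (auto intro!: eventually_mono[OF eventually_gt_at_top[of 2]] less_imp_le dec)
  also have "N 2 < N 1" by (rule dec) auto
  also have "N 1 \<le> (p' 0)\<^sup>2"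
  proof (rule tendsto_lowerbound[OF tendsto_mono[OF at_le N_lim_0]])
    show "\<forall>\<^sub>F s in at_right 0. N 1 \<le> N s"
      by (intro eventually_at_rightI[of 0 1]) (auto intro!: less_imp_le dec)
  qed auto
  also have "\<dots> \<le> N (-1)"
  proof (rule tendsto_upperbound[OF tendsto_mono[OF at_le N_lim_0]])
    show "\<forall>\<^sub>F s in at_left 0. N s \<le> N (-1)"
      by (intro eventually_at_leftI[of "-1" 0]) (auto intro!: less_imp_le dec)
  qed auto
  also have "N (-1) < N (-2)" by (rule dec) auto
  also have "N (-2) \<le> a * m\<^sup>2"
    by (rule tendsto_lowerbound[OF N_lim_bot])
       (auto intro!: eventually_mono[OF eventually_gt_at_bot[of "-2"]] less_imp_le dec)
  finally show ?thesis .
qed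

text \<open>Replacing \<open>p s\<close> by \<open>- p (- s)\<close> changes the sign of
  \<open>b\<close> and exchanges the two ends, which reduces this case to
  \<open>decreasing\<close>.\<close>

lemma increasing:
  assumes "b < 0"
  shows "a * m\<^sup>2 < a * M\<^sup>2"
proof -
  interpret r: line_relation "\<lambda>s. - p (- s)" "\<lambda>s. p' (- s)" a "- b" "- M" "- m"
  proof
    show "((\<lambda>s. - p (- s)) has_real_derivative p' (- s)) (at s)" for s
      using DERIV_minus[OF deriv[of "- s", unfolded DERIV_mirror]] by simp
    show "- p (- s) = s * (1 + - b * s + a * s\<^sup>2) * p' (- s)" for s
      using rel[of "- s"] by simp
    show "((\<lambda>s. - p (- s)) \<longlongrightarrow> - M) at_bot"
      using tendsto_minus[OF lim_top] by (simp add: filterlim_at_bot_mirror)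
    show "((\<lambda>s. - p (- s)) \<longlongrightarrow> - m) at_top"
      using tendsto_minus[OF lim_bot] by (simp add: filterlim_at_bot_mirror)
  qed (rule pos)
  show ?thesis using r.decreasing assms by simp
qed

text \<open>Now \<open>N\<close> is constant on each side of 0, and both constants equal its limit
  \<open>(p' 0)\<close> squared at 0. This determines the square of \<open>p\<close>, and the sign
  of \<open>p s\<close> is that of \<open>s\<close>. The limits at the ends give the two identities
  for \<open>a\<close>, and the first one forces \<open>a > 0\<close>.\<close>

lemma explicit:
  assumes b: "b = 0" and M: "M > 0"
  shows "a > 0 \<and> a * M\<^sup>2 = a * m\<^sup>2 \<and> (\<forall>s. p s = sqrt (a * M\<^sup>2) * s / sqrt (1 + a * s\<^sup>2))"
proof -
  define K where "K = p' 0"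
  have K: "K > 0" using pos by (simp add: K_def)
  have der0: "(N has_real_derivative 0) (at s)" if "s \<noteq> 0" for s
    using N_deriv[OF that] b by simp
  have cp: "N s = N 1" if "s > 0" for s
  proof -
    have "\<exists>c. \<forall>x\<in>{0<..}. N x = c"
      by (rule has_field_derivative_zero_constant) (auto intro!: has_field_derivative_at_within der0)
    then show ?thesis using that by auto
  qed
  have cm: "N s = N (-1)" if "s < 0" for s
  proof -
    have "\<exists>c. \<forall>x\<in>{..<0}. N x = c"
      by (rule has_field_derivative_zero_constant) (auto intro!: has_field_derivative_at_within der0)
    then show ?thesis using that by auto
  qed
  have e1: "N 1 = K\<^sup>2"
  proof (rule tendsto_unique[OF _ _ tendsto_mono[OF at_le N_lim_0], folded K_def])
    show "(N \<longlongrightarrow> N 1) (at_right 0)"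
      by (rule tendsto_eventually) (auto intro!: eventually_at_rightI[of 0 1] cp)
  qed auto
  have e2: "N (-1) = K\<^sup>2"
  proof (rule tendsto_unique[OF _ _ tendsto_mono[OF at_le N_lim_0], folded K_def])
    show "(N \<longlongrightarrow> N (-1)) (at_left 0)"
      by (rule tendsto_eventually) (auto intro!: eventually_at_leftI[of "-1" 0] cm)
  qed auto
  have aM: "a * M\<^sup>2 = K\<^sup>2"
  proof (rule tendsto_unique[OF _ N_lim_top])
    show "(N \<longlongrightarrow> K\<^sup>2) at_top"
      by (rule tendsto_eventually) (auto intro!: eventually_mono[OF eventually_gt_at_top[of 0]] simp: cp e1)
  qed auto
  have am: "a * m\<^sup>2 = K\<^sup>2"
  proof (rule tendsto_unique[OF _ N_lim_bot])
    show "(N \<longlongrightarrow> K\<^sup>2) at_bot"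
      by (rule tendsto_eventually) (auto intro!: eventually_mono[OF eventually_gt_at_bot[of 0]] simp: cm e2)
  qed auto
  have a: "a > 0" using aM K M by (metis zero_less_mult_pos2 zero_less_power)
  have "p s = K * s / sqrt (1 + a * s\<^sup>2)" for s
  proof (cases "s = 0")
    case False
    have q: "1 + a * s\<^sup>2 > 0" using a by (intro add_pos_nonneg) auto
    have "N s = (p s / s)\<^sup>2 * (1 + a * s\<^sup>2)" unfolding N_def by (simp add: b)
    moreover have "N s = K\<^sup>2" using cp[of s] cm[of s] e1 e2 False by linarith
    ultimately have "(p s * sqrt (1 + a * s\<^sup>2))\<^sup>2 = (K * s)\<^sup>2"
      using False q by (simp add: power_mult_distrib power_divide field_simps)
    moreover have "sgn (p s * sqrt (1 + a * s\<^sup>2)) = sgn (K * s)"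
      using False p_less[of s 0] p_less[of 0 s] p0 K q by (cases "s > 0") (auto simp: sgn_mult)
    ultimately have "p s * sqrt (1 + a * s\<^sup>2) = K * s"
      by (metis abs_mult_sgn power2_abs real_sqrt_abs)
    then show ?thesis using q by (simp add: field_simps)
  qed (simp add: p0)
  then show ?thesis using a aM am K by simp
qed

end

text \<open>Both functions solve the equation with the same cubic, but the absolute values
  \<open>A\<close> and \<open>B\<close> of their limits occur at opposite ends. For \<open>b\<close>
  nonzero, monotonicity of \<open>N\<close> for \<open>p\<close> and for \<open>P\<close> would
  order \<open>c3 * A^2\<close> and \<open>c3 * B^2\<close> strictly in both ways.\<close>

lemma line_relation_pair:
  fixes p p' P P' :: "real \<Rightarrow> real"
  assumes p: "\<And>s. (p has_real_derivative p' s) (at s)" "\<And>s. p' s > 0" "\<And>s. isCont p' s"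
      "\<And>s. p s = (c0 + c1 * s + c2 * s\<^sup>2 + c3 * s ^ 3) * p' s"
      "(p \<longlongrightarrow> - B) at_bot" "(p \<longlongrightarrow> A) at_top"
    and P: "\<And>s. (P has_real_derivative P' s) (at s)" "\<And>s. P' s > 0"
      "\<And>s. P s = (c0 + c1 * s + c2 * s\<^sup>2 + c3 * s ^ 3) * P' s"
      "(P \<longlongrightarrow> - A) at_bot" "(P \<longlongrightarrow> B) at_top"
    and AB: "A > 0" "B > 0"
  shows "\<exists>s0 a K. a > 0 \<and> K > 0 \<and> (\<forall>s. p (s0 + s) = K * s / sqrt (1 + a * s\<^sup>2)) \<and>
    (\<forall>s. P (s0 + s) = K * s / sqrt (1 + a * s\<^sup>2))"
proof -
  obtain l where l: "p l < 0"
    using eventually_happens[OF order_tendstoD(2)[OF p(5), of 0]] AB by auto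
  obtain r where r: "p r > 0"
    using eventually_happens[OF order_tendstoD(1)[OF p(6), of 0]] AB by auto
  have inc: "p s < p t" if "s < t" for s t
    using DERIV_pos_imp_increasing[OF that, of p] p(1,2) by blast
  have "l < r" using l r inc[of r l] by (cases l r rule: linorder_cases) auto
  then obtain s0 where s0: "p s0 = 0"
    using IVT'[of p l 0 r] l r p(1) by (auto intro!: continuous_at_imp_continuous_on DERIV_isCont)
  define b where "b = c2 + 3 * c3 * s0"
  define e where "e = c1 + 2 * c2 * s0 + 3 * c3 * s0\<^sup>2"
  \<comment> \<open>The derivative is positive, so a zero of \<open>p\<close> is a root of the
    cubic. As \<open>P\<close> shares the cubic, the same shift serves both functions.\<close>
  have c00: "c0 + c1 * s0 + c2 * s0\<^sup>2 + c3 * s0 ^ 3 = 0"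
    using p(2)[of s0] p(4)[of s0] s0 by simp
  have c: "c0 + c1 * (s0 + s) + c2 * (s0 + s)\<^sup>2 + c3 * (s0 + s) ^ 3 = s * (e + b * s + c3 * s\<^sup>2)" for s
  proof -
    have "c0 + c1 * (s0 + s) + c2 * (s0 + s)\<^sup>2 + c3 * (s0 + s) ^ 3 =
      (c0 + c1 * s0 + c2 * s0\<^sup>2 + c3 * s0 ^ 3) + s * (e + b * s + c3 * s\<^sup>2)"
      by (simp add: e_def b_def power2_eq_square power3_eq_cube algebra_simps)
    then show ?thesis using c00 by simp
  qed
  have rel: "p (s0 + s) = s * (e + b * s + c3 * s\<^sup>2) * p' (s0 + s)"
    "P (s0 + s) = s * (e + b * s + c3 * s\<^sup>2) * P' (s0 + s)" for s
    using p(4)[of "s0 + s"] P(3)[of "s0 + s"] c[of s] by simp_all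
  \<comment> \<open>The difference quotient of \<open>p\<close> at its zero tends to
    \<open>p' s0\<close>, while by the relation and continuity of \<open>p'\<close> it tends to
    \<open>e * p' s0\<close>.\<close>
  have e: "e = 1"
  proof -
    have "((\<lambda>s. (p (s0 + s) - p s0) / s) \<longlongrightarrow> p' s0) (at 0)"
      using p(1)[of s0] by (simp add: DERIV_def)
    moreover have "\<forall>\<^sub>F s in at 0. (p (s0 + s) - p s0) / s = (e + b * s + c3 * s\<^sup>2) * p' (s0 + s)"
      by (auto simp: eventually_at_filter rel(1) s0)
    ultimately have l1: "((\<lambda>s. (e + b * s + c3 * s\<^sup>2) * p' (s0 + s)) \<longlongrightarrow> p' s0) (at 0)"
      by (rule Lim_transform_eventually)
    have "((\<lambda>s. p' (s0 + s)) \<longlongrightarrow> p' s0) (at 0)"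
      using p(3)[of s0] by (simp add: isCont_iff)
    then have "((\<lambda>s. (e + b * s + c3 * s\<^sup>2) * p' (s0 + s)) \<longlongrightarrow> (e + b * 0 + c3 * 0\<^sup>2) * p' s0) (at 0)"
      by (intro tendsto_intros)
    from tendsto_unique[OF _ l1 this] show ?thesis using p(2)[of s0] by simp
  qed
  have top: "filterlim (\<lambda>s. s0 + s) at_top at_top"
    by (intro filterlim_tendsto_add_at_top[OF tendsto_const] filterlim_ident)
  have bot: "filterlim (\<lambda>s. s0 + s) at_bot at_bot"
    unfolding filterlim_at_bot
  proof
    show "\<forall>\<^sub>F s in at_bot. s0 + s \<le> Z" for Z
      by (rule eventually_mono[OF eventually_le_at_bot[of "Z - s0"]]) simp
  qed
  have shift: "((\<lambda>s. h (s0 + s)) has_real_derivative h' (s0 + s)) (at s)"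
    if "\<And>s. (h has_real_derivative h' s) (at s)" for h h' s
    using DERIV_shift[of h "h' (s0 + s)" s s0] that[of "s0 + s"] by (simp add: add.commute)
  interpret p: line_relation "\<lambda>s. p (s0 + s)" "\<lambda>s. p' (s0 + s)" c3 b "- B" A
    by (unfold_locales, rule shift[OF p(1)], rule p(2), use rel(1) e in simp,
        rule filterlim_compose[OF p(5) bot], rule filterlim_compose[OF p(6) top])
  interpret P: line_relation "\<lambda>s. P (s0 + s)" "\<lambda>s. P' (s0 + s)" c3 b "- A" B
    by (unfold_locales, rule shift[OF P(1)], rule P(2), use rel(2) e in simp,
        rule filterlim_compose[OF P(4) bot], rule filterlim_compose[OF P(5) top])
  have "\<not> b > 0" using p.decreasing P.decreasing by auto
  moreover have "\<not> b < 0" using p.increasing P.increasing by auto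
  ultimately have b: "b = 0" by simp
  have "c3 * A\<^sup>2 = c3 * B\<^sup>2" "c3 > 0" using p.explicit[OF b] AB by auto
  moreover have "\<forall>s. p (s0 + s) = sqrt (c3 * A\<^sup>2) * s / sqrt (1 + c3 * s\<^sup>2)"
    using p.explicit[OF b] AB by auto
  moreover have "\<forall>s. P (s0 + s) = sqrt (c3 * B\<^sup>2) * s / sqrt (1 + c3 * s\<^sup>2)"
    using P.explicit[OF b] AB by auto
  ultimately show ?thesis
    using AB by (intro exI[of _ s0] exI[of _ c3] exI[of _ "sqrt (c3 * A\<^sup>2)"]) auto
qed

section \<open>Positively homogeneous functions and their restriction to parallel lines\<close>

lemma homogeneous_derivative:
  fixes f :: "'a::real_normed_vector \<Rightarrow> real"
  assumes df: "\<And>y. y \<noteq> 0 \<Longrightarrow> (f has_derivative Df y) (at y)"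
    and hom: "\<And>l y. l > 0 \<Longrightarrow> y \<noteq> 0 \<Longrightarrow> f (l *\<^sub>R y) = l * f y"
    and l: "l > 0" and y: "y \<noteq> 0"
  shows "Df (l *\<^sub>R y) v = Df y v" "Df y y = f y"
proof -
  have "((\<lambda>y. l *\<^sub>R y) has_derivative (\<lambda>v. l *\<^sub>R v)) (at y)" by (auto intro!: derivative_eq_intros)
  moreover have "(f has_derivative Df (l *\<^sub>R y)) (at (l *\<^sub>R y))" using df l y by simp
  ultimately have "((\<lambda>y. f (l *\<^sub>R y)) has_derivative (\<lambda>v. Df (l *\<^sub>R y) (l *\<^sub>R v))) (at y)"
    by (rule has_derivative_compose)
  moreover have "((\<lambda>y. f (l *\<^sub>R y)) has_derivative (\<lambda>v. l * Df y v)) (at y)"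
    by (rule has_derivative_transform_within_open[OF has_derivative_mult_right[OF df[OF y]], of "- {0}"])
       (use l y hom in auto)
  ultimately have "Df (l *\<^sub>R y) (l *\<^sub>R v) = l * Df y v"
    using has_derivative_unique by (metis (no_types))
  moreover have "linear (Df (l *\<^sub>R y))" using df[of "l *\<^sub>R y"] l y has_derivative_linear by auto
  ultimately show "Df (l *\<^sub>R y) v = Df y v" using l by (simp add: linear_cmul)
  have ly: "linear (Df y)" using df[OF y] has_derivative_linear by blast
  have "((\<lambda>s. s *\<^sub>R y) has_derivative (\<lambda>s. s *\<^sub>R y)) (at 1)" by (auto intro!: derivative_eq_intros)
  moreover have "(f has_derivative Df y) (at (1 *\<^sub>R y))" using df y by simp
  ultimately have "((\<lambda>s. f (s *\<^sub>R y)) has_derivative (\<lambda>s. Df y (s *\<^sub>R y))) (at 1)"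
    by (rule has_derivative_compose)
  moreover have "((\<lambda>s. f (s *\<^sub>R y)) has_derivative (\<lambda>s. s * f y)) (at 1)"
    by (rule has_derivative_transform_within_open[of "\<lambda>s. s * f y" _ _ _ "{0<..}"])
       (auto intro!: derivative_eq_intros simp: hom y)
  ultimately have "(\<lambda>s. Df y (s *\<^sub>R y)) = (\<lambda>s. s * f y)" using has_derivative_unique by blast
  from fun_cong[OF this, of 1] show "Df y y = f y" by simp
qed

text \<open>A function of degree 0 takes the same value at \<open>n + s t\<close> and at
  \<open>t + n / s\<close>, and the latter point tends to \<open>t\<close>.\<close>

lemma tendsto_along_ray:
  fixes g :: "'a::real_normed_vector \<Rightarrow> real"
  assumes cont: "continuous_on (- {0}) g" and hom: "\<And>l y. l > 0 \<Longrightarrow> y \<noteq> 0 \<Longrightarrow> g (l *\<^sub>R y) = g y"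
    and t: "t \<noteq> 0" and n: "\<And>s. n + s *\<^sub>R t \<noteq> 0"
  shows "((\<lambda>s. g (n + s *\<^sub>R t)) \<longlongrightarrow> g t) at_top"
proof -
  have z: "((\<lambda>s::real. 1 / s) \<longlongrightarrow> 0) at_top"
    using tendsto_inverse_0_at_top[OF filterlim_ident] by (simp add: inverse_eq_divide)
  have "((\<lambda>s. (1 / s) *\<^sub>R n + t) \<longlongrightarrow> 0 *\<^sub>R n + t) at_top" by (intro tendsto_intros z)
  moreover have "isCont g t" using cont t by (simp add: continuous_on_eq_continuous_at open_Compl)
  ultimately have "((\<lambda>s. g ((1 / s) *\<^sub>R n + t)) \<longlongrightarrow> g t) at_top"
    using isCont_tendsto_compose[of t g] by simp
  moreover have "\<forall>\<^sub>F s in at_top. g ((1 / s) *\<^sub>R n + t) = g (n + s *\<^sub>R t)"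
  proof (rule eventually_mono[OF eventually_gt_at_top[of 0]])
    fix s :: real assume s: "s > 0"
    have "n + s *\<^sub>R t = s *\<^sub>R ((1 / s) *\<^sub>R n + t)" using s by (simp add: algebra_simps)
    moreover have "(1 / s) *\<^sub>R n + t \<noteq> 0" using n[of s] calculation by auto
    ultimately show "g ((1 / s) *\<^sub>R n + t) = g (n + s *\<^sub>R t)" using hom s by simp
  qed
  ultimately show ?thesis by (rule Lim_transform_eventually)
qed

text \<open>The restriction of \<open>f\<close> to the two lines \<open>\<plusminus>n\<^sub>0 + \<real> t\<close> is known up to a constant each;
  differentiability of \<open>f\<close> at \<open>t\<close>, where the two half planes meet, relates the constants.\<close>

lemma glue_half_planes:
  fixes f :: "real^2 \<Rightarrow> real"
  assumes df: "\<And>y. y \<noteq> 0 \<Longrightarrow> (f has_derivative Df y) (at y)"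
    and hom: "\<And>l y. l > 0 \<Longrightarrow> y \<noteq> 0 \<Longrightarrow> f (l *\<^sub>R y) = l * f y"
    and t: "t \<noteq> 0" and n0: "\<And>r s. r \<noteq> 0 \<Longrightarrow> r *\<^sub>R n0 + s *\<^sub>R t \<noteq> 0"
    and a: "a > 0"
    and pl: "\<And>s. f (n0 + s *\<^sub>R t) = L * sqrt (1 + a * s\<^sup>2) + B1"
    and mi: "\<And>s. f (- n0 + s *\<^sub>R t) = L * sqrt (1 + a * s\<^sup>2) + B2"
    and rs: "r *\<^sub>R n0 + s *\<^sub>R t \<noteq> 0"
  shows "f (r *\<^sub>R n0 + s *\<^sub>R t) = L * sqrt (r\<^sup>2 + a * s\<^sup>2) + B1 * r"
proof -
  have scale: "r * sqrt (1 + a * (s / r)\<^sup>2) = sqrt (r\<^sup>2 + a * s\<^sup>2)" if "r > 0" for r s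
  proof -
    have "r * sqrt (1 + a * (s / r)\<^sup>2) = sqrt (r\<^sup>2 * (1 + a * (s / r)\<^sup>2))"
      using that by (simp add: real_sqrt_mult)
    also have "r\<^sup>2 * (1 + a * (s / r)\<^sup>2) = r\<^sup>2 + a * s\<^sup>2"
      using that by (simp add: power_divide field_simps)
    finally show ?thesis .
  qed
  have pl': "f (r *\<^sub>R n0 + s *\<^sub>R t) = L * sqrt (r\<^sup>2 + a * s\<^sup>2) + B1 * r" if r: "r > 0" for r s
  proof -
    have "r *\<^sub>R n0 + s *\<^sub>R t = r *\<^sub>R (n0 + (s / r) *\<^sub>R t)" using r by (simp add: algebra_simps)
    moreover have "n0 + (s / r) *\<^sub>R t \<noteq> 0" using n0[of 1] by simp
    ultimately have "f (r *\<^sub>R n0 + s *\<^sub>R t) = r * (L * sqrt (1 + a * (s / r)\<^sup>2) + B1)"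
      using hom[OF r] pl by simp
    also have "\<dots> = L * (r * sqrt (1 + a * (s / r)\<^sup>2)) + B1 * r" by (simp add: algebra_simps)
    finally show ?thesis unfolding scale[OF r] .
  qed
  have mi': "f (r *\<^sub>R n0 + s *\<^sub>R t) = L * sqrt (r\<^sup>2 + a * s\<^sup>2) - B2 * r" if r: "r < 0" for r s
  proof -
    have r': "- r > 0" using r by simp
    have "r *\<^sub>R n0 + s *\<^sub>R t = (- r) *\<^sub>R (- n0 + (s / (- r)) *\<^sub>R t)" using r by (simp add: algebra_simps)
    moreover have "- n0 + (s / (- r)) *\<^sub>R t \<noteq> 0" using n0[of "-1" "s / (- r)"] by simp
    ultimately have "f (r *\<^sub>R n0 + s *\<^sub>R t) = (- r) * (L * sqrt (1 + a * (s / (- r))\<^sup>2) + B2)"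
      using hom[OF r', of "- n0 + (s / (- r)) *\<^sub>R t"] mi[of "s / (- r)"] by presburger
    also have "\<dots> = L * ((- r) * sqrt (1 + a * (s / (- r))\<^sup>2)) - B2 * r" by (simp add: algebra_simps)
    finally show ?thesis unfolding scale[OF r'] by simp
  qed
  \<comment> \<open>The subtracted root has derivative 0 in \<open>r\<close> at 0. What remains is
    \<open>B1 * r\<close> for positive and \<open>- B2 * r\<close> for negative \<open>r\<close>,
    and differentiability at 0 equates the two slopes.\<close>
  define k where "k \<sigma> r = f (r *\<^sub>R n0 + \<sigma> *\<^sub>R t) - L * sqrt (r\<^sup>2 + a * \<sigma>\<^sup>2)" for \<sigma> r
  have k_deriv: "(k \<sigma> has_real_derivative Df (\<sigma> *\<^sub>R t) n0) (at 0)" if "\<sigma> \<noteq> 0" for \<sigma>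
  proof -
    have "((\<lambda>r. r *\<^sub>R n0 + \<sigma> *\<^sub>R t) has_derivative (\<lambda>r. r *\<^sub>R n0)) (at 0)"
      by (auto intro!: derivative_eq_intros)
    moreover have d: "(f has_derivative Df (\<sigma> *\<^sub>R t)) (at (\<sigma> *\<^sub>R t))" using df that t by simp
    ultimately have "((\<lambda>r. f (r *\<^sub>R n0 + \<sigma> *\<^sub>R t)) has_derivative (\<lambda>r. Df (\<sigma> *\<^sub>R t) (r *\<^sub>R n0))) (at 0)"
      using has_derivative_compose[of "\<lambda>r. r *\<^sub>R n0 + \<sigma> *\<^sub>R t" _ 0 UNIV f] by simp
    then have "((\<lambda>r. f (r *\<^sub>R n0 + \<sigma> *\<^sub>R t)) has_real_derivative Df (\<sigma> *\<^sub>R t) n0) (at 0)"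
      using has_derivative_linear[OF d]
      by (simp add: has_field_derivative_def linear_cmul mult_commute_abs)
    moreover have "((\<lambda>r. L * sqrt (r\<^sup>2 + a * \<sigma>\<^sup>2)) has_real_derivative 0) (at 0)"
      using a that by (auto intro!: derivative_eq_intros simp: mult_less_0_iff)
    ultimately show ?thesis unfolding k_def using DERIV_diff by fastforce
  qed
  \<comment> \<open>The line \<open>r = 0\<close> belongs to neither half plane; continuity supplies
    the values there, which are also needed in the final case distinction.\<close>
  have k0: "k \<sigma> 0 = 0" if "\<sigma> \<noteq> 0" for \<sigma>
  proof -
    have "(k \<sigma> \<longlongrightarrow> k \<sigma> 0) (at_right 0)"
      using DERIV_isCont[OF k_deriv[OF that]] by (simp add: isCont_def filterlim_at_split)
    moreover have "(k \<sigma> \<longlongrightarrow> B1 * 0) (at_right 0)"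
    proof (rule Lim_transform_eventually)
      show "((\<lambda>r. B1 * r) \<longlongrightarrow> B1 * 0) (at_right 0)" by (intro tendsto_intros)
      show "\<forall>\<^sub>F r in at_right 0. B1 * r = k \<sigma> r"
        by (rule eventually_at_rightI[of 0 1]) (auto simp: k_def pl')
    qed
    ultimately show ?thesis using tendsto_unique[of "at_right (0::real)"] by fastforce
  qed
  have quot: "((\<lambda>r. k 1 r / r) \<longlongrightarrow> Df t n0) (at 0)"
    using k_deriv[of 1] k0[of 1] by (simp add: has_field_derivative_iff)
  have "B1 = Df t n0"
  proof (rule tendsto_unique)
    show "((\<lambda>r. k 1 r / r) \<longlongrightarrow> B1) (at_right 0)"
      by (rule tendsto_eventually, rule eventually_at_rightI[of 0 1]) (auto simp: k_def pl'[of _ 1, simplified])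
    show "((\<lambda>r. k 1 r / r) \<longlongrightarrow> Df t n0) (at_right 0)" using quot by (simp add: filterlim_at_split)
  qed simp
  moreover have "- B2 = Df t n0"
  proof (rule tendsto_unique)
    show "((\<lambda>r. k 1 r / r) \<longlongrightarrow> - B2) (at_left 0)"
      by (rule tendsto_eventually, rule eventually_at_leftI[of "-1" 0]) (auto simp: k_def mi'[of _ 1, simplified])
    show "((\<lambda>r. k 1 r / r) \<longlongrightarrow> Df t n0) (at_left 0)" using quot by (simp add: filterlim_at_split)
  qed simp
  ultimately have B2: "B2 = - B1" by simp
  consider "r > 0" | "r < 0" | "r = 0" by linarith
  then show ?thesis
  proof cases
    case 3
    then show ?thesis using k0[of s] rs by (auto simp: k_def)
  qed (use pl' mi' B2 in auto)
qed

text \<open>\<open>H\<close> is the second derivative of \<open>f\<close> in direction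
  \<open>t\<close>, and the squared determinant in \<open>rel\<close> is constant on each line
  parallel to \<open>t\<close>. On such a line \<open>rel\<close> is therefore a first-order
  equation with cubic coefficient, and \<open>odd\<close> gives the opposite line the same
  equation.\<close>

lemma planar_norm_cubic_relation:
  fixes f :: "real^2 \<Rightarrow> real"
  assumes df: "\<And>y. y \<noteq> 0 \<Longrightarrow> (f has_derivative Df y) (at y)"
    and hom: "\<And>l y. l > 0 \<Longrightarrow> y \<noteq> 0 \<Longrightarrow> f (l *\<^sub>R y) = l * f y"
    and pos: "\<And>y. y \<noteq> 0 \<Longrightarrow> f y > 0"
    and cont: "continuous_on (- {0}) (\<lambda>y. Df y t)"
    and d2: "\<And>y. y \<noteq> 0 \<Longrightarrow> ((\<lambda>s. Df (y + s *\<^sub>R t) t) has_real_derivative H y) (at 0)"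
    and contH: "continuous_on (- {0}) H"
    and Hpos: "\<And>y. y $ 2 * t $ 1 - y $ 1 * t $ 2 \<noteq> 0 \<Longrightarrow> H y > 0"
    and rel: "\<And>y. y \<noteq> 0 \<Longrightarrow> Df y t * (y $ 2 * t $ 1 - y $ 1 * t $ 2)\<^sup>2 = C y * H y"
    and cubic: "\<And>n. \<exists>c0 c1 c2 c3. \<forall>s. C (n + s *\<^sub>R t) = c0 + c1 * s + c2 * s\<^sup>2 + c3 * s ^ 3"
    and odd: "\<And>y. C (- y) = - C y"
    and t: "t \<noteq> 0"
  shows "\<exists>u v w. \<forall>y. y \<noteq> 0 \<longrightarrow> f y = sqrt ((u \<bullet> y)\<^sup>2 + (v \<bullet> y)\<^sup>2) + w \<bullet> y"
proof -
  \<comment> \<open>\<open>n\<close> is \<open>t\<close> turned by a right angle, so the determinant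
    equals the squared length \<open>d\<close> of \<open>t\<close> along
    \<open>n + s t\<close>.\<close>
  define n :: "real^2" where "n = vector [- t $ 2, t $ 1]"
  define d where "d = (t $ 1)\<^sup>2 + (t $ 2)\<^sup>2"
  have n12: "n $ 1 = - t $ 2" "n $ 2 = t $ 1" by (simp_all add: n_def)
  have d: "d > 0" using t unfolding d_def
    by (metis (mono_tags, lifting) sum_power2_gt_zero_iff vec_eq_iff exhaust_2 zero_index)
  have om: "(n + s *\<^sub>R t) $ 2 * t $ 1 - (n + s *\<^sub>R t) $ 1 * t $ 2 = d" for s
    by (simp add: n12 d_def power2_eq_square algebra_simps)
  have ne: "n + s *\<^sub>R t \<noteq> 0" "- n + s *\<^sub>R t \<noteq> 0" for s
  proof -
    have *: "n + s *\<^sub>R t \<noteq> 0" for s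
    proof
      assume "n + s *\<^sub>R t = 0"
      from om[of s, unfolded this] d show False by simp
    qed
    show "n + s *\<^sub>R t \<noteq> 0" "- n + s *\<^sub>R t \<noteq> 0" using *[of s] *[of "- s"] by auto
  qed
  obtain e0 e1 e2 e3 where e: "\<And>s. C (n + s *\<^sub>R t) = e0 + e1 * s + e2 * s\<^sup>2 + e3 * s ^ 3"
    using cubic[of n] by blast
  note homD = homogeneous_derivative[OF df hom]
  have lin: "linear (Df y)" if "y \<noteq> 0" for y using df[OF that] has_derivative_linear by blast
  have Dtt: "Df t t = f t" using homD(2)[of 1 t] t by simp
  have Dmt: "Df (- t) t = - f (- t)"
    using homD(2)[of 1 "- t"] t linear_neg[OF lin[of "- t"], of t] by simp
  have ray1: "((\<lambda>s. Df (m + s *\<^sub>R t) t) \<longlongrightarrow> f t) at_top"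
    and ray2: "((\<lambda>s. Df (m - s *\<^sub>R t) t) \<longlongrightarrow> - f (- t)) at_top" if "\<And>s. m + s *\<^sub>R t \<noteq> 0" for m
  proof -
    show "((\<lambda>s. Df (m + s *\<^sub>R t) t) \<longlongrightarrow> f t) at_top"
      using tendsto_along_ray[OF cont homD(1) t that] Dtt by simp
    have "m + s *\<^sub>R (- t) \<noteq> 0" for s using that[of "- s"] by simp
    then show "((\<lambda>s. Df (m - s *\<^sub>R t) t) \<longlongrightarrow> - f (- t)) at_top"
      using tendsto_along_ray[OF cont homD(1), of "- t" m] t Dmt by simp
  qed
  have line: "((\<lambda>s. Df (m + s *\<^sub>R t) t) has_real_derivative H (m + s *\<^sub>R t)) (at s)"
    if "\<And>s. m + s *\<^sub>R t \<noteq> 0" for m s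
    using DERIV_shift[of "\<lambda>s. Df (m + s *\<^sub>R t) t" "H (m + s *\<^sub>R t)" 0 s] d2[OF that[of s]]
    by (simp add: algebra_simps)
  have Hp: "H (n + s *\<^sub>R t) > 0" "H (- (n + s *\<^sub>R t)) > 0" for s
  proof -
    have "(- (n + s *\<^sub>R t)) $ 2 * t $ 1 - (- (n + s *\<^sub>R t)) $ 1 * t $ 2 \<noteq> 0"
      using om[of s] d by (simp add: algebra_simps)
    then show "H (n + s *\<^sub>R t) > 0" "H (- (n + s *\<^sub>R t)) > 0"
      using Hpos om[of s] d by (auto simp only: less_irrefl)
  qed
  define c where "c s = e0 / d\<^sup>2 + e1 / d\<^sup>2 * s + e2 / d\<^sup>2 * s\<^sup>2 + e3 / d\<^sup>2 * s ^ 3" for s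
  have cC: "c s * d\<^sup>2 = C (n + s *\<^sub>R t)" for s
  proof -
    have "c s = C (n + s *\<^sub>R t) / d\<^sup>2" unfolding c_def e by (simp add: add_divide_distrib)
    then show ?thesis using d by simp
  qed
  have r1: "Df (n + s *\<^sub>R t) t = c s * H (n + s *\<^sub>R t)" for s
  proof -
    have "Df (n + s *\<^sub>R t) t * d\<^sup>2 = c s * d\<^sup>2 * H (n + s *\<^sub>R t)"
      using rel[OF ne(1)[of s]] unfolding om cC .
    then show ?thesis using d by simp
  qed
  \<comment> \<open>At the reflected point the determinant is \<open>- d\<close>, so its square is
    unchanged, whereas \<open>C\<close> changes sign; the outer minus sign absorbs this.\<close>
  have r2: "- Df (- (n + s *\<^sub>R t)) t = c s * H (- (n + s *\<^sub>R t))" for s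
  proof -
    have omn: "(- (n + s *\<^sub>R t)) $ 2 * t $ 1 - (- (n + s *\<^sub>R t)) $ 1 * t $ 2 = - d"
      using om[of s] by (simp add: algebra_simps)
    have "- (n + s *\<^sub>R t) \<noteq> 0" using ne(1)[of s] unfolding neg_equal_0_iff_equal .
    from rel[OF this, unfolded omn odd, folded cC] have "Df (- (n + s *\<^sub>R t)) t * d\<^sup>2 = - (c s * d\<^sup>2) * H (- (n + s *\<^sub>R t))"
      by simp
    then have "(Df (- (n + s *\<^sub>R t)) t + c s * H (- (n + s *\<^sub>R t))) * d\<^sup>2 = 0"
      unfolding distrib_right by (simp add: mult.assoc mult.left_commute)
    then have "Df (- (n + s *\<^sub>R t)) t + c s * H (- (n + s *\<^sub>R t)) = 0" using d by simp
    then show ?thesis by linarith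
  qed
  have "\<exists>s0 a K. a > 0 \<and> K > 0 \<and>
    (\<forall>s. Df (n + (s0 + s) *\<^sub>R t) t = K * s / sqrt (1 + a * s\<^sup>2)) \<and>
    (\<forall>s. - Df (- (n + (s0 + s) *\<^sub>R t)) t = K * s / sqrt (1 + a * s\<^sup>2))"
  proof (rule line_relation_pair[where p' = "\<lambda>s. H (n + s *\<^sub>R t)" and P' = "\<lambda>s. H (- (n + s *\<^sub>R t))"
        and A = "f t" and B = "f (- t)"
        and ?c0.0 = "e0 / d\<^sup>2" and ?c1.0 = "e1 / d\<^sup>2" and ?c2.0 = "e2 / d\<^sup>2" and ?c3.0 = "e3 / d\<^sup>2"])
    show "((\<lambda>s. Df (n + s *\<^sub>R t) t) has_real_derivative H (n + s *\<^sub>R t)) (at s)" for s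
      using line ne by blast
    show "isCont (\<lambda>s. H (n + s *\<^sub>R t)) s" for s
    proof -
      have "continuous_on UNIV (\<lambda>s. H (n + s *\<^sub>R t))"
        by (rule continuous_on_compose2[OF contH]) (use ne in \<open>auto intro!: continuous_intros\<close>)
      then show ?thesis by (simp add: continuous_on_eq_continuous_at)
    qed
    show "((\<lambda>s. Df (n + s *\<^sub>R t) t) \<longlongrightarrow> f t) at_top" using ray1 ne by blast
    show "((\<lambda>s. Df (n + s *\<^sub>R t) t) \<longlongrightarrow> - f (- t)) at_bot"
      using ray2[OF ne(1)] by (simp add: filterlim_at_bot_mirror)
    show "((\<lambda>s. - Df (- (n + s *\<^sub>R t)) t) has_real_derivative H (- (n + s *\<^sub>R t))) (at s)" for s
    proof -
      have "((\<lambda>s. Df (- n + (- s) *\<^sub>R t) t) has_real_derivative - H (- n + (- s) *\<^sub>R t)) (at s)"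
        using line[OF ne(2), of "- s"] unfolding DERIV_mirror .
      from DERIV_minus[OF this] show ?thesis by simp
    qed
    show "((\<lambda>s. - Df (- (n + s *\<^sub>R t)) t) \<longlongrightarrow> - f t) at_bot"
      using tendsto_minus[OF ray1[OF ne(2)]] by (simp add: filterlim_at_bot_mirror)
    show "((\<lambda>s. - Df (- (n + s *\<^sub>R t)) t) \<longlongrightarrow> f (- t)) at_top"
      using tendsto_minus[OF ray2[OF ne(2)]] by simp
  qed (use Hp r1 r2 pos t in \<open>simp_all add: c_def\<close>)
  then obtain s0 a K where a: "a > 0" and K: "K > 0"
    and sol1: "\<And>s. Df (n + (s0 + s) *\<^sub>R t) t = K * s / sqrt (1 + a * s\<^sup>2)"
    and sol2: "\<And>s. - Df (- (n + (s0 + s) *\<^sub>R t)) t = K * s / sqrt (1 + a * s\<^sup>2)" by blast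
  define n0 where "n0 = n + s0 *\<^sub>R t"
  \<comment> \<open>Chosen so that the derivative of \<open>L * sqrt (1 + a * s^2)\<close> is
    \<open>K * s / sqrt (1 + a * s^2)\<close>.\<close>
  define L where "L = K / a"
  have ne0: "n0 + s *\<^sub>R t \<noteq> 0" "- n0 + s *\<^sub>R t \<noteq> 0" for s
    using ne(1)[of "s0 + s"] ne(2)[of "s - s0"] by (auto simp: n0_def algebra_simps)
  have sol1': "Df (n0 + s *\<^sub>R t) t = K * s / sqrt (1 + a * s\<^sup>2)" for s
    using sol1[of s] by (simp add: n0_def algebra_simps)
  have sol2': "Df (- n0 + s *\<^sub>R t) t = K * s / sqrt (1 + a * s\<^sup>2)" for s
    using sol2[of "- s"] by (simp add: n0_def algebra_simps)
  have const: "\<exists>B. \<forall>s. f (m + s *\<^sub>R t) = L * sqrt (1 + a * s\<^sup>2) + B"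
    if m: "\<And>s. m + s *\<^sub>R t \<noteq> 0" and sol: "\<And>s. Df (m + s *\<^sub>R t) t = K * s / sqrt (1 + a * s\<^sup>2)" for m
  proof -
    define h where "h s = f (m + s *\<^sub>R t) - L * sqrt (1 + a * s\<^sup>2)" for s
    have "(h has_real_derivative 0) (at s)" for s
    proof -
      have q: "1 + a * s\<^sup>2 > 0" using a by (intro add_pos_nonneg) auto
      have "((\<lambda>s. m + s *\<^sub>R t) has_derivative (\<lambda>r. r *\<^sub>R t)) (at s)"
        by (auto intro!: derivative_eq_intros)
      from has_derivative_compose[OF this df[OF m]]
      have "((\<lambda>s. f (m + s *\<^sub>R t)) has_real_derivative Df (m + s *\<^sub>R t) t) (at s)"
        using linear_cmul[OF lin[OF m]] by (simp add: has_field_derivative_def mult_commute_abs)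
      moreover have "((\<lambda>s. L * sqrt (1 + a * s\<^sup>2)) has_real_derivative K * s / sqrt (1 + a * s\<^sup>2)) (at s)"
        using q a by (auto intro!: derivative_eq_intros simp: L_def field_simps)
      ultimately show ?thesis unfolding h_def using DERIV_diff sol by fastforce
    qed
    then have "h s = h 0" for s using DERIV_isconst_all by blast
    then show ?thesis unfolding h_def by (metis add.commute diff_add_cancel)
  qed
  obtain B1 where B1: "\<And>s. f (n0 + s *\<^sub>R t) = L * sqrt (1 + a * s\<^sup>2) + B1"
    using const[OF ne0(1) sol1'] by blast
  obtain B2 where B2: "\<And>s. f (- n0 + s *\<^sub>R t) = L * sqrt (1 + a * s\<^sup>2) + B2"
    using const[OF ne0(2) sol2'] by blast
  have om0: "n0 $ 2 * t $ 1 - n0 $ 1 * t $ 2 = d" using om[of s0] by (simp add: n0_def)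
  have ner: "r *\<^sub>R n0 + s *\<^sub>R t \<noteq> 0" if "r \<noteq> 0" for r s
  proof
    assume "r *\<^sub>R n0 + s *\<^sub>R t = 0"
    then have "r * n0 $ 1 + s * t $ 1 = 0" "r * n0 $ 2 + s * t $ 2 = 0"
      by (auto simp: vec_eq_iff dest: spec)
    then have "r * (n0 $ 2 * t $ 1 - n0 $ 1 * t $ 2) = 0" by algebra
    then show False using om0 d that by simp
  qed
  note all = glue_half_planes[OF df hom t ner a B1 B2]
  \<comment> \<open>\<open>\<rho>\<close> and \<open>\<sigma>\<close> are the basis dual to
    \<open>n0\<close>, \<open>t\<close>, by Cramer's rule with determinant \<open>d\<close>.\<close>
  define \<rho> :: "real^2" where "\<rho> = vector [- t $ 2 / d, t $ 1 / d]"
  define \<sigma> :: "real^2" where "\<sigma> = vector [n0 $ 2 / d, - n0 $ 1 / d]"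
  have dec: "(\<rho> \<bullet> y) *\<^sub>R n0 + (\<sigma> \<bullet> y) *\<^sub>R t = y" for y
  proof -
    have "d * ((\<rho> \<bullet> y) * n0 $ i + (\<sigma> \<bullet> y) * t $ i) = d * y $ i" for i
    proof -
      have "d * (\<rho> \<bullet> y) = y $ 2 * t $ 1 - y $ 1 * t $ 2" "d * (\<sigma> \<bullet> y) = n0 $ 2 * y $ 1 - n0 $ 1 * y $ 2"
        using d by (simp_all add: \<rho>_def \<sigma>_def inner_vec_def sum_2 field_simps)
      then have "d * ((\<rho> \<bullet> y) * n0 $ i + (\<sigma> \<bullet> y) * t $ i) =
          (y $ 2 * t $ 1 - y $ 1 * t $ 2) * n0 $ i + (n0 $ 2 * y $ 1 - n0 $ 1 * y $ 2) * t $ i"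
        by algebra
      also have "\<dots> = (n0 $ 2 * t $ 1 - n0 $ 1 * t $ 2) * y $ i"
        using exhaust_2[of i] by (auto simp: algebra_simps)
      finally show ?thesis using om0 by simp
    qed
    then show ?thesis using d by (simp add: vec_eq_iff)
  qed
  have "f y = sqrt ((((L * 1) *\<^sub>R \<rho>) \<bullet> y)\<^sup>2 + (((L * sqrt a) *\<^sub>R \<sigma>) \<bullet> y)\<^sup>2) + (B1 *\<^sub>R \<rho>) \<bullet> y" if "y \<noteq> 0" for y
  proof -
    have "f y = L * sqrt ((\<rho> \<bullet> y)\<^sup>2 + a * (\<sigma> \<bullet> y)\<^sup>2) + B1 * (\<rho> \<bullet> y)"
      using all[of "\<rho> \<bullet> y" "\<sigma> \<bullet> y"] that by (simp add: dec)
    moreover have "L * sqrt ((\<rho> \<bullet> y)\<^sup>2 + a * (\<sigma> \<bullet> y)\<^sup>2) = sqrt (L\<^sup>2 * ((\<rho> \<bullet> y)\<^sup>2 + a * (\<sigma> \<bullet> y)\<^sup>2))"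
      using K a by (simp add: real_sqrt_mult L_def)
    moreover have "L\<^sup>2 * ((\<rho> \<bullet> y)\<^sup>2 + a * (\<sigma> \<bullet> y)\<^sup>2) =
        (((L * 1) *\<^sub>R \<rho>) \<bullet> y)\<^sup>2 + (((L * sqrt a) *\<^sub>R \<sigma>) \<bullet> y)\<^sup>2"
      using a by (simp add: power_mult_distrib algebra_simps)
    ultimately show ?thesis by simp
  qed
  then show ?thesis by blast
qed

section \<open>A Finsler metric in one chart\<close>

lemma pderiv_at_eq: "(F has_derivative F') (at x) \<Longrightarrow> pderiv_at i F x = F' (axis i 1)"
  unfolding pderiv_at_def by (simp add: frechet_derivative_at[symmetric])

lemma open_slit:
  fixes U :: "'a::topological_space set"
  assumes "open U"
  shows "open (U \<times> (UNIV - {0 :: 'b::real_normed_vector}))"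
  using assms by (intro open_Times open_Diff) auto

context
  fixes U :: "(real^'n::finite) set" and g :: "real^'n \<Rightarrow> real^'n \<Rightarrow> real"
  assumes U: "open U" and smooth: "smooth_on (U \<times> (UNIV - {0})) (\<lambda>(x, y). g x y)"
begin

lemma slice_y_derivative:
  assumes "x \<in> U" "y \<noteq> 0"
  shows "((\<lambda>y. g x y) has_derivative (\<lambda>v. frechet_derivative (\<lambda>(x, y). g x y) (at (x, y)) (0, v))) (at y)"
proof -
  have "((\<lambda>y. (x, y)) has_derivative (\<lambda>v. (0, v))) (at y)" by (auto intro!: derivative_eq_intros)
  from has_derivative_compose[OF this smooth_on_has_derivative[OF smooth, of "(x, y)"]] assms
  show ?thesis by simp
qed

lemma slice_x_derivative:
  assumes "x \<in> U" "y \<noteq> 0"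
  shows "((\<lambda>x. g x y) has_derivative (\<lambda>v. frechet_derivative (\<lambda>(x, y). g x y) (at (x, y)) (v, 0))) (at x)"
proof -
  have "((\<lambda>x. (x, y)) has_derivative (\<lambda>v. (v, 0))) (at x)" by (auto intro!: derivative_eq_intros)
  from has_derivative_compose[OF this smooth_on_has_derivative[OF smooth, of "(x, y)"]] assms
  show ?thesis by simp
qed

lemma py_eq: "x \<in> U \<Longrightarrow> y \<noteq> 0 \<Longrightarrow>
    py i g x y = frechet_derivative (\<lambda>(x, y). g x y) (at (x, y)) (0, axis i 1)"
  unfolding py_def using pderiv_at_eq[OF slice_y_derivative] by simp

lemma px_eq: "x \<in> U \<Longrightarrow> y \<noteq> 0 \<Longrightarrow>
    px i g x y = frechet_derivative (\<lambda>(x, y). g x y) (at (x, y)) (axis i 1, 0)"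
  unfolding px_def using pderiv_at_eq[OF slice_x_derivative] by simp

lemma smooth_py: "smooth_on (U \<times> (UNIV - {0})) (\<lambda>(x, y). py i g x y)"
  by (rule smooth_on_cong[OF open_slit[OF U] _ smooth_on_frechet[OF smooth, of "(0, axis i 1)"]])
    (erule SigmaE, simp add: py_eq)

lemma smooth_px: "smooth_on (U \<times> (UNIV - {0})) (\<lambda>(x, y). px i g x y)"
  by (rule smooth_on_cong[OF open_slit[OF U] _ smooth_on_frechet[OF smooth, of "(axis i 1, 0)"]])
    (erule SigmaE, simp add: px_eq)

lemma slice_y_linear:
  assumes "x \<in> U" "y \<noteq> 0"
  shows "((\<lambda>y. g x y) has_derivative (\<lambda>v. \<Sum>i\<in>UNIV. v $ i * py i g x y)) (at y)"
proof -
  note d = slice_y_derivative[OF assms]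
  have "frechet_derivative (\<lambda>(x, y). g x y) (at (x, y)) (0, v) = (\<Sum>i\<in>UNIV. v $ i * py i g x y)" for v
    using linear_sum_axis[OF has_derivative_linear[OF d], of v] by (simp add: py_eq[OF assms])
  then show ?thesis using d by simp
qed

end

text \<open>All derivatives involved are directional derivatives of the uncurried function on the
  product, along \<open>(0, axis i 1)\<close> or \<open>(axis i 1, 0)\<close>, so
  \<open>mixed_derivative_symmetric\<close> covers both cases.\<close>

lemma py_py_commute:
  fixes U :: "(real^'n::finite) set"
  assumes U: "open U" and g: "smooth_on (U \<times> (UNIV - {0})) (\<lambda>(x, y). g x y)" and xy: "x \<in> U" "y \<noteq> 0"
  shows "py i (py j g) x y = py j (py i g) x y" "px i (py j g) x y = py j (px i g) x y"
proof -
  let ?G = "\<lambda>(x, y). g x y" and ?S = "U \<times> (UNIV - {0 :: real^'n})"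
  have S: "open ?S" "(x, y) \<in> ?S" using open_slit[OF U] xy by auto
  have c2: "C_diff_on 2 ?S ?G" using g by (simp add: smooth_on_def)
  have *: "frechet_derivative (\<lambda>(x, y). py j g x y) (at (x, y)) =
      frechet_derivative (\<lambda>z. frechet_derivative ?G (at z) (0, axis j 1)) (at (x, y))" for j
    by (rule frechet_derivative_cong_open[OF S]) (erule SigmaE, simp add: py_eq[OF U g])
  have **: "frechet_derivative (\<lambda>(x, y). px j g x y) (at (x, y)) =
      frechet_derivative (\<lambda>z. frechet_derivative ?G (at z) (axis j 1, 0)) (at (x, y))" for j
    by (rule frechet_derivative_cong_open[OF S]) (erule SigmaE, simp add: px_eq[OF U g])
  show "py i (py j g) x y = py j (py i g) x y"
    unfolding py_eq[OF U smooth_py[OF U g] xy] * by (rule mixed_derivative_symmetric[OF S c2])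
  show "px i (py j g) x y = py j (px i g) x y"
    unfolding py_eq[OF U smooth_px[OF U g] xy] px_eq[OF U smooth_py[OF U g] xy] * **
    by (rule mixed_derivative_symmetric[OF S c2])
qed

lemma smooth_slice_continuous:
  assumes "smooth_on (U \<times> (UNIV - {0})) (\<lambda>(x, y). g x y)" "x \<in> U"
  shows "continuous_on (- {0}) (\<lambda>y. g x y)"
  by (rule continuous_on_compose2[OF smooth_on_continuous_on[OF assms(1)], of "- {0}" "\<lambda>y. (x, y)", simplified])
    (use assms(2) in \<open>auto intro!: continuous_intros\<close>)

text \<open>A symmetric 2 by 2 matrix that annihilates a nonzero vector y is a multiple of the
  square of (y2, - y1). Here y is nonzero because Euler's relation gives \<open>f\<close>, which is
  nonzero.\<close>

lemma planar_hessian: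
  fixes f f1 f2 :: real
  assumes eul: "y1 * f1 + y2 * f2 = f" "y1 * f11 + y2 * f12 = 0" "y1 * f12 + y2 * f22 = 0"
    and f: "f \<noteq> 0"
  shows "\<exists>h. f11 = h * y2\<^sup>2 \<and> f12 = - h * (y1 * y2) \<and> f22 = h * y1\<^sup>2"
proof (cases "y2 = 0")
  case True
  then have y1: "y1 \<noteq> 0" using eul f by auto
  then show ?thesis using eul True by (intro exI[of _ "f22 / y1\<^sup>2"]) auto
next
  case False
  have f12: "f12 = - y1 * f11 / y2" using eul(2) False by (simp add: field_simps)
  have "f22 = - y1 * f12 / y2" using eul(3) False by (simp add: field_simps)
  then have "f22 = y1\<^sup>2 * f11 / y2\<^sup>2" unfolding f12 by (simp add: power2_eq_square)
  then show ?thesis using False f12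
    by (intro exI[of _ "f11 / y2\<^sup>2"]) (auto simp: power2_eq_square)
qed

text \<open>With \<open>f\<^sub>i\<^sub>j = h \<omega>\<^sub>i \<omega>\<^sub>j\<close>, \<open>\<omega> = (y\<^sub>2, - y\<^sub>1)\<close>, contract the system with \<open>(f\<^sub>2, - f\<^sub>1)\<close>.\<close>

lemma torsion_cubic_identity:
  fixes f f1 f2 :: real
  assumes eul: "y1 * f1 + y2 * f2 = f" "y1 * f11 + y2 * f12 = 0" "y1 * f12 + y2 * f22 = 0"
    and f: "f \<noteq> 0"
    and e1: "(f1 * f1 + f * f11) * (Q1 - m * y1) + (f1 * f2 + f * f12) * (Q2 - m * y2) = - f * T * y2"
    and e2: "(f2 * f1 + f * f12) * (Q1 - m * y1) + (f2 * f2 + f * f22) * (Q2 - m * y2) = f * T * y1"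
  shows "T * (y2 * t1 - y1 * t2)\<^sup>2 =
    (y1 * Q2 - y2 * Q1) * (t1 * (t1 * f11 + t2 * f12) + t2 * (t1 * f12 + t2 * f22))"
proof -
  obtain h where h: "f11 = h * y2\<^sup>2" "f12 = - h * (y1 * y2)" "f22 = h * y1\<^sup>2"
    using planar_hessian[OF eul f] by blast
  \<comment> \<open>This contraction removes the rank one part \<open>f_i f_j\<close> of the tensor.
    The projective term \<open>m * y\<close> drops out because the Hessian annihilates y.\<close>
  have "f2 * (- f * T * y2) - f1 * (f * T * y1) =
      f * h * (y2 * Q1 - y1 * Q2) * (y1 * f1 + y2 * f2)"
    unfolding e1[symmetric] e2[symmetric] h
    by (simp add: power2_eq_square algebra_simps)
  moreover have "f2 * (- f * T * y2) - f1 * (f * T * y1) = - f * T * (y1 * f1 + y2 * f2)"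
    by (simp add: algebra_simps)
  ultimately have "(f * f) * (- T) = (f * f) * (h * (y2 * Q1 - y1 * Q2))"
    unfolding eul(1) by (simp add: mult_ac)
  then have "- T = h * (y2 * Q1 - y1 * Q2)" using f by (simp only: mult_cancel_left) auto
  then have T: "T = h * (y1 * Q2 - y2 * Q1)" by (simp add: algebra_simps)
  show ?thesis unfolding T h by (simp add: power2_eq_square algebra_simps)
qed

section \<open>Spray, torsion and the Douglas condition in coordinates\<close>

abbreviation energy :: "(real^'n \<Rightarrow> real^'n \<Rightarrow> real) \<Rightarrow> real^'n \<Rightarrow> real^'n \<Rightarrow> real" where
  "energy f \<equiv> (\<lambda>x y. (1/2) * (f x y)\<^sup>2)"

text \<open>The formula of \<open>finsler_spray\<close> for a bare coordinate function, so that the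
  local computations do not mention the manifold.\<close>

definition spray_of :: "(real^'n::finite \<Rightarrow> real^'n \<Rightarrow> real) \<Rightarrow> real^'n \<Rightarrow> real^'n \<Rightarrow> real^'n" where
  "spray_of f x y = (\<chi> i. \<Sum>j\<in>UNIV. matrix_inv (fundamental_tensor f x y) $ i $ j *
     ((\<Sum>l\<in>UNIV. px l (py j (energy f)) x y * y $ l) - px j (energy f) x y))"

locale finsler_chart =
  fixes f :: "real^2 \<Rightarrow> real^2 \<Rightarrow> real" and U :: "(real^2) set"
  assumes U: "open U" and smooth: "smooth_on (U \<times> (UNIV - {0})) (\<lambda>(x, y). f x y)"
    and pos: "x \<in> U \<Longrightarrow> y \<noteq> 0 \<Longrightarrow> f x y > 0"
    and hom: "x \<in> U \<Longrightarrow> y \<noteq> 0 \<Longrightarrow> l > 0 \<Longrightarrow> f x (l *\<^sub>R y) = l * f x y"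
    and posdef: "x \<in> U \<Longrightarrow> y \<noteq> 0 \<Longrightarrow> z \<noteq> 0 \<Longrightarrow> z \<bullet> (fundamental_tensor f x y *v z) > 0"
begin

lemmas smooth_py_f = smooth_py[OF U smooth]

lemma py_half_square:
  assumes "x \<in> U" "y \<noteq> 0"
  shows "py j (energy f) x y = f x y * py j f x y"
    "py j (\<lambda>x y. (f x y)\<^sup>2) x y = 2 * (f x y * py j f x y)"
    "px j (energy f) x y = f x y * px j f x y"
proof -
  note dy = slice_y_derivative[OF U smooth assms] and dx = slice_x_derivative[OF U smooth assms]
  show "py j (energy f) x y = f x y * py j f x y"
    unfolding py_eq[OF U smooth assms] py_def[of _ "\<lambda>x y. (1/2) * (f x y)\<^sup>2"]
    by (rule pderiv_at_eq[THEN trans], rule has_derivative_mult_right[OF has_derivative_power[OF dy]]) simp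
  show "py j (\<lambda>x y. (f x y)\<^sup>2) x y = 2 * (f x y * py j f x y)"
    unfolding py_eq[OF U smooth assms] py_def[of _ "\<lambda>x y. (f x y)\<^sup>2"]
    by (rule pderiv_at_eq[THEN trans], rule has_derivative_power[OF dy]) simp
  show "px j (energy f) x y = f x y * px j f x y"
    unfolding px_eq[OF U smooth assms] px_def[of _ "\<lambda>x y. (1/2) * (f x y)\<^sup>2"]
    by (rule pderiv_at_eq[THEN trans], rule has_derivative_mult_right[OF has_derivative_power[OF dx]]) simp
qed

lemma fundamental_tensor_eq:
  assumes "x \<in> U" "y \<noteq> 0"
  shows "fundamental_tensor f x y $ i $ j = py i f x y * py j f x y + f x y * py i (py j f) x y"
proof -
  note d1 = slice_y_derivative[OF U smooth assms] and d2 = slice_y_derivative[OF U smooth_py_f assms]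
  have "((\<lambda>y. py j (\<lambda>x y. (f x y)\<^sup>2) x y) has_derivative
     (\<lambda>v. 2 * (f x y * frechet_derivative (\<lambda>(x, y). py j f x y) (at (x, y)) (0, v) +
       frechet_derivative (\<lambda>(x, y). f x y) (at (x, y)) (0, v) * py j f x y))) (at y)"
    by (rule has_derivative_transform_within_open[OF has_derivative_mult_right[OF has_derivative_mult[OF d1 d2]],
          of "- {0}"])
      (use assms py_half_square in auto)
  from pderiv_at_eq[OF this, of i]
  have "py i (py j (\<lambda>x y. (f x y)\<^sup>2)) x y = 2 * (py i f x y * py j f x y + f x y * py i (py j f) x y)"
    unfolding py_def[of i "py j (\<lambda>x y. (f x y)\<^sup>2)"]
    by (simp add: py_eq[OF U smooth assms] py_eq[OF U smooth_py_f assms])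
  then show ?thesis by (simp add: fundamental_tensor_def)
qed

lemma px_py_half_square:
  assumes "x \<in> U" "y \<noteq> 0"
  shows "px l (py j (energy f)) x y = px l f x y * py j f x y + f x y * py j (px l f) x y"
proof -
  note d1 = slice_x_derivative[OF U smooth assms] and d2 = slice_x_derivative[OF U smooth_py_f assms]
  have "((\<lambda>x. py j (energy f) x y) has_derivative
     (\<lambda>v. f x y * frechet_derivative (\<lambda>(x, y). py j f x y) (at (x, y)) (v, 0) +
       frechet_derivative (\<lambda>(x, y). f x y) (at (x, y)) (v, 0) * py j f x y)) (at x)"
    by (rule has_derivative_transform_within_open[OF has_derivative_mult[OF d1 d2], of U])
      (use assms py_half_square U in auto)
  from pderiv_at_eq[OF this, of l] show ?thesis
    unfolding px_def[of l "py j (energy f)"]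
      py_py_commute(2)[OF U smooth assms, symmetric]
    by (simp add: px_eq[OF U smooth assms] px_eq[OF U smooth_py_f assms])
qed

text \<open>Multiplying by the tensor cancels the inverse matrix in the spray, so no inverse is ever
  computed. Positive definiteness makes the tensor invertible.\<close>

lemma fundamental_tensor_spray:
  assumes "x \<in> U" "y \<noteq> 0"
  shows "(\<Sum>j\<in>UNIV. fundamental_tensor f x y $ i $ j * spray_of f x y $ j) =
    (\<Sum>l\<in>UNIV. (px l f x y * py i f x y + f x y * py i (px l f) x y) * y $ l) - f x y * px i f x y"
proof -
  let ?g = "fundamental_tensor f x y"
  define e :: "real^2" where "e = (\<chi> j. (\<Sum>l\<in>UNIV. px l (py j (energy f)) x y * y $ l)
      - px j (energy f) x y)"
  have s: "spray_of f x y = matrix_inv ?g *v e"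
    by (simp add: spray_of_def e_def matrix_vector_mult_def)
  have "\<forall>z. ?g *v z = 0 \<longrightarrow> z = 0" using posdef[OF assms] by (metis inner_zero_right less_irrefl)
  then have "invertible ?g" using matrix_left_invertible_ker invertible_left_inverse by blast
  then have "?g ** matrix_inv ?g = mat 1"
    unfolding invertible_def matrix_inv_def by (rule someI2_ex) blast
  then have "?g *v spray_of f x y = e"
    unfolding s by (simp add: matrix_vector_mul_assoc)
  then have "(?g *v spray_of f x y) $ i = e $ i" by simp
  then show ?thesis
    by (simp only: e_def matrix_vector_mult_def vec_lambda_beta px_py_half_square[OF assms] py_half_square[OF assms])
qed

lemma euler:
  assumes "x \<in> U" "y \<noteq> 0"
  shows "y $ 1 * py 1 f x y + y $ 2 * py 2 f x y = f x y"
    "l > 0 \<Longrightarrow> py i f x (l *\<^sub>R y) = py i f x y"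
    "y $ 1 * py 1 (py i f) x y + y $ 2 * py 2 (py i f) x y = 0"
proof -
  note d = slice_y_linear[OF U smooth assms(1)]
  note h = homogeneous_derivative[OF d hom[OF assms(1)]]
  show "y $ 1 * py 1 f x y + y $ 2 * py 2 f x y = f x y"
    using h(2)[of 1 y] assms by (simp add: sum_2)
  have 0: "py i f x (l *\<^sub>R y) = py i f x y" if "l > 0" for l
    using h(1)[of l y "axis i 1"] that assms exhaust_2[of i] by (auto simp: sum_2 axis_def)
  then show "l > 0 \<Longrightarrow> py i f x (l *\<^sub>R y) = py i f x y" .
  have "((\<lambda>l. l *\<^sub>R y) has_derivative (\<lambda>l. l *\<^sub>R y)) (at 1)" by (auto intro!: derivative_eq_intros)
  moreover have "(py i f x has_derivative (\<lambda>v. \<Sum>j\<in>UNIV. v $ j * py j (py i f) x y)) (at (1 *\<^sub>R y))"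
    using slice_y_linear[OF U smooth_py_f assms] by simp
  ultimately have "((\<lambda>l. py i f x (l *\<^sub>R y)) has_derivative
      (\<lambda>l. \<Sum>j\<in>UNIV. (l *\<^sub>R y) $ j * py j (py i f) x y)) (at 1)"
    by (rule has_derivative_compose)
  moreover have "((\<lambda>l. py i f x (l *\<^sub>R y)) has_derivative (\<lambda>l. 0)) (at 1)"
    by (rule has_derivative_transform_within_open[of "\<lambda>l. py i f x y" _ _ _ "{0<..}"]) (auto simp: 0)
  ultimately have "(\<lambda>l. \<Sum>j\<in>UNIV. (l *\<^sub>R y) $ j * py j (py i f) x y) = (\<lambda>l. 0)"
    using has_derivative_unique by blast
  from fun_cong[OF this, of 1] show "y $ 1 * py 1 (py i f) x y + y $ 2 * py 2 (py i f) x y = 0"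
    by (simp add: sum_2)
qed

text \<open>Inserting \<open>N\<close> into the lowered spray yields the tensor applied to
  \<open>N(y, y)\<close>, plus a term with N antisymmetrised in its lower indices, that is,
  \<open>f\<close> times \<open>dF(t)\<close> times (- y2, y1). Subtracting the former leaves the
  tensor applied to \<open>Q - m y\<close>, which is the system of
  \<open>torsion_cubic_identity\<close>.\<close>

lemma douglas_relation:
  assumes xy: "x \<in> U" "y \<noteq> 0"
    and N: "\<And>j y. y \<noteq> 0 \<Longrightarrow> px j f x y = (\<Sum>i\<in>UNIV. \<Sum>k\<in>UNIV. N i j k * y $ k * py i f x y)"
    and D: "\<And>i. spray_of f x y $ i = (\<Sum>j\<in>UNIV. \<Sum>k\<in>UNIV. D i j k * y $ j * y $ k) - m * y $ i"
    and t: "\<And>i. t $ i = N i 1 2 - N i 2 1"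
    and Q: "\<And>i. Q i = (\<Sum>j\<in>UNIV. \<Sum>k\<in>UNIV. (D i j k - N i j k) * y $ j * y $ k)"
  shows "(t $ 1 * py 1 f x y + t $ 2 * py 2 f x y) * (y $ 2 * t $ 1 - y $ 1 * t $ 2)\<^sup>2 =
    (y $ 1 * Q 2 - y $ 2 * Q 1) *
    (t $ 1 * (t $ 1 * py 1 (py 1 f) x y + t $ 2 * py 1 (py 2 f) x y) +
     t $ 2 * (t $ 1 * py 1 (py 2 f) x y + t $ 2 * py 2 (py 2 f) x y))"
proof -
  let ?F = "f x y" and ?f = "\<lambda>i. py i f x y" and ?h = "\<lambda>i j. py i (py j f) x y"
  have sym: "?h 2 1 = ?h 1 2" using py_py_commute(1)[OF U smooth xy] by blast
  have pypx: "py j (px l f) x y = (\<Sum>i\<in>UNIV. N i l j * ?f i + (\<Sum>k\<in>UNIV. N i l k * y $ k * ?h j i))" for j l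
  proof -
    have dy: "((\<lambda>y. py i f x y) has_derivative (\<lambda>v. \<Sum>j\<in>UNIV. v $ j * ?h j i)) (at y)" for i
      by (rule slice_y_linear[OF U smooth_py_f xy])
    have "((\<lambda>y. \<Sum>i\<in>UNIV. \<Sum>k\<in>UNIV. N i l k * y $ k * py i f x y) has_derivative
      (\<lambda>v. \<Sum>i\<in>UNIV. \<Sum>k\<in>UNIV. N i l k * y $ k * (\<Sum>j\<in>UNIV. v $ j * ?h j i) + N i l k * v $ k * ?f i)) (at y)"
      by (intro has_derivative_sum has_derivative_mult[OF has_derivative_mult_right dy]
          bounded_linear.has_derivative[OF bounded_linear_vec_nth] has_derivative_ident)
    then have "((\<lambda>y. px l f x y) has_derivative
      (\<lambda>v. \<Sum>i\<in>UNIV. \<Sum>k\<in>UNIV. N i l k * y $ k * (\<Sum>j\<in>UNIV. v $ j * ?h j i) + N i l k * v $ k * ?f i)) (at y)"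
      by (rule has_derivative_transform_within_open[of _ _ _ _ "- {0}"]) (use xy N in auto)
    from pderiv_at_eq[OF this, of j] show ?thesis
      unfolding py_def[of j "px l f"]
      using exhaust_2[of j] by (auto simp: sum_2 axis_def algebra_simps)
  qed
  have sp: "(\<Sum>j\<in>UNIV. (?f i * ?f j + ?F * ?h i j) * spray_of f x y $ j) =
    (\<Sum>l\<in>UNIV. (px l f x y * ?f i + ?F * py i (px l f) x y) * y $ l) - ?F * px i f x y" for i
    using fundamental_tensor_spray[OF xy, of i] unfolding fundamental_tensor_eq[OF xy] .
  let ?T = "t $ 1 * ?f 1 + t $ 2 * ?f 2"
  have e1: "(?f 1 * ?f 1 + ?F * ?h 1 1) * (Q 1 - m * y $ 1) + (?f 1 * ?f 2 + ?F * ?h 1 2) * (Q 2 - m * y $ 2)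
      = - ?F * ?T * y $ 2"
    using sp[of 1] unfolding D pypx N[OF xy(2)] Q t sum_2 sym by (simp add: algebra_simps)
  have e2: "(?f 2 * ?f 1 + ?F * ?h 1 2) * (Q 1 - m * y $ 1) + (?f 2 * ?f 2 + ?F * ?h 2 2) * (Q 2 - m * y $ 2)
      = ?F * ?T * y $ 1"
    using sp[of 2] unfolding D pypx N[OF xy(2)] Q t sum_2 sym by (simp add: algebra_simps)
  show ?thesis
    by (rule torsion_cubic_identity[OF _ _ _ _ e1 e2])
      (use euler(1)[OF xy] euler(3)[OF xy, of 1] euler(3)[OF xy, of 2] pos[OF xy] sym in auto)
qed

text \<open>The spray is known only at \<open>k y\<close> with an uncontrolled \<open>k > 0\<close>.
  Nothing is lost, since both sides of the relation are homogeneous of degree 2: \<open>Df\<close>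
  has degree 0, \<open>C\<close> degree 3 and \<open>H\<close> degree -1.\<close>

lemma randers_fibre:
  assumes x: "x \<in> U"
    and N: "\<And>j y. y \<noteq> 0 \<Longrightarrow> px j f x y = (\<Sum>i\<in>UNIV. \<Sum>k\<in>UNIV. N i j k * y $ k * py i f x y)"
    and D: "\<And>y. y \<noteq> 0 \<Longrightarrow> \<exists>k>0. \<exists>m. \<forall>i. spray_of f x (k *\<^sub>R y) $ i =
      (\<Sum>j\<in>UNIV. \<Sum>l\<in>UNIV. D i j l * (k *\<^sub>R y) $ j * (k *\<^sub>R y) $ l) - m * (k *\<^sub>R y) $ i"
    and tors: "N i0 j0 k0 \<noteq> N i0 k0 j0"
  shows "\<exists>u v w. \<forall>y. y \<noteq> 0 \<longrightarrow> f x y = sqrt ((u \<bullet> y)\<^sup>2 + (v \<bullet> y)\<^sup>2) + w \<bullet> y"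
proof -
  \<comment> \<open>Antisymmetry in two lower indices leaves a single independent pair in dimension
    two, so the torsion is encoded by a vector.\<close>
  define t :: "real^2" where "t = (\<chi> i. N i 1 2 - N i 2 1)"
  have t: "t $ i = N i 1 2 - N i 2 1" for i by (simp add: t_def)
  have t0: "t \<noteq> 0"
  proof -
    have "t $ i0 \<noteq> 0" using tors exhaust_2[of j0] exhaust_2[of k0] by (auto simp: t)
    then show ?thesis by auto
  qed
  define Q where "Q i y = (\<Sum>j\<in>UNIV. \<Sum>k\<in>UNIV. (D i j k - N i j k) * y $ j * y $ k)" for i and y :: "real^2"
  define C where "C y = y $ 1 * Q 2 y - y $ 2 * Q 1 y" for y
  define H where "H y = t $ 1 * (t $ 1 * py 1 (py 1 f) x y + t $ 2 * py 1 (py 2 f) x y) +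
     t $ 2 * (t $ 1 * py 1 (py 2 f) x y + t $ 2 * py 2 (py 2 f) x y)" for y
  define Df where "Df y v = (\<Sum>i\<in>UNIV. v $ i * py i f x y)" for y v
  define c where "c a b e = D a b e - N a b e" for a b e
  \<comment> \<open>As a binary cubic form, \<open>C\<close> is odd, homogeneous of degree 3 and a
    cubic polynomial on every line; all three facts are used below.\<close>
  have C_eq: "C y = c 2 1 1 * y $ 1 ^ 3 + (c 2 1 2 + c 2 2 1 - c 1 1 1) * (y $ 1)\<^sup>2 * y $ 2
      + (c 2 2 2 - c 1 1 2 - c 1 2 1) * y $ 1 * (y $ 2)\<^sup>2 - c 1 2 2 * y $ 2 ^ 3" for y
    by (simp add: C_def Q_def c_def sum_2 power2_eq_square power3_eq_cube algebra_simps)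
  have df: "(f x has_derivative Df y) (at y)" if "y \<noteq> 0" for y
    unfolding Df_def by (rule slice_y_linear[OF U smooth x that])
  have d2: "((\<lambda>s. Df (y + s *\<^sub>R t) t) has_real_derivative H y) (at 0)" if y: "y \<noteq> 0" for y
  proof -
    have 1: "((\<lambda>s. y + s *\<^sub>R t) has_derivative (\<lambda>s. s *\<^sub>R t)) (at 0)"
      by (auto intro!: derivative_eq_intros)
    have 2: "(py i f x has_derivative (\<lambda>v. \<Sum>j\<in>UNIV. v $ j * py j (py i f) x y)) (at (y + 0 *\<^sub>R t))" for i
      using slice_y_linear[OF U smooth_py_f x y] by simp
    have 3: "((\<lambda>s. py i f x (y + s *\<^sub>R t)) has_derivative (\<lambda>s. \<Sum>j\<in>UNIV. (s *\<^sub>R t) $ j * py j (py i f) x y)) (at 0)" for i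
      using has_derivative_compose[OF 1 2] .
    have "((\<lambda>s. Df (y + s *\<^sub>R t) t) has_derivative
      (\<lambda>s. \<Sum>i\<in>UNIV. t $ i * (\<Sum>j\<in>UNIV. (s *\<^sub>R t) $ j * py j (py i f) x y))) (at 0)"
      unfolding Df_def by (intro has_derivative_sum has_derivative_mult_right 3)
    moreover have "py 2 (py 1 f) x y = py 1 (py 2 f) x y" using py_py_commute(1)[OF U smooth x y] .
    then have "(\<lambda>s. \<Sum>i\<in>UNIV. t $ i * (\<Sum>j\<in>UNIV. (s *\<^sub>R t) $ j * py j (py i f) x y)) = (*) (H y)"
      by (intro ext) (simp add: H_def sum_2 algebra_simps)
    ultimately show ?thesis unfolding has_field_derivative_def by simp
  qed
  have homD: "Df (l *\<^sub>R y) v = Df y v" if "l > 0" "y \<noteq> 0" for l y v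
    unfolding Df_def using euler(2)[OF x that(2,1)] by simp
  \<comment> \<open>\<open>H\<close> is the derivative of \<open>Df\<close> in direction
    \<open>t\<close>, so its degree follows from that of \<open>Df\<close> by the substitution of
    \<open>s / l\<close> for \<open>s\<close>.\<close>
  have homH: "H (l *\<^sub>R y) = H y / l" if l: "l > 0" and y: "y \<noteq> 0" for l y
  proof -
    have eq: "\<forall>\<^sub>F s in nhds 0. Df (l *\<^sub>R y + s *\<^sub>R t) t = Df (y + (s / l) *\<^sub>R t) t"
    proof -
      have "open {s. y + (s / l) *\<^sub>R t \<noteq> 0}"
        by (intro open_Collect_neq continuous_intros) (use l in auto)
      then have "\<forall>\<^sub>F s in nhds 0. y + (s / l) *\<^sub>R t \<noteq> 0"
        unfolding eventually_nhds using y by (intro exI[of _ "{s. y + (s / l) *\<^sub>R t \<noteq> 0}"]) auto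
      then show ?thesis
      proof (rule eventually_mono)
        fix s assume "y + (s / l) *\<^sub>R t \<noteq> 0"
        from homD[OF l this, of t] show "Df (l *\<^sub>R y + s *\<^sub>R t) t = Df (y + (s / l) *\<^sub>R t) t"
          using l by (simp add: scaleR_add_right)
      qed
    qed
    have "((\<lambda>s. s / l) has_real_derivative 1 / l) (at 0)"
      using l by (auto intro!: derivative_eq_intros)
    moreover have "((\<lambda>s. Df (y + s *\<^sub>R t) t) has_real_derivative H y) (at (0 / l))" using d2[OF y] by simp
    ultimately have "((\<lambda>s. Df (y + (s / l) *\<^sub>R t) t) has_real_derivative H y * (1 / l)) (at 0)"
      using DERIV_chain2[of "\<lambda>s. Df (y + s *\<^sub>R t) t" "H y" "\<lambda>s. s / l" 0 "1 / l" UNIV] by blast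
    then have "((\<lambda>s. Df (l *\<^sub>R y + s *\<^sub>R t) t) has_real_derivative H y * (1 / l)) (at 0)"
      using DERIV_cong_ev[OF refl eq refl] by blast
    then show ?thesis using DERIV_unique[OF d2[of "l *\<^sub>R y"]] l y by fastforce
  qed
  show ?thesis
  proof (rule planar_norm_cubic_relation[where C = C])
    show "(f x has_derivative Df y) (at y)" if "y \<noteq> 0" for y using df that .
    show "f x (l *\<^sub>R y) = l * f x y" if "l > 0" "y \<noteq> 0" for l y using hom x that by blast
    show "f x y > 0" if "y \<noteq> 0" for y using pos x that .
    show "continuous_on (- {0}) (\<lambda>y. Df y t)"
      unfolding Df_def by (intro continuous_intros smooth_slice_continuous[OF smooth_py_f x])
    show "((\<lambda>s. Df (y + s *\<^sub>R t) t) has_real_derivative H y) (at 0)" if "y \<noteq> 0" for y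
      by (rule d2[OF that])
    show "continuous_on (- {0}) H"
      unfolding H_def by (intro continuous_intros smooth_slice_continuous[OF smooth_py[OF U smooth_py_f] x])
    show "H y > 0" if om: "y $ 2 * t $ 1 - y $ 1 * t $ 2 \<noteq> 0" for y
    proof -
      have y: "y \<noteq> 0" using om by auto
      let ?F = "f x y" and ?f = "\<lambda>i. py i f x y" and ?h = "\<lambda>i j. py i (py j f) x y"
      have F: "?F > 0" using pos x y .
      have sym: "?h 2 1 = ?h 1 2" using py_py_commute(1)[OF U smooth x y] .
      note eu = euler[OF x y]
      obtain h where h: "?h 1 1 = h * (y $ 2)\<^sup>2" "?h 1 2 = - h * (y $ 1 * y $ 2)" "?h 2 2 = h * (y $ 1)\<^sup>2"
        using planar_hessian[OF eu(1), of "?h 1 1" "?h 1 2" "?h 2 2"] eu(3)[of 1] eu(3)[of 2] sym F by auto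
      \<comment> \<open>\<open>z\<close> spans the kernel of the differential of the norm. The rank
        one part of the tensor vanishes on it, so positive definiteness there is exactly the
        positivity of \<open>h\<close>.\<close>
      define z :: "real^2" where "z = vector [?f 2, - ?f 1]"
      have z: "z $ 1 = ?f 2" "z $ 2 = - ?f 1" by (simp_all add: z_def)
      have "z \<noteq> 0"
      proof
        assume "z = 0"
        then have "?f 2 = 0" "?f 1 = 0" using z by auto
        then show False using eu(1) F by simp
      qed
      from posdef[OF x y this]
      have "z $ 1 * ((?f 1 * ?f 1 + ?F * ?h 1 1) * z $ 1 + (?f 1 * ?f 2 + ?F * ?h 1 2) * z $ 2) +
         z $ 2 * ((?f 2 * ?f 1 + ?F * ?h 2 1) * z $ 1 + (?f 2 * ?f 2 + ?F * ?h 2 2) * z $ 2) > 0"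
        by (simp add: inner_vec_def matrix_vector_mult_def sum_2 fundamental_tensor_eq[OF x y])
      then have "?F * h * (y $ 1 * ?f 1 + y $ 2 * ?f 2)\<^sup>2 > 0"
        unfolding z sym h by (simp add: power2_eq_square algebra_simps)
      then have "h > 0" unfolding eu(1) using F by (auto simp: zero_less_mult_iff)
      moreover have "H y = h * (y $ 2 * t $ 1 - y $ 1 * t $ 2)\<^sup>2"
        unfolding H_def h by (simp add: power2_eq_square algebra_simps)
      ultimately show ?thesis using om by simp
    qed
    show "Df y t * (y $ 2 * t $ 1 - y $ 1 * t $ 2)\<^sup>2 = C y * H y" if y: "y \<noteq> 0" for y
    proof -
      obtain k m where k: "k > 0" and sp: "\<And>i. spray_of f x (k *\<^sub>R y) $ i =
        (\<Sum>j\<in>UNIV. \<Sum>l\<in>UNIV. D i j l * (k *\<^sub>R y) $ j * (k *\<^sub>R y) $ l) - m * (k *\<^sub>R y) $ i"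
        using D[OF y] by blast
      have ky: "k *\<^sub>R y \<noteq> 0" using k y by simp
      have "Df (k *\<^sub>R y) t * ((k *\<^sub>R y) $ 2 * t $ 1 - (k *\<^sub>R y) $ 1 * t $ 2)\<^sup>2 = C (k *\<^sub>R y) * H (k *\<^sub>R y)"
        using douglas_relation[OF x ky N sp t, of "\<lambda>i. Q i (k *\<^sub>R y)"]
        by (simp add: Q_def Df_def C_def H_def sum_2)
      moreover have "((k *\<^sub>R y) $ 2 * t $ 1 - (k *\<^sub>R y) $ 1 * t $ 2)\<^sup>2 = k\<^sup>2 * (y $ 2 * t $ 1 - y $ 1 * t $ 2)\<^sup>2"
        by (simp add: power2_eq_square algebra_simps)
      moreover have "C (k *\<^sub>R y) = k\<^sup>2 * k * C y"
        unfolding C_eq by (simp add: power2_eq_square power3_eq_cube algebra_simps)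
      ultimately have "k\<^sup>2 * (Df y t * (y $ 2 * t $ 1 - y $ 1 * t $ 2)\<^sup>2) = k\<^sup>2 * (C y * H y)"
        using homD[OF k y] homH[OF k y] k by (simp add: mult_ac)
      then show ?thesis using k by simp
    qed
    show "C (- y) = - C y" for y by (simp add: C_eq)
    show "t \<noteq> 0" by (rule t0)
    show "\<exists>c0 c1 c2 c3. \<forall>s. C (n + s *\<^sub>R t) = c0 + c1 * s + c2 * s\<^sup>2 + c3 * s ^ 3" for n
    proof -
      define k0 k1 k2 k3 where k: "k0 = c 2 1 1" "k1 = c 2 1 2 + c 2 2 1 - c 1 1 1"
        "k2 = c 2 2 2 - c 1 1 2 - c 1 2 1" "k3 = - c 1 2 2"
      have "C (n + s *\<^sub>R t) = (k0 * n $ 1 ^ 3 + k1 * (n $ 1)\<^sup>2 * n $ 2 + k2 * n $ 1 * (n $ 2)\<^sup>2 + k3 * n $ 2 ^ 3)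
        + (3 * k0 * (n $ 1)\<^sup>2 * t $ 1 + k1 * (2 * n $ 1 * t $ 1 * n $ 2 + (n $ 1)\<^sup>2 * t $ 2)
          + k2 * (t $ 1 * (n $ 2)\<^sup>2 + 2 * n $ 1 * n $ 2 * t $ 2) + 3 * k3 * (n $ 2)\<^sup>2 * t $ 2) * s
        + (3 * k0 * n $ 1 * (t $ 1)\<^sup>2 + k1 * ((t $ 1)\<^sup>2 * n $ 2 + 2 * n $ 1 * t $ 1 * t $ 2)
          + k2 * (n $ 1 * (t $ 2)\<^sup>2 + 2 * n $ 2 * t $ 1 * t $ 2) + 3 * k3 * n $ 2 * (t $ 2)\<^sup>2) * s\<^sup>2
        + (k0 * t $ 1 ^ 3 + k1 * (t $ 1)\<^sup>2 * t $ 2 + k2 * t $ 1 * (t $ 2)\<^sup>2 + k3 * t $ 2 ^ 3) * s ^ 3" for s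
        unfolding C_eq k[symmetric] by (simp add: k power2_eq_square power3_eq_cube algebra_simps)
      then show ?thesis by blast
    qed
  qed
qed

end

section \<open>Charts and tangent vectors\<close>

locale manifold =
  fixes X :: "'m topology" and A :: "('m, 'n::finite) chart set"
  assumes manifold: "smooth_manifold X A"
begin

abbreviation overlap :: "('m, 'n) chart \<Rightarrow> ('m, 'n) chart \<Rightarrow> (real^'n) set" where
  "overlap \<phi> \<psi> \<equiv> cmap \<phi> ` (cdom \<phi> \<inter> cdom \<psi>)"

abbreviation jac :: "('m, 'n) chart \<Rightarrow> ('m, 'n) chart \<Rightarrow> real^'n \<Rightarrow> real^'n \<Rightarrow> real^'n" where
  "jac \<phi> \<psi> x \<equiv> frechet_derivative (transition \<phi> \<psi>) (at x)"

abbreviation curve :: "('m, 'n) chart \<Rightarrow> (real \<Rightarrow> real^'n) \<Rightarrow> real \<Rightarrow> 'm" where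
  "curve \<phi> x \<equiv> cinv \<phi> \<circ> x"

abbreviation field :: "('m, 'n) chart \<Rightarrow> (real \<Rightarrow> real^'n) \<Rightarrow> (real \<Rightarrow> real^'n) \<Rightarrow> real \<Rightarrow> ('m, 'n) tvec" where
  "field \<phi> x v t \<equiv> coord_vec A \<phi> (curve \<phi> x t) (v t)"

lemma chart: "\<phi> \<in> A \<Longrightarrow> is_chart X \<phi>"
  using manifold by (simp add: smooth_manifold_def)

lemma openin_cdom: "\<phi> \<in> A \<Longrightarrow> openin X (cdom \<phi>)"
  and open_cran: "\<phi> \<in> A \<Longrightarrow> open (cran \<phi>)"
  and homeo: "\<phi> \<in> A \<Longrightarrow> homeomorphic_map (subtopology X (cdom \<phi>)) (top_of_set (cran \<phi>)) (cmap \<phi>)"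
  using chart by (auto simp: is_chart_def)

lemma cdom_subset: "\<phi> \<in> A \<Longrightarrow> cdom \<phi> \<subseteq> topspace X"
  using openin_cdom openin_subset by blast

lemma inj_cmap: "\<phi> \<in> A \<Longrightarrow> inj_on (cmap \<phi>) (cdom \<phi>)"
  using homeomorphic_imp_injective_map[OF homeo] cdom_subset by (simp add: Int_absorb1)

lemma cinv_cmap: "\<phi> \<in> A \<Longrightarrow> p \<in> cdom \<phi> \<Longrightarrow> cinv \<phi> (cmap \<phi> p) = p"
  unfolding cinv_def using inj_cmap by (simp add: inv_into_f_f)

lemma cinv_in: "x \<in> cran \<phi> \<Longrightarrow> cinv \<phi> x \<in> cdom \<phi>"
  and cmap_cinv: "x \<in> cran \<phi> \<Longrightarrow> cmap \<phi> (cinv \<phi> x) = x"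
  unfolding cinv_def cran_def by (auto intro: inv_into_into f_inv_into_f)

lemma cmap_in: "p \<in> cdom \<phi> \<Longrightarrow> cmap \<phi> p \<in> cran \<phi>"
  by (simp add: cran_def)

lemma continuous_cinv:
  assumes "\<phi> \<in> A"
  shows "continuous_map (top_of_set (cran \<phi>)) X (cinv \<phi>)"
proof -
  have "homeomorphic_map (subtopology X (cdom \<phi>)) (top_of_set (cran \<phi>)) (cmap \<phi>)" using homeo assms .
  then obtain g where g: "homeomorphic_maps (subtopology X (cdom \<phi>)) (top_of_set (cran \<phi>)) (cmap \<phi>) g"
    using homeomorphic_map_maps by blast
  then have cont: "continuous_map (top_of_set (cran \<phi>)) (subtopology X (cdom \<phi>)) g"
    and gc: "\<And>y. y \<in> cran \<phi> \<Longrightarrow> cmap \<phi> (g y) = y"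
    by (auto simp: homeomorphic_maps_def)
  have "g y = cinv \<phi> y" if y: "y \<in> cran \<phi>" for y
  proof -
    have "g y \<in> cdom \<phi>" using cont y by (auto simp: continuous_map_def)
    then show ?thesis using cinv_cmap[OF assms] gc[OF y] by metis
  qed
  moreover have "continuous_map (top_of_set (cran \<phi>)) X g"
    using cont continuous_map_in_subtopology by blast
  ultimately show ?thesis using continuous_map_eq[of "top_of_set (cran \<phi>)" X g "cinv \<phi>"] by simp
qed

lemma open_image:
  assumes "\<phi> \<in> A" "openin X W" "W \<subseteq> cdom \<phi>"
  shows "open (cmap \<phi> ` W)"
proof -
  have "openin (subtopology X (cdom \<phi>)) W"
    using assms by (simp add: openin_open_subtopology openin_cdom)
  then have "openin (top_of_set (cran \<phi>)) (cmap \<phi> ` W)"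
    using homeomorphic_imp_open_map[OF homeo[OF assms(1)]] by (simp add: open_map_def)
  then show ?thesis using open_cran[OF assms(1)] openin_open_trans by blast
qed

lemma open_overlap: "\<phi> \<in> A \<Longrightarrow> \<psi> \<in> A \<Longrightarrow> open (overlap \<phi> \<psi>)"
  by (rule open_image) (simp_all add: openin_Int openin_cdom)

lemma overlap_iff:
  assumes "\<phi> \<in> A"
  shows "x \<in> overlap \<phi> \<psi> \<longleftrightarrow> x \<in> cran \<phi> \<and> cinv \<phi> x \<in> cdom \<psi>"
proof
  assume "x \<in> overlap \<phi> \<psi>"
  then obtain p where "x = cmap \<phi> p" "p \<in> cdom \<phi>" "p \<in> cdom \<psi>" by blast
  then show "x \<in> cran \<phi> \<and> cinv \<phi> x \<in> cdom \<psi>" using cinv_cmap[OF assms] cmap_in[of p \<phi>] by simp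
next
  assume "x \<in> cran \<phi> \<and> cinv \<phi> x \<in> cdom \<psi>"
  then show "x \<in> overlap \<phi> \<psi>" using cinv_in[of x \<phi>] cmap_cinv[of x \<phi>] by (metis IntI image_eqI)
qed

lemma transition_smooth: "\<phi> \<in> A \<Longrightarrow> \<psi> \<in> A \<Longrightarrow> smooth_on (overlap \<phi> \<psi>) (transition \<phi> \<psi>)"
  using manifold unfolding smooth_manifold_def smoothly_compatible_def by blast

lemma transition_derivative:
  "\<phi> \<in> A \<Longrightarrow> \<psi> \<in> A \<Longrightarrow> x \<in> overlap \<phi> \<psi> \<Longrightarrow> (transition \<phi> \<psi> has_derivative jac \<phi> \<psi> x) (at x)"
  using smooth_on_has_derivative[OF transition_smooth] .

lemma transition_cmap: "\<phi> \<in> A \<Longrightarrow> p \<in> cdom \<phi> \<Longrightarrow> transition \<phi> \<psi> (cmap \<phi> p) = cmap \<psi> p"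
  by (simp add: transition_def cinv_cmap)

lemma linear_jac:
  "\<phi> \<in> A \<Longrightarrow> \<psi> \<in> A \<Longrightarrow> p \<in> cdom \<phi> \<Longrightarrow> p \<in> cdom \<psi> \<Longrightarrow> linear (jac \<phi> \<psi> (cmap \<phi> p))"
  using has_derivative_linear[OF transition_derivative] by blast

lemma jac_cocycle:
  assumes A: "\<phi> \<in> A" "\<psi> \<in> A" "\<kappa> \<in> A" and p: "p \<in> cdom \<phi>" "p \<in> cdom \<psi>" "p \<in> cdom \<kappa>"
  shows "jac \<phi> \<kappa> (cmap \<phi> p) y = jac \<psi> \<kappa> (cmap \<psi> p) (jac \<phi> \<psi> (cmap \<phi> p) y)"
proof -
  let ?W = "cdom \<phi> \<inter> cdom \<psi> \<inter> cdom \<kappa>"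
  have W: "open (cmap \<phi> ` ?W)" by (rule open_image[OF A(1)]) (simp_all add: openin_Int openin_cdom A le_infI1)
  have "(transition \<psi> \<kappa> has_derivative jac \<psi> \<kappa> (cmap \<psi> p)) (at (transition \<phi> \<psi> (cmap \<phi> p)))"
    unfolding transition_cmap[OF A(1) p(1)] using transition_derivative[OF A(2,3)] p by blast
  from has_derivative_compose[OF transition_derivative[OF A(1,2)] this] p
  have "((\<lambda>x. transition \<psi> \<kappa> (transition \<phi> \<psi> x)) has_derivative
      (\<lambda>y. jac \<psi> \<kappa> (cmap \<psi> p) (jac \<phi> \<psi> (cmap \<phi> p) y))) (at (cmap \<phi> p))" by blast
  then have "(transition \<phi> \<kappa> has_derivative
      (\<lambda>y. jac \<psi> \<kappa> (cmap \<psi> p) (jac \<phi> \<psi> (cmap \<phi> p) y))) (at (cmap \<phi> p))"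
    by (rule has_derivative_transform_within_open[OF _ W]) (simp add: p, elim imageE IntE, simp add: transition_cmap A)
  then show ?thesis by (simp add: frechet_derivative_at[symmetric])
qed

lemma jac_self:
  assumes "\<phi> \<in> A" "p \<in> cdom \<phi>"
  shows "jac \<phi> \<phi> (cmap \<phi> p) y = y"
proof -
  have "(transition \<phi> \<phi> has_derivative (\<lambda>y. y)) (at (cmap \<phi> p))"
    by (rule has_derivative_transform_within_open[OF has_derivative_ident open_cran[OF assms(1)]])
      (simp_all add: transition_def cmap_cinv cmap_in assms)
  then show ?thesis by (simp add: frechet_derivative_at[symmetric])
qed

lemma jac_inverse:
  assumes "\<phi> \<in> A" "\<psi> \<in> A" "p \<in> cdom \<phi>" "p \<in> cdom \<psi>"
  shows "jac \<psi> \<phi> (cmap \<psi> p) (jac \<phi> \<psi> (cmap \<phi> p) y) = y"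
  using jac_cocycle[OF assms(1,2,1) assms(3,4,3), of y] jac_self[OF assms(1,3), of y] by simp

lemma jac_eq_0_iff:
  assumes "\<phi> \<in> A" "\<psi> \<in> A" "p \<in> cdom \<phi>" "p \<in> cdom \<psi>"
  shows "jac \<phi> \<psi> (cmap \<phi> p) y = 0 \<longleftrightarrow> y = 0"
  using jac_inverse[OF assms, of y] linear_0[OF linear_jac[OF assms]]
    linear_0[OF linear_jac[OF assms(2,1,4,3)]] by auto

lemma coord_vec_apply: "\<psi> \<in> A \<Longrightarrow> p \<in> cdom \<psi> \<Longrightarrow> coord_vec A \<phi> p y \<psi> = jac \<phi> \<psi> (cmap \<phi> p) y"
  by (simp add: coord_vec_def)

lemma coord_vec_self: "\<phi> \<in> A \<Longrightarrow> p \<in> cdom \<phi> \<Longrightarrow> coord_vec A \<phi> p y \<phi> = y"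
  by (simp add: coord_vec_apply jac_self)

lemma coord_vec_tangent:
  assumes "\<phi> \<in> A" "p \<in> cdom \<phi>"
  shows "coord_vec A \<phi> p y \<in> tangent_space A p"
proof -
  have "coord_vec A \<phi> p y \<kappa> = jac \<psi> \<kappa> (cmap \<psi> p) (coord_vec A \<phi> p y \<psi>)"
    if "\<psi> \<in> A" "\<kappa> \<in> A" "p \<in> cdom \<psi> \<inter> cdom \<kappa>" for \<psi> \<kappa>
    unfolding coord_vec_apply[OF that(1) IntD1[OF that(3)]] coord_vec_apply[OF that(2) IntD2[OF that(3)]]
    by (rule jac_cocycle[OF assms(1) that(1,2) assms(2) IntD1[OF that(3)] IntD2[OF that(3)]])
  moreover have "coord_vec A \<phi> p y \<psi> = 0" if "\<not> (\<psi> \<in> A \<and> p \<in> cdom \<psi>)" for \<psi>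
    using that unfolding coord_vec_def by (rule if_not_P)
  ultimately show ?thesis unfolding tangent_space_def by blast
qed

lemma tangent_eq_coord_vec:
  assumes "\<phi> \<in> A" "p \<in> cdom \<phi>" "v \<in> tangent_space A p"
  shows "v = coord_vec A \<phi> p (v \<phi>)"
proof
  fix \<psi>
  show "v \<psi> = coord_vec A \<phi> p (v \<phi>) \<psi>"
  proof (cases "\<psi> \<in> A \<and> p \<in> cdom \<psi>")
    case True
    then have "v \<psi> = jac \<phi> \<psi> (cmap \<phi> p) (v \<phi>)"
      using assms unfolding tangent_space_def by blast
    with True show ?thesis by (simp add: coord_vec_def)
  next
    case False
    then have "v \<psi> = 0" using assms(3) unfolding tangent_space_def by blast
    with False show ?thesis by (auto simp: coord_vec_def)
  qed
qed

lemma coord_vec_change: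
  assumes "\<phi> \<in> A" "\<psi> \<in> A" "p \<in> cdom \<phi>" "p \<in> cdom \<psi>"
  shows "coord_vec A \<phi> p y = coord_vec A \<psi> p (jac \<phi> \<psi> (cmap \<phi> p) y)"
proof
  fix \<kappa>
  show "coord_vec A \<phi> p y \<kappa> = coord_vec A \<psi> p (jac \<phi> \<psi> (cmap \<phi> p) y) \<kappa>"
    using jac_cocycle[OF assms(1,2) _ assms(3,4), of \<kappa>] by (simp add: coord_vec_def)
qed

lemma coord_vec_eq_0_iff:
  assumes "\<phi> \<in> A" "p \<in> cdom \<phi>"
  shows "coord_vec A \<phi> p y = (\<lambda>_. 0) \<longleftrightarrow> y = 0"
proof
  assume "coord_vec A \<phi> p y = (\<lambda>_. 0)"
  then show "y = 0" using coord_vec_self[OF assms, of y] by simp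
next
  assume "y = 0"
  then show "coord_vec A \<phi> p y = (\<lambda>_. 0)"
    using linear_0[OF linear_jac[OF assms(1) _ assms(2)]] by (simp add: coord_vec_def fun_eq_iff)
qed

lemma in_coords_cmap: "\<phi> \<in> A \<Longrightarrow> p \<in> cdom \<phi> \<Longrightarrow> in_coords A F \<phi> (cmap \<phi> p) y = F p (coord_vec A \<phi> p y)"
  by (simp add: in_coords_def cinv_cmap)

lemma in_coords_change:
  assumes "\<phi> \<in> A" "\<psi> \<in> A" "p \<in> cdom \<phi>" "p \<in> cdom \<psi>"
  shows "in_coords A F \<phi> (cmap \<phi> p) y = in_coords A F \<psi> (cmap \<psi> p) (jac \<phi> \<psi> (cmap \<phi> p) y)"
  unfolding in_coords_cmap[OF assms(1,3)] in_coords_cmap[OF assms(2,4)] coord_vec_change[OF assms, of y] ..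

section \<open>Curves and vector fields given in one chart\<close>

context
  fixes \<phi> :: "('m, 'n) chart" and I :: "real set" and x v :: "real \<Rightarrow> real^'n"
  assumes \<phi>: "\<phi> \<in> A" and I: "open_interval I" and x: "smooth_on I x" "x ` I \<subseteq> cran \<phi>"
    and v: "smooth_on I v"
begin

lemma open_I: "open I" using I by (simp add: open_interval_def)

lemma curve_continuous: "continuous_map (top_of_set I) X (curve \<phi> x)"
proof -
  have "continuous_map (top_of_set I) (top_of_set (cran \<phi>)) x"
    using smooth_on_continuous_on[OF x(1)] x(2) by (auto simp: image_subset_iff_funcset)
  from continuous_map_compose[OF this continuous_cinv[OF \<phi>]] show ?thesis .
qed

lemma open_chart_times: "\<psi> \<in> A \<Longrightarrow> open {t \<in> I. curve \<phi> x t \<in> cdom \<psi>}"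
  using openin_continuous_map_preimage[OF curve_continuous openin_cdom[of \<psi>]] open_I
  by (simp add: openin_open_eq)

lemma chart_times_overlap: "t \<in> I \<Longrightarrow> curve \<phi> x t \<in> cdom \<psi> \<Longrightarrow> x t \<in> overlap \<phi> \<psi>"
  unfolding overlap_iff[OF \<phi>] using x(2) by (simp add: image_subset_iff)

lemma chart_times_image: "x ` {t \<in> I. curve \<phi> x t \<in> cdom \<psi>} \<subseteq> overlap \<phi> \<psi>"
  using chart_times_overlap by blast

lemma smooth_curve_chart: "smooth_curve X A I (curve \<phi> x)"
  unfolding smooth_curve_def
proof (intro conjI ballI)
  fix \<psi> assume \<psi>: "\<psi> \<in> A"
  let ?T = "{t \<in> I. curve \<phi> x t \<in> cdom \<psi>}"
  have "smooth_on ?T (\<lambda>t. transition \<phi> \<psi> (x t))"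
    by (rule smooth_on_compose[OF open_chart_times[OF \<psi>] open_overlap[OF \<phi> \<psi>] chart_times_image
          smooth_on_subset[OF x(1)] transition_smooth[OF \<phi> \<psi>]]) blast
  then show "smooth_on ?T (cmap \<psi> \<circ> (curve \<phi> x))" by (simp add: transition_def comp_def)
qed (fact I curve_continuous)+

lemma velocity_chart:
  assumes "\<psi> \<in> A" "t \<in> I" "curve \<phi> x t \<in> cdom \<psi>" "(x has_vector_derivative x') (at t)"
  shows "velocity \<psi> (curve \<phi> x) t = jac \<phi> \<psi> (x t) x'"
proof -
  have "(x has_derivative (\<lambda>h. h *\<^sub>R x')) (at t)" using assms(4) by (simp add: has_vector_derivative_def)
  from has_derivative_compose[OF this transition_derivative[OF \<phi> assms(1) chart_times_overlap[OF assms(2,3)]]]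
  have "((\<lambda>t. transition \<phi> \<psi> (x t)) has_derivative (\<lambda>h. jac \<phi> \<psi> (x t) (h *\<^sub>R x'))) (at t)" .
  moreover have "linear (jac \<phi> \<psi> (x t))"
    using has_derivative_linear[OF transition_derivative[OF \<phi> assms(1) chart_times_overlap[OF assms(2,3)]]] .
  ultimately have "((cmap \<psi> \<circ> (curve \<phi> x)) has_vector_derivative jac \<phi> \<psi> (x t) x') (at t)"
    by (simp add: has_vector_derivative_def linear_cmul transition_def comp_def)
  then show ?thesis unfolding velocity_def by (rule vector_derivative_at)
qed

lemma jac_expand:
  assumes "\<psi> \<in> A" "y \<in> overlap \<phi> \<psi>"
  shows "jac \<phi> \<psi> y w = (\<Sum>k\<in>UNIV. w $ k *\<^sub>R pderiv_at k (transition \<phi> \<psi>) y)"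
proof -
  have "linear (jac \<phi> \<psi> y)" using has_derivative_linear[OF transition_derivative[OF \<phi> assms]] .
  from linear_sum_axis[OF this] show ?thesis unfolding pderiv_at_def .
qed

text \<open>Exhibits the components in another chart as sums of products of smooth functions of
  time, ready for smoothness proofs and differentiation.\<close>

lemma field_apply:
  assumes "\<psi> \<in> A" "t \<in> I" "curve \<phi> x t \<in> cdom \<psi>"
  shows "field \<phi> x v t \<psi> =
    (\<Sum>k\<in>UNIV. v t $ k *\<^sub>R pderiv_at k (transition \<phi> \<psi>) (x t))"
proof -
  have "cmap \<phi> (curve \<phi> x t) = x t" using x(2) assms(2) cmap_cinv[of "x t" \<phi>] by (simp add: image_subset_iff)
  then show ?thesis
    unfolding coord_vec_apply[OF assms(1,3)] jac_expand[OF assms(1) chart_times_overlap[OF assms(2,3)], symmetric]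
    by (rule arg_cong)
qed

lemma vector_field_chart:
  "vector_field_along A I (curve \<phi> x) (field \<phi> x v)"
  unfolding vector_field_along_def
proof (intro conjI ballI)
  show "field \<phi> x v t \<in> tangent_space A (curve \<phi> x t)" if "t \<in> I" for t
    by (rule coord_vec_tangent[OF \<phi>]) (use that x(2) cinv_in[of "x t" \<phi>] in \<open>simp add: image_subset_iff\<close>)
  fix \<psi> assume \<psi>: "\<psi> \<in> A"
  let ?T = "{t \<in> I. curve \<phi> x t \<in> cdom \<psi>}"
  have T: "open ?T" using open_chart_times[OF \<psi>] .
  have "smooth_on ?T (\<lambda>t. \<Sum>k\<in>UNIV. v t $ k *\<^sub>R pderiv_at k (transition \<phi> \<psi>) (x t))"
  proof (intro smooth_on_sum smooth_on_scaleR T smooth_on_vec_nth smooth_on_subset[OF v])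
    show "smooth_on ?T (\<lambda>t. pderiv_at k (transition \<phi> \<psi>) (x t))" for k
      unfolding pderiv_at_def
      by (rule smooth_on_compose[OF T open_overlap[OF \<phi> \<psi>] chart_times_image
            smooth_on_subset[OF x(1)] smooth_on_frechet[OF transition_smooth[OF \<phi> \<psi>]]]) blast
  qed blast
  then show "smooth_on ?T (\<lambda>t. field \<phi> x v t \<psi>)"
    by (rule smooth_on_cong[OF T, rotated]) (elim CollectE conjE, rule field_apply[OF \<psi>, symmetric])
qed

end

end

section \<open>Parallel fields and geodesics\<close>

lemma smooth_on_has_derivative_sum:
  fixes g :: "real^'n::finite \<Rightarrow> 'b::real_normed_vector"
  assumes "smooth_on S g" "y \<in> S"
  shows "(g has_derivative (\<lambda>h. \<Sum>j\<in>UNIV. h $ j *\<^sub>R pderiv_at j g y)) (at y)"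
proof -
  note d = smooth_on_has_derivative[OF assms]
  have "frechet_derivative g (at y) h = (\<Sum>j\<in>UNIV. h $ j *\<^sub>R pderiv_at j g y)" for h
    unfolding pderiv_at_def by (rule linear_sum_axis[OF has_derivative_linear[OF d]])
  then have "frechet_derivative g (at y) = (\<lambda>h. \<Sum>j\<in>UNIV. h $ j *\<^sub>R pderiv_at j g y)" by (rule ext)
  then show ?thesis using d by metis
qed

lemma has_vector_derivative_compose_sum:
  fixes g :: "real^'n::finite \<Rightarrow> 'b::real_normed_vector"
  assumes "smooth_on S g" "x t \<in> S" "(x has_vector_derivative x') (at t)"
  shows "((\<lambda>t. g (x t)) has_vector_derivative (\<Sum>j\<in>UNIV. x' $ j *\<^sub>R pderiv_at j g (x t))) (at t)"
proof -
  have "(x has_derivative (\<lambda>h. h *\<^sub>R x')) (at t)" using assms(3) by (simp add: has_vector_derivative_def)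
  from has_derivative_compose[OF this smooth_on_has_derivative_sum[OF assms(1,2)]]
  show ?thesis by (simp add: has_vector_derivative_def scaleR_sum_right mult.commute)
qed

lemma has_vector_derivative_vec_nth:
  assumes "(v has_vector_derivative v') F"
  shows "((\<lambda>t. v t $ i) has_field_derivative v' $ i) F"
  using bounded_linear.has_vector_derivative[OF bounded_linear_vec_nth assms]
  by (simp add: has_real_derivative_iff_has_vector_derivative)

text \<open>A Gronwall argument: the derivative of the squared length is at most
  \<open>2 * L\<close> times it in absolute value. Hence the squared length times
  \<open>exp (2 * L * r)\<close> does not decrease and times \<open>exp (- 2 * L * r)\<close> does
  not increase, which carries a zero backward and forward respectively.\<close>

lemma linear_ode_zero_forward:
  fixes v :: "real \<Rightarrow> real^'n::finite"
  assumes st: "s \<le> t" and v: "\<And>r. r \<in> {s..t} \<Longrightarrow> (v has_vector_derivative (\<chi> i. \<Sum>k\<in>UNIV. m i k r * v r $ k)) (at r)"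
    and m: "\<And>i k. continuous_on {s..t} (m i k)"
  shows "v s = 0 \<longleftrightarrow> v t = 0"
proof -
  define \<mu> where "\<mu> r = (\<Sum>i\<in>UNIV. \<Sum>k\<in>UNIV. \<bar>m i k r\<bar>)" for r
  have "continuous_on {s..t} \<mu>" unfolding \<mu>_def by (intro continuous_intros m)
  then have "bounded (\<mu> ` {s..t})" by (intro compact_imp_bounded compact_continuous_image compact_Icc)
  then obtain L where L: "\<And>r. r \<in> {s..t} \<Longrightarrow> norm (\<mu> r) \<le> L" unfolding bounded_iff by blast
  define v' where "v' r = (\<chi> i. \<Sum>k\<in>UNIV. m i k r * v r $ k)" for r
  have vn: "\<bar>v r \<bullet> v' r\<bar> \<le> L * (v r \<bullet> v r)" if r: "r \<in> {s..t}" for r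
  proof -
    have "norm (v' r) \<le> (\<Sum>i\<in>UNIV. \<bar>v' r $ i\<bar>)" by (rule norm_le_l1_cart)
    also have "\<dots> \<le> (\<Sum>i\<in>UNIV. \<Sum>k\<in>UNIV. \<bar>m i k r\<bar> * norm (v r))"
    proof (rule sum_mono)
      fix i
      have "\<bar>v' r $ i\<bar> \<le> (\<Sum>k\<in>UNIV. \<bar>m i k r * v r $ k\<bar>)" unfolding v'_def by (simp add: sum_abs)
      also have "\<dots> \<le> (\<Sum>k\<in>UNIV. \<bar>m i k r\<bar> * norm (v r))"
        by (intro sum_mono) (simp add: abs_mult mult_left_mono component_le_norm_cart)
      finally show "\<bar>v' r $ i\<bar> \<le> (\<Sum>k\<in>UNIV. \<bar>m i k r\<bar> * norm (v r))" .
    qed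
    also have "\<dots> = \<mu> r * norm (v r)" by (simp add: \<mu>_def sum_distrib_right)
    also have "\<dots> \<le> L * norm (v r)" using L[OF r] by (intro mult_right_mono) auto
    finally have "norm (v r) * norm (v' r) \<le> norm (v r) * (L * norm (v r))" by (intro mult_left_mono) auto
    then show ?thesis using Cauchy_Schwarz_ineq2[of "v r" "v' r"]
      by (simp add: power2_norm_eq_inner[symmetric] power2_eq_square mult_ac)
  qed
  have d: "((\<lambda>r. (v r \<bullet> v r) * exp (c * r)) has_real_derivative
      (2 * (v r \<bullet> v' r) + c * (v r \<bullet> v r)) * exp (c * r)) (at r)" if r: "r \<in> {s..t}" for r c
  proof -
    have "((\<lambda>r. v r \<bullet> v r) has_vector_derivative v r \<bullet> v' r + v' r \<bullet> v r) (at r)"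
      using bounded_bilinear.has_vector_derivative[OF bounded_bilinear_inner v[OF r] v[OF r]]
      unfolding v'_def .
    then have 1: "((\<lambda>r. v r \<bullet> v r) has_real_derivative 2 * (v r \<bullet> v' r)) (at r)"
      by (simp add: has_real_derivative_iff_has_vector_derivative inner_commute)
    have 2: "((\<lambda>r. exp (c * r)) has_real_derivative exp (c * r) * c) (at r)"
      by (auto intro!: derivative_eq_intros)
    show ?thesis by (rule DERIV_cong[OF DERIV_mult[OF 1 2]]) (simp add: algebra_simps)
  qed
  have up: "(v s \<bullet> v s) * exp (2 * L * s) \<le> (v t \<bullet> v t) * exp (2 * L * t)"
  proof (rule DERIV_nonneg_imp_nondecreasing[OF st])
    fix r assume "s \<le> r" "r \<le> t"
    then have r: "r \<in> {s..t}" by simp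
    have "0 \<le> (2 * (v r \<bullet> v' r) + 2 * L * (v r \<bullet> v r)) * exp (2 * L * r)"
      using vn[OF r] by (intro mult_nonneg_nonneg) (auto simp: abs_le_iff)
    then show "\<exists>y. ((\<lambda>r. (v r \<bullet> v r) * exp (2 * L * r)) has_real_derivative y) (at r) \<and> 0 \<le> y"
      using d[OF r, of "2 * L"] by blast
  qed
  have down: "(v t \<bullet> v t) * exp (- 2 * L * t) \<le> (v s \<bullet> v s) * exp (- 2 * L * s)"
  proof (rule DERIV_nonpos_imp_nonincreasing[OF st])
    fix r assume "s \<le> r" "r \<le> t"
    then have r: "r \<in> {s..t}" by simp
    have "(2 * (v r \<bullet> v' r) + - 2 * L * (v r \<bullet> v r)) * exp (- 2 * L * r) \<le> 0"
      using vn[OF r] by (intro mult_nonpos_nonneg) (auto simp: abs_le_iff)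
    then show "\<exists>y. ((\<lambda>r. (v r \<bullet> v r) * exp (- 2 * L * r)) has_real_derivative y) (at r) \<and> y \<le> 0"
      using d[OF r, of "- 2 * L"] by blast
  qed
  show ?thesis
  proof
    assume "v s = 0"
    then have "(v t \<bullet> v t) * exp (- 2 * L * t) \<le> 0" using down by simp
    then have "v t \<bullet> v t \<le> 0" by (simp add: mult_le_0_iff)
    then show "v t = 0" using inner_gt_zero_iff[of "v t"] by linarith
  next
    assume "v t = 0"
    then have "(v s \<bullet> v s) * exp (2 * L * s) \<le> 0" using up by simp
    then have "v s \<bullet> v s \<le> 0" by (simp add: mult_le_0_iff)
    then show "v s = 0" using inner_gt_zero_iff[of "v s"] by linarith
  qed
qed

lemma linear_ode_zero:
  fixes v :: "real \<Rightarrow> real^'n::finite"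
  assumes I: "is_interval I" "s \<in> I" "t \<in> I"
    and v: "\<And>r. r \<in> I \<Longrightarrow> (v has_vector_derivative (\<chi> i. \<Sum>k\<in>UNIV. m i k r * v r $ k)) (at r)"
    and m: "\<And>i k. continuous_on I (m i k)"
  shows "v s = 0 \<longleftrightarrow> v t = 0"
proof -
  have *: "v a = 0 \<longleftrightarrow> v b = 0" if ab: "a \<le> b" "a \<in> I" "b \<in> I" for a b
  proof -
    have sub: "{a..b} \<subseteq> I" using mem_is_interval_1_I[OF I(1) ab(2,3)] by (simp add: subset_iff)
    show ?thesis
    proof (rule linear_ode_zero_forward[OF ab(1), where m = m])
      show "(v has_vector_derivative (\<chi> i. \<Sum>k\<in>UNIV. m i k r * v r $ k)) (at r)" if "r \<in> {a..b}" for r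
        using v that sub by blast
      show "continuous_on {a..b} (m i k)" for i k by (rule continuous_on_subset[OF m sub])
    qed
  qed
  show ?thesis using *[OF _ I(2,3)] *[OF _ I(3,2)] linear[of s t] by blast
qed

abbreviation parallel_rhs :: "('m, 'n::finite) christoffel \<Rightarrow> ('m, 'n) chart \<Rightarrow> real^'n \<Rightarrow> real^'n \<Rightarrow> real^'n \<Rightarrow> real^'n" where
  "parallel_rhs \<Gamma> \<phi> x w y \<equiv> \<chi> i. - (\<Sum>j\<in>UNIV. \<Sum>k\<in>UNIV. \<Gamma> \<phi> x i j k * w $ j * y $ k)"

abbreviation parallel_on_line :: "('m, 'n::finite) christoffel \<Rightarrow> ('m, 'n) chart \<Rightarrow> real \<Rightarrow> real^'n \<Rightarrow> real^'n \<Rightarrow> (real \<Rightarrow> real^'n) \<Rightarrow> bool" where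
  "parallel_on_line \<Gamma> \<phi> T x w v \<equiv> smooth_on {-T<..<T} v \<and> (\<forall>t\<in>{-T<..<T}. x + t *\<^sub>R w \<in> cran \<phi> \<and>
    (v has_vector_derivative parallel_rhs \<Gamma> \<phi> (x + t *\<^sub>R w) w (v t)) (at t))"

locale surface = manifold X A for X :: "'m topology" and A :: "('m, 2) chart set"
begin

context
  fixes \<phi> :: "('m, 2) chart" and I :: "real set" and x v x' v' :: "real \<Rightarrow> real^2" and \<Gamma> :: "('m, 2) christoffel"
  assumes \<phi>: "\<phi> \<in> A" and I: "open_interval I" and x: "smooth_on I x" "x ` I \<subseteq> cran \<phi>"
    and v: "smooth_on I v" and \<Gamma>: "affine_connection A \<Gamma>"
    and x': "\<And>t. t \<in> I \<Longrightarrow> (x has_vector_derivative x' t) (at t)"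
    and v': "\<And>t. t \<in> I \<Longrightarrow> (v has_vector_derivative v' t) (at t)"
    and parallel: "\<And>t i. t \<in> I \<Longrightarrow> v' t $ i = - (\<Sum>j\<in>UNIV. \<Sum>k\<in>UNIV. \<Gamma> \<phi> (x t) i j k * x' t $ j * v t $ k)"
begin

text \<open>\<open>parallel_along\<close> demands the equation in every chart met by the curve.
  Differentiating the transformed components produces second derivatives of the transition map, and
  the inhomogeneous term in the law for \<open>\<Gamma>\<close> cancels them.\<close>

lemma parallel_other_chart:
  assumes \<psi>: "\<psi> \<in> A" and t: "t \<in> I" "curve \<phi> x t \<in> cdom \<psi>"
  shows "((\<lambda>s. field \<phi> x v s \<psi>) has_vector_derivative
    (parallel_rhs \<Gamma> \<psi> (cmap \<psi> (curve \<phi> x t)) (velocity \<psi> (curve \<phi> x) t) (field \<phi> x v t \<psi>))) (at t)"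
proof -
  let ?\<tau> = "transition \<phi> \<psi>" and ?T = "{t \<in> I. curve \<phi> x t \<in> cdom \<psi>}"
  define P where "P k = pderiv_at k ?\<tau>" for k
  define PP where "PP j k = pderiv_at j (P k) (x t)" for j k
  have xt: "x t \<in> overlap \<phi> \<psi>" using chart_times_overlap[OF \<phi> I x v t] .
  have smP: "smooth_on (overlap \<phi> \<psi>) (P k)" for k
    unfolding P_def pderiv_at_def by (intro smooth_on_frechet transition_smooth \<phi> \<psi>)
  have dP: "((\<lambda>s. P k (x s)) has_vector_derivative (\<Sum>j\<in>UNIV. x' t $ j *\<^sub>R PP j k)) (at t)" for k
    unfolding PP_def using has_vector_derivative_compose_sum[OF smP xt x'[OF t(1)]] .
  have "((\<lambda>s. \<Sum>k\<in>UNIV. v s $ k *\<^sub>R P k (x s)) has_vector_derivative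
      (\<Sum>k\<in>UNIV. v t $ k *\<^sub>R (\<Sum>j\<in>UNIV. x' t $ j *\<^sub>R PP j k) + v' t $ k *\<^sub>R P k (x t))) (at t)"
    by (intro has_vector_derivative_sum has_vector_derivative_scaleR dP
        has_vector_derivative_vec_nth[OF v'[OF t(1)]])
  then have W: "((\<lambda>s. field \<phi> x v s \<psi>) has_vector_derivative
      (\<Sum>k\<in>UNIV. v t $ k *\<^sub>R (\<Sum>j\<in>UNIV. x' t $ j *\<^sub>R PP j k) + v' t $ k *\<^sub>R P k (x t))) (at t)"
    by (rule has_vector_derivative_transform_within_open[OF _ open_chart_times[OF \<phi> I x v \<psi>]])
      (use t field_apply[OF \<phi> I x v \<psi>] in \<open>simp_all add: P_def\<close>)
  have vel: "velocity \<psi> (curve \<phi> x) t = (\<Sum>k\<in>UNIV. x' t $ k *\<^sub>R P k (x t))"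
    unfolding velocity_chart[OF \<phi> I x v \<psi> t x'[OF t(1)]] jac_expand[OF \<phi> I x v \<psi> xt] P_def ..
  have fld: "field \<phi> x v t \<psi> = (\<Sum>k\<in>UNIV. v t $ k *\<^sub>R P k (x t))"
    unfolding field_apply[OF \<phi> I x v \<psi> t] P_def ..
  have cm: "cmap \<psi> (curve \<phi> x t) = ?\<tau> (x t)" by (simp add: transition_def)
  have law: "(\<Sum>i\<in>UNIV. P i (x t) $ a * \<Gamma> \<phi> (x t) i j k) = PP j k $ a +
      (\<Sum>b\<in>UNIV. \<Sum>c\<in>UNIV. \<Gamma> \<psi> (?\<tau> (x t)) a b c * P j (x t) $ b * P k (x t) $ c)" for a j k
    using \<Gamma> \<phi> \<psi> xt unfolding affine_connection_def Let_def PP_def P_def by blast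
  have PP: "PP j k $ a = (\<Sum>i\<in>UNIV. P i (x t) $ a * \<Gamma> \<phi> (x t) i j k) -
      (\<Sum>b\<in>UNIV. \<Sum>c\<in>UNIV. \<Gamma> \<psi> (?\<tau> (x t)) a b c * P j (x t) $ b * P k (x t) $ c)" for a j k
    using law[of a j k] by simp
  have "(\<Sum>k\<in>UNIV. v t $ k *\<^sub>R (\<Sum>j\<in>UNIV. x' t $ j *\<^sub>R PP j k) + v' t $ k *\<^sub>R P k (x t)) =
    (parallel_rhs \<Gamma> \<psi> (cmap \<psi> (curve \<phi> x t)) (velocity \<psi> (curve \<phi> x) t) (field \<phi> x v t \<psi>))"
    unfolding vec_eq_iff
  proof
    fix a
    show "(\<Sum>k\<in>UNIV. v t $ k *\<^sub>R (\<Sum>j\<in>UNIV. x' t $ j *\<^sub>R PP j k) + v' t $ k *\<^sub>R P k (x t)) $ a =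
      (parallel_rhs \<Gamma> \<psi> (cmap \<psi> (curve \<phi> x t)) (velocity \<psi> (curve \<phi> x) t) (field \<phi> x v t \<psi>)) $ a"
      unfolding vel fld cm
      by (simp add: parallel[OF t(1)] PP sum_2 algebra_simps)
  qed
  then show ?thesis using W by simp
qed

lemma parallel_along_chart:
  "parallel_along A \<Gamma> I (curve \<phi> x) (field \<phi> x v)"
  unfolding parallel_along_def
proof (intro conjI ballI impI allI)
  show "vector_field_along A I (curve \<phi> x) (field \<phi> x v)"
    by (rule vector_field_chart[OF \<phi> I x v])
  fix \<psi> t i assume a: "\<psi> \<in> A" "t \<in> I" "curve \<phi> x t \<in> cdom \<psi>"
  show "vector_derivative (\<lambda>s. field \<phi> x v s \<psi>) (at t) $ i +
    (\<Sum>j\<in>UNIV. \<Sum>k\<in>UNIV. \<Gamma> \<psi> (cmap \<psi> (curve \<phi> x t)) i j k * velocity \<psi> (curve \<phi> x) t $ j *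
      field \<phi> x v t \<psi> $ k) = 0"
    unfolding vector_derivative_at[OF parallel_other_chart[OF a]] by simp
qed

lemma transport_constant:
  assumes "transport_preserves X A \<Gamma> F" "\<And>t. t \<in> I \<Longrightarrow> v t \<noteq> 0"
  shows "(\<lambda>t. in_coords A F \<phi> (x t) (v t)) constant_on I"
proof -
  have "field \<phi> x v t \<noteq> (\<lambda>_. 0)" if "t \<in> I" for t
    using coord_vec_eq_0_iff[OF \<phi>, of "curve \<phi> x t" "v t"] assms(2)[OF that] cinv_in[of "x t" \<phi>] x(2) that
    by (simp add: image_subset_iff)
  then have "(\<lambda>t. F (curve \<phi> x t) (field \<phi> x v t)) constant_on I"
    using assms(1) smooth_curve_chart[OF \<phi> I x v] parallel_along_chart
    unfolding transport_preserves_def by blast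
  then show ?thesis by (simp add: in_coords_def)
qed

text \<open>A curve is a geodesic of the connection when its velocity is parallel along it, so the
  change of charts for parallel fields is reused with the velocity as the field.\<close>

lemma geodesic_chart:
  assumes "\<And>t. t \<in> I \<Longrightarrow> v t = x' t" "\<And>t. t \<in> I \<Longrightarrow> v t \<noteq> 0"
  shows "geodesic X A (connection_spray \<Gamma>) I (curve \<phi> x)"
  unfolding geodesic_def
proof (intro conjI ballI impI)
  show "smooth_curve X A I (curve \<phi> x)" by (rule smooth_curve_chart[OF \<phi> I x v])
  fix \<psi> t assume \<psi>: "\<psi> \<in> A" and t: "t \<in> I" "curve \<phi> x t \<in> cdom \<psi>"
  have vel: "velocity \<psi> (curve \<phi> x) s = field \<phi> x v s \<psi>"
    if s: "s \<in> {t \<in> I. curve \<phi> x t \<in> cdom \<psi>}" for s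
  proof -
    have s': "s \<in> I" "curve \<phi> x s \<in> cdom \<psi>" using s by auto
    have "cmap \<phi> (curve \<phi> x s) = x s"
      using x(2) s'(1) cmap_cinv[of "x s" \<phi>] by (simp add: image_subset_iff)
    then show ?thesis
      unfolding velocity_chart[OF \<phi> I x v \<psi> s' x'[OF s'(1)]] coord_vec_apply[OF \<psi> s'(2)]
      using assms(1)[OF s'(1)] by simp
  qed
  have p: "curve \<phi> x t \<in> cdom \<phi>" using x(2) t(1) cinv_in[of "x t" \<phi>] by (simp add: image_subset_iff)
  have velt: "velocity \<psi> (curve \<phi> x) t = field \<phi> x v t \<psi>" using vel t by blast
  show "velocity \<psi> (curve \<phi> x) t \<noteq> 0"
    unfolding velt coord_vec_apply[OF \<psi> t(2)] jac_eq_0_iff[OF \<phi> \<psi> p t(2)] using assms(2)[OF t(1)] .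
  have "((velocity \<psi> (curve \<phi> x)) has_vector_derivative
    (parallel_rhs \<Gamma> \<psi> (cmap \<psi> (curve \<phi> x t)) (velocity \<psi> (curve \<phi> x) t) (field \<phi> x v t \<psi>))) (at t)"
    by (rule has_vector_derivative_transform_within_open[OF parallel_other_chart[OF \<psi> t] open_chart_times[OF \<phi> I x v \<psi>]])
      (use t vel in simp_all)
  from vector_derivative_at[OF this]
  show "vector_derivative (velocity \<psi> (curve \<phi> x)) (at t) +
      connection_spray \<Gamma> \<psi> (cmap \<psi> (curve \<phi> x t)) (velocity \<psi> (curve \<phi> x) t) = 0"
    unfolding velt[symmetric] by (simp add: connection_spray_def vec_eq_iff)
qed

end

end

section \<open>Flows of the parallel and geodesic equations and their pointwise consequences\<close>

lemma smooth_on_minus: "open S \<Longrightarrow> smooth_on S f \<Longrightarrow> smooth_on S (\<lambda>x. - f x)"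
  by (rule smooth_on_linear[OF bounded_linear_minus[OF bounded_linear_ident]])

lemma smooth_on_fst: "open S \<Longrightarrow> smooth_on S fst"
  and smooth_on_snd: "open S \<Longrightarrow> smooth_on S snd"
  using smooth_on_linear[OF bounded_linear_fst _ smooth_on_ident, of S]
    smooth_on_linear[OF bounded_linear_snd _ smooth_on_ident, of S] by auto

context surface
begin

lemma smooth_christoffel: "affine_connection A \<Gamma> \<Longrightarrow> \<phi> \<in> A \<Longrightarrow> smooth_on (cran \<phi>) (\<lambda>x. \<Gamma> \<phi> x i j k)"
  unfolding affine_connection_def by blast

text \<open>Base point, direction and transported vector are combined into one autonomous system in
  which the direction is constant. The local flow then gives a \<open>T\<close> that is uniform in
  all three initial data.\<close>

lemma parallel_flow:
  assumes \<Gamma>: "affine_connection A \<Gamma>" and \<phi>: "\<phi> \<in> A" and x0: "x0 \<in> cran \<phi>"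
  shows "\<exists>\<delta>>0. \<exists>T>0. \<forall>x1 w y. dist (x0, w0, y0) (x1, w, y) < \<delta> \<longrightarrow>
    (\<exists>v. v 0 = y \<and> parallel_on_line \<Gamma> \<phi> T x1 w v)"
proof -
  define S where "S = cran \<phi> \<times> (UNIV :: ((real^2) \<times> (real^2)) set)"
  define G where "G z = (fst (snd z), (0 :: real^2), parallel_rhs \<Gamma> \<phi> (fst z) (fst (snd z)) (snd (snd z)))"
    for z :: "(real^2) \<times> (real^2) \<times> (real^2)"
  have S: "open S" unfolding S_def by (intro open_Times open_cran \<phi> open_UNIV)
  have f: "smooth_on S fst" and s: "smooth_on S snd" using smooth_on_fst smooth_on_snd S by blast+
  have fs: "smooth_on S (\<lambda>z. fst (snd z))" by (rule smooth_on_linear[OF bounded_linear_fst S s])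
  have ss: "smooth_on S (\<lambda>z. snd (snd z))" by (rule smooth_on_linear[OF bounded_linear_snd S s])
  have g: "smooth_on S (\<lambda>z. \<Gamma> \<phi> (fst z) i j k)" for i j k
    by (rule smooth_on_compose[OF S open_cran[OF \<phi>] _ f smooth_christoffel[OF \<Gamma> \<phi>]]) (auto simp: S_def)
  have 3: "smooth_on S (\<lambda>z. (parallel_rhs \<Gamma> \<phi> (fst z) (fst (snd z)) (snd (snd z))) :: real^2)"
    by (rule smooth_on_vec[OF S]) (simp, intro smooth_on_minus smooth_on_sum smooth_on_mult smooth_on_vec_nth S g fs ss)
  have "smooth_on S G"
    unfolding G_def by (intro smooth_on_Pair smooth_on_const S fs 3)
  from smooth_local_flow[OF S _ this, of "(x0, w0, y0)"] x0
  obtain \<delta> T where \<delta>: "\<delta> > 0" and T: "T > 0" and flow: "\<And>z. z \<in> ball (x0, w0, y0) \<delta> \<Longrightarrow>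
      \<exists>u. u 0 = z \<and> smooth_on {-T<..<T} u \<and> (\<forall>t\<in>{-T<..<T}. u t \<in> S \<and> (u has_vector_derivative G (u t)) (at t))"
    by (auto simp: S_def)
  have "\<exists>v. v 0 = y \<and> parallel_on_line \<Gamma> \<phi> T x1 w v"
    if near: "dist (x0, w0, y0) (x1, w, y) < \<delta>" for x1 w y
  proof -
    let ?I = "{-T<..<T}"
    have "(x1, w, y) \<in> ball (x0, w0, y0) \<delta>" using near by simp
    from flow[OF this] obtain u where u0: "u 0 = (x1, w, y)" and usm: "smooth_on ?I u"
      and uS: "\<And>t. t \<in> ?I \<Longrightarrow> u t \<in> S" and ud: "\<And>t. t \<in> ?I \<Longrightarrow> (u has_vector_derivative G (u t)) (at t)"
      by blast
    have d1: "((\<lambda>t. fst (u t)) has_vector_derivative fst (snd (u t))) (at t)" if "t \<in> ?I" for t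
      using bounded_linear.has_vector_derivative[OF bounded_linear_fst ud[OF that]] by (simp add: G_def)
    have du: "((\<lambda>t. snd (u t)) has_vector_derivative snd (G (u t))) (at t)" if "t \<in> ?I" for t
      using bounded_linear.has_vector_derivative[OF bounded_linear_snd ud[OF that]] .
    have d2: "((\<lambda>t. fst (snd (u t))) has_vector_derivative 0) (at t)" if "t \<in> ?I" for t
      using bounded_linear.has_vector_derivative[OF bounded_linear_fst du[OF that]] by (simp add: G_def)
    have d3: "((\<lambda>t. snd (snd (u t))) has_vector_derivative snd (snd (G (u t)))) (at t)" if "t \<in> ?I" for t
      using bounded_linear.has_vector_derivative[OF bounded_linear_snd du[OF that]] .
    have conv: "convex ?I" and I0: "0 \<in> ?I" using T by auto
    have const: "h t = h 0" if hd: "\<And>t. t \<in> ?I \<Longrightarrow> (h has_vector_derivative 0) (at t)" and t: "t \<in> ?I"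
      for h :: "real \<Rightarrow> real^2" and t
    proof -
      have "\<exists>c. \<forall>x\<in>?I. h x = c"
        by (rule has_derivative_zero_constant[OF conv])
          (use hd in \<open>auto simp: has_vector_derivative_def intro: has_derivative_at_withinI\<close>)
      then show ?thesis using t I0 by auto
    qed
    have w: "fst (snd (u t)) = w" if "t \<in> ?I" for t using const[OF d2 that] u0 by simp
    have x: "fst (u t) = x1 + t *\<^sub>R w" if "t \<in> ?I" for t
    proof -
      have "((\<lambda>t. fst (u t) - t *\<^sub>R w) has_vector_derivative fst (snd (u t)) - 1 *\<^sub>R w) (at t)" if "t \<in> ?I" for t
        by (intro has_vector_derivative_diff d1 that) (auto intro!: derivative_eq_intros)
      then have "((\<lambda>t. fst (u t) - t *\<^sub>R w) has_vector_derivative 0) (at t)" if "t \<in> ?I" for t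
        using w that by fastforce
      from const[OF this that] show ?thesis using u0 by (simp add: algebra_simps)
    qed
    have "smooth_on ?I (\<lambda>t. snd (snd (u t)))"
      by (intro smooth_on_linear[OF bounded_linear_snd] usm open_greaterThanLessThan)
    moreover have "x1 + t *\<^sub>R w \<in> cran \<phi>" if "t \<in> ?I" for t
      using uS[OF that] x[OF that] by (auto simp: S_def mem_Times_iff)
    moreover have "((\<lambda>t. snd (snd (u t))) has_vector_derivative
        (parallel_rhs \<Gamma> \<phi> (x1 + t *\<^sub>R w) w (snd (snd (u t))))) (at t)"
      if "t \<in> ?I" for t
      using d3[OF that] unfolding G_def by (simp add: x[OF that] w[OF that])
    ultimately show ?thesis using u0 by (intro exI[of _ "\<lambda>t. snd (snd (u t))"]) auto
  qed
  then show ?thesis using \<delta> T by blast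
qed

text \<open>The state space excludes velocity 0, so solutions staying in it have nonvanishing
  velocity, as \<open>geodesic\<close> requires.\<close>

lemma geodesic_flow:
  assumes \<Gamma>: "affine_connection A \<Gamma>" and \<phi>: "\<phi> \<in> A" and x0: "x0 \<in> cran \<phi>" and y: "y \<noteq> 0"
  shows "\<exists>T>0. \<exists>x v. x 0 = x0 \<and> v 0 = y \<and> smooth_on {-T<..<T} x \<and> smooth_on {-T<..<T} v \<and>
    (\<forall>t\<in>{-T<..<T}. x t \<in> cran \<phi> \<and> v t \<noteq> 0 \<and> (x has_vector_derivative v t) (at t) \<and>
      (v has_vector_derivative parallel_rhs \<Gamma> \<phi> (x t) (v t) (v t)) (at t))"
proof -
  define S where "S = cran \<phi> \<times> - {0 :: real^2}"
  define G where "G z = (snd z, parallel_rhs \<Gamma> \<phi> (fst z) (snd z) (snd z))"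
    for z :: "(real^2) \<times> (real^2)"
  have S: "open S" unfolding S_def by (intro open_Times open_cran \<phi>) auto
  have f: "smooth_on S fst" and s: "smooth_on S snd" using smooth_on_fst smooth_on_snd S by blast+
  have g: "smooth_on S (\<lambda>z. \<Gamma> \<phi> (fst z) i j k)" for i j k
    by (rule smooth_on_compose[OF S open_cran[OF \<phi>] _ f smooth_christoffel[OF \<Gamma> \<phi>]]) (auto simp: S_def)
  have 3: "smooth_on S (\<lambda>z. (parallel_rhs \<Gamma> \<phi> (fst z) (snd z) (snd z)) :: real^2)"
    by (rule smooth_on_vec[OF S]) (simp, intro smooth_on_minus smooth_on_sum smooth_on_mult smooth_on_vec_nth S g s)
  have "smooth_on S G"
    unfolding G_def by (intro smooth_on_Pair S s 3)
  from smooth_local_flow[OF S _ this, of "(x0, y)"] x0 y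
  obtain \<delta> T where \<delta>: "\<delta> > 0" and T: "T > 0" and flow: "\<And>z. z \<in> ball (x0, y) \<delta> \<Longrightarrow>
      \<exists>u. u 0 = z \<and> smooth_on {-T<..<T} u \<and> (\<forall>t\<in>{-T<..<T}. u t \<in> S \<and> (u has_vector_derivative G (u t)) (at t))"
    by (auto simp: S_def)
  let ?I = "{-T<..<T}"
  obtain u where u0: "u 0 = (x0, y)" and usm: "smooth_on ?I u"
    and uS: "\<And>t. t \<in> ?I \<Longrightarrow> u t \<in> S" and ud: "\<And>t. t \<in> ?I \<Longrightarrow> (u has_vector_derivative G (u t)) (at t)"
    using flow[of "(x0, y)"] \<delta> by auto
  have d1: "((\<lambda>t. fst (u t)) has_vector_derivative snd (u t)) (at t)" if "t \<in> ?I" for t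
    using bounded_linear.has_vector_derivative[OF bounded_linear_fst ud[OF that]] by (simp add: G_def)
  have d2: "((\<lambda>t. snd (u t)) has_vector_derivative parallel_rhs \<Gamma> \<phi> (fst (u t)) (snd (u t)) (snd (u t))) (at t)"
    if "t \<in> ?I" for t
    using bounded_linear.has_vector_derivative[OF bounded_linear_snd ud[OF that]] by (simp add: G_def)
  have "smooth_on ?I (\<lambda>t. fst (u t))" "smooth_on ?I (\<lambda>t. snd (u t))"
    by (intro smooth_on_linear[OF bounded_linear_fst] smooth_on_linear[OF bounded_linear_snd] usm open_greaterThanLessThan)+
  moreover have "fst (u t) \<in> cran \<phi> \<and> snd (u t) \<noteq> 0" if "t \<in> ?I" for t
    using uS[OF that] by (auto simp: S_def mem_Times_iff)
  ultimately show ?thesis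
    using u0 T d1 d2 by (intro exI[of _ T] conjI exI[of _ "\<lambda>t. fst (u t)"] exI[of _ "\<lambda>t. snd (u t)"] ballI) auto
qed

lemma open_interval_symmetric: "T > 0 \<Longrightarrow> open_interval {-T<..<T::real}"
  unfolding open_interval_def by (auto simp: is_interval_oo)

text \<open>The first part feeds the second: invariance of \<open>F\<close> is assumed only for
  nowhere vanishing parallel fields, and a parallel field that is nonzero at one time is nonzero at
  all times.\<close>

lemma parallel_line:
  assumes \<Gamma>: "affine_connection A \<Gamma>" and \<phi>: "\<phi> \<in> A" and T: "T > 0"
    and x: "\<And>t. t \<in> {-T<..<T} \<Longrightarrow> x1 + t *\<^sub>R w \<in> cran \<phi>" and v: "smooth_on {-T<..<T} v"
    and v': "\<And>t. t \<in> {-T<..<T} \<Longrightarrow>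
      (v has_vector_derivative parallel_rhs \<Gamma> \<phi> (x1 + t *\<^sub>R w) w (v t)) (at t)"
  shows "s \<in> {-T<..<T} \<Longrightarrow> t \<in> {-T<..<T} \<Longrightarrow> v s = 0 \<longleftrightarrow> v t = 0"
    "transport_preserves X A \<Gamma> F \<Longrightarrow> v 0 \<noteq> 0 \<Longrightarrow>
      (\<lambda>t. in_coords A F \<phi> (x1 + t *\<^sub>R w) (v t)) constant_on {-T<..<T}"
proof -
  let ?I = "{-T<..<T}"
  have lin: "smooth_on ?I (\<lambda>t. x1 + t *\<^sub>R w)"
    by (intro smooth_on_add smooth_on_const smooth_on_linear[OF bounded_linear_scaleR_left] smooth_on_ident
        open_greaterThanLessThan)
  have im: "(\<lambda>t. x1 + t *\<^sub>R w) ` ?I \<subseteq> cran \<phi>" using x by blast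
  define m where "m i k t = - (\<Sum>j\<in>UNIV. \<Gamma> \<phi> (x1 + t *\<^sub>R w) i j k * w $ j)" for i k t
  have m: "continuous_on ?I (m i k)" for i k
    unfolding m_def
    by (intro continuous_intros continuous_on_compose2[OF smooth_on_continuous_on[OF smooth_christoffel[OF \<Gamma> \<phi>]]
          smooth_on_continuous_on[OF lin]] im)
  have vm: "(v has_vector_derivative (\<chi> i. \<Sum>k\<in>UNIV. m i k t * v t $ k)) (at t)" if "t \<in> ?I" for t
  proof -
    have "(\<chi> i. \<Sum>k\<in>UNIV. m i k t * v t $ k) =
      (parallel_rhs \<Gamma> \<phi> (x1 + t *\<^sub>R w) w (v t))"
      by (simp add: m_def vec_eq_iff sum_2 algebra_simps)
    then show ?thesis using v'[OF that] by simp
  qed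
  show z: "v s = 0 \<longleftrightarrow> v t = 0" if "s \<in> ?I" "t \<in> ?I" for s t
    by (rule linear_ode_zero[where m = m, OF is_interval_oo that vm m])
  assume tr: "transport_preserves X A \<Gamma> F" and v0: "v 0 \<noteq> 0"
  have nz: "v t \<noteq> 0" if "t \<in> ?I" for t using z[of 0 t] that v0 T by simp
  have lin': "((\<lambda>t. x1 + t *\<^sub>R w) has_vector_derivative w) (at t)" for t
    by (auto intro!: derivative_eq_intros)
  show "(\<lambda>t. in_coords A F \<phi> (x1 + t *\<^sub>R w) (v t)) constant_on ?I"
    by (rule transport_constant[OF \<phi> open_interval_symmetric[OF T] lin im v \<Gamma> lin' v' _ tr nz]) simp_all
qed

text \<open>\<open>F\<close> is constant on the parallel field starting at \<open>y\<close> over the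
  coordinate line in direction \<open>j\<close>; this is the derivative of that constancy at time
  0.\<close>

lemma transport_pde:
  assumes \<Gamma>: "affine_connection A \<Gamma>" and tr: "transport_preserves X A \<Gamma> F" and \<phi>: "\<phi> \<in> A"
    and sm: "smooth_on (cran \<phi> \<times> (UNIV - {0})) (\<lambda>(x, y). in_coords A F \<phi> x y)"
    and x0: "x0 \<in> cran \<phi>" and y: "y \<noteq> 0"
  shows "px j (in_coords A F \<phi>) x0 y =
    (\<Sum>i\<in>UNIV. \<Sum>k\<in>UNIV. \<Gamma> \<phi> x0 i j k * y $ k * py i (in_coords A F \<phi>) x0 y)"
proof -
  let ?f = "in_coords A F \<phi>"
  define w :: "real^2" where "w = axis j 1"
  obtain \<delta> T where \<delta>: "\<delta> > 0" and T: "T > 0" and fl: "\<forall>x1 w' y'. dist (x0, w, y) (x1, w', y') < \<delta> \<longrightarrow>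
    (\<exists>v. v 0 = y' \<and> parallel_on_line \<Gamma> \<phi> T x1 w' v)"
    using parallel_flow[OF \<Gamma> \<phi> x0, of w y] by blast
  have "dist (x0, w, y) (x0, w, y) < \<delta>" using \<delta> by simp
  from fl[rule_format, OF this] obtain v where v0: "v 0 = y" and vs: "smooth_on {-T<..<T} v"
    and xr: "\<And>t. t \<in> {-T<..<T} \<Longrightarrow> x0 + t *\<^sub>R w \<in> cran \<phi>"
    and vd: "\<And>t. t \<in> {-T<..<T} \<Longrightarrow> (v has_vector_derivative
      (parallel_rhs \<Gamma> \<phi> (x0 + t *\<^sub>R w) w (v t))) (at t)"
    by blast
  have "(\<lambda>t. ?f (x0 + t *\<^sub>R w) (v t)) constant_on {-T<..<T}"
    using parallel_line(2)[OF \<Gamma> \<phi> T xr vs vd tr] v0 y by simp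
  then obtain c where c: "\<And>t. t \<in> {-T<..<T} \<Longrightarrow> ?f (x0 + t *\<^sub>R w) (v t) = c"
    unfolding constant_on_def by blast
  \<comment> \<open>Initial rate of change of the parallel field; with \<open>w\<close> a coordinate
    vector only the symbols whose first lower index is \<open>j\<close> remain.\<close>
  define v' :: "real^2" where "v' = (\<chi> i. - (\<Sum>k\<in>UNIV. \<Gamma> \<phi> x0 i j k * y $ k))"
  have "(v has_vector_derivative v') (at 0)"
  proof -
    have "(\<chi> i. - (\<Sum>l\<in>UNIV. \<Sum>k\<in>UNIV. \<Gamma> \<phi> (x0 + 0 *\<^sub>R w) i l k * w $ l * v 0 $ k)) = v'"
      unfolding v'_def w_def v0 vec_eq_iff using exhaust_2[of j] by (auto simp: sum_2 axis_def)
    then show ?thesis using vd[of 0] T by simp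
  qed
  moreover have "((\<lambda>t. x0 + t *\<^sub>R w) has_vector_derivative w) (at 0)" by (auto intro!: derivative_eq_intros)
  ultimately have pair: "((\<lambda>t. (x0 + t *\<^sub>R w, v t)) has_derivative (\<lambda>h. (h *\<^sub>R w, h *\<^sub>R v'))) (at 0)"
    unfolding has_vector_derivative_def by (intro has_derivative_Pair)
  define G where "G = frechet_derivative (\<lambda>(x, y). ?f x y) (at (x0, y))"
  have dG: "((\<lambda>(x, y). ?f x y) has_derivative G) (at (x0 + 0 *\<^sub>R w, v 0))"
    using smooth_on_has_derivative[OF sm, of "(x0, y)"] x0 y v0 by (simp add: G_def)
  have "((\<lambda>t. ?f (x0 + t *\<^sub>R w) (v t)) has_derivative (\<lambda>h. G (h *\<^sub>R w, h *\<^sub>R v'))) (at 0)"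
    using has_derivative_compose[OF pair dG] by simp
  moreover have "((\<lambda>t. ?f (x0 + t *\<^sub>R w) (v t)) has_derivative (\<lambda>h. 0)) (at 0)"
    by (rule has_derivative_transform_within_open[of "\<lambda>t. c" _ _ _ "{-T<..<T}"]) (use T c in auto)
  ultimately have "(\<lambda>h. G (h *\<^sub>R w, h *\<^sub>R v')) = (\<lambda>h. 0)" using has_derivative_unique by blast
  from fun_cong[OF this, of 1] have G0: "G (w, v') = 0" by simp
  have "linear G" using has_derivative_linear[OF dG] .
  from linear_add[OF this, of "(w, 0)" "(0, v')"] G0 have "G (w, 0) + G (0, v') = 0" by simp
  moreover have "G (w, 0) = px j ?f x0 y"
    unfolding G_def w_def px_eq[OF open_cran[OF \<phi>] sm x0 y] ..
  moreover have "G (0, v') = (\<Sum>i\<in>UNIV. v' $ i * py i ?f x0 y)"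
    using has_derivative_unique[OF slice_y_derivative[OF open_cran[OF \<phi>] sm x0 y]
        slice_y_linear[OF open_cran[OF \<phi>] sm x0 y]] unfolding G_def by metis
  ultimately show ?thesis by (simp add: v'_def sum_2 algebra_simps)
qed

text \<open>The connection geodesic with initial velocity \<open>y\<close> becomes, after
  reparametrization by \<open>h\<close>, a geodesic of \<open>P\<close> through the same point with
  velocity \<open>k y\<close>. The second derivative of \<open>h\<close> contributes only a multiple
  of the velocity. Since \<open>h\<close> is merely known to exist, \<open>k\<close> cannot be
  prescribed.\<close>

lemma douglas_pointwise:
  assumes \<Gamma>: "affine_connection A \<Gamma>" and \<phi>: "\<phi> \<in> A" and x0: "x0 \<in> cran \<phi>" and y: "y \<noteq> 0"
    and geo: "\<And>I c. geodesic X A (connection_spray \<Gamma>) I c \<Longrightarrow>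
      \<exists>J h. pos_reparam J I h \<and> geodesic X A P J (c \<circ> h)"
  shows "\<exists>k>0. \<exists>m. \<forall>i. P \<phi> x0 (k *\<^sub>R y) $ i =
    (\<Sum>j\<in>UNIV. \<Sum>l\<in>UNIV. \<Gamma> \<phi> x0 i j l * (k *\<^sub>R y) $ j * (k *\<^sub>R y) $ l) - m * (k *\<^sub>R y) $ i"
proof -
  obtain T x v where T: "T > 0" and x00: "x 0 = x0" and v0: "v 0 = y"
    and xs: "smooth_on {-T<..<T} x" and vs: "smooth_on {-T<..<T} v"
    and all: "\<forall>t\<in>{-T<..<T}. x t \<in> cran \<phi> \<and> v t \<noteq> 0 \<and> (x has_vector_derivative v t) (at t) \<and>
      (v has_vector_derivative parallel_rhs \<Gamma> \<phi> (x t) (v t) (v t)) (at t)"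
    using geodesic_flow[OF \<Gamma> \<phi> x0 y] by blast
  let ?I = "{-T<..<T}"
  have I: "open_interval ?I" by (rule open_interval_symmetric[OF T])
  have im: "x ` ?I \<subseteq> cran \<phi>" using all by blast
  have xd: "(x has_vector_derivative v t) (at t)" if "t \<in> ?I" for t using all that by blast
  have vd: "(v has_vector_derivative parallel_rhs \<Gamma> \<phi> (x t) (v t) (v t)) (at t)"
    if "t \<in> ?I" for t using all that by blast
  have nz: "v t \<noteq> 0" if "t \<in> ?I" for t using all that by blast
  let ?c = "cinv \<phi> \<circ> x"
  have "geodesic X A (connection_spray \<Gamma>) ?I ?c"
    by (rule geodesic_chart[OF \<phi> I xs im vs \<Gamma> xd vd _ refl nz]) simp_all
  from geo[OF this] obtain J h where re: "pos_reparam J ?I h" and gP: "geodesic X A P J (?c \<circ> h)" by blast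
  have J: "open J" and hJ: "h ` J = ?I" and hs: "smooth_on J h" and hp: "\<And>s. s \<in> J \<Longrightarrow> deriv h s > 0"
    using re by (auto simp: pos_reparam_def open_interval_def)
  have "0 \<in> h ` J" using hJ T by simp
  then obtain s0 where s0: "s0 \<in> J" "h s0 = 0" by auto
  have hI: "h s \<in> ?I" if "s \<in> J" for s using hJ that by blast
  have dh: "(h has_real_derivative deriv h s) (at s)" if "s \<in> J" for s
    using smooth_on_has_derivative[OF hs that] field_differentiable_derivI
      real_differentiable_def differentiableI differentiable_def DERIV_deriv_iff_real_differentiable by blast
  have fr: "frechet_derivative h (at s) 1 = deriv h s" if "s \<in> J" for s
    using frechet_derivative_at[OF dh[OF that, unfolded has_field_derivative_def]] by (metis mult.right_neutral)
  have "smooth_on J (deriv h)"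
    by (rule smooth_on_cong[OF J fr smooth_on_frechet[OF hs, of 1]])
  from smooth_on_has_derivative[OF this s0(1)]
  have "(deriv h has_real_derivative deriv (deriv h) s0) (at s0)"
    using DERIV_deriv_iff_real_differentiable differentiableI by blast
  then obtain h2 where h2: "(deriv h has_real_derivative h2) (at s0)" by blast
  have vel: "velocity \<phi> (?c \<circ> h) s = deriv h s *\<^sub>R v (h s)" if s: "s \<in> J" for s
  proof -
    have "((x \<circ> h) has_vector_derivative deriv h s *\<^sub>R v (h s)) (at s)"
      using dh[OF s] by (intro vector_diff_chain_at xd hI s) (simp add: has_real_derivative_iff_has_vector_derivative)
    then have "((cmap \<phi> \<circ> (?c \<circ> h)) has_vector_derivative deriv h s *\<^sub>R v (h s)) (at s)"
    proof (rule has_vector_derivative_transform_within_open[OF _ J s])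
      fix r assume "r \<in> J"
      then have "x (h r) \<in> cran \<phi>" using im hI by blast
      from cmap_cinv[OF this] show "(x \<circ> h) r = (cmap \<phi> \<circ> (?c \<circ> h)) r" by simp
    qed
    then show ?thesis unfolding velocity_def by (rule vector_derivative_at)
  qed
  define k where "k = deriv h s0"
  have k: "k > 0" using hp s0 by (simp add: k_def)
  define v' where "v' = (parallel_rhs \<Gamma> \<phi> x0 y y)"
  have "(v has_vector_derivative v') (at (h s0))"
    using vd[of 0] T unfolding s0(2) v'_def by (simp add: x00 v0)
  then have "((v \<circ> h) has_vector_derivative k *\<^sub>R v') (at s0)"
    using dh[OF s0(1)] unfolding k_def
    by (intro vector_diff_chain_at) (simp_all add: has_real_derivative_iff_has_vector_derivative)
  from has_vector_derivative_scaleR[OF h2 this]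
  have "((\<lambda>s. deriv h s *\<^sub>R v (h s)) has_vector_derivative k *\<^sub>R k *\<^sub>R v' + h2 *\<^sub>R y) (at s0)"
    by (simp add: k_def s0 v0)
  then have "((velocity \<phi> (?c \<circ> h)) has_vector_derivative k *\<^sub>R k *\<^sub>R v' + h2 *\<^sub>R y) (at s0)"
    by (rule has_vector_derivative_transform_within_open[OF _ J s0(1)]) (simp add: vel)
  note vd2 = vector_derivative_at[OF this]
  have p: "(?c \<circ> h) s0 = cinv \<phi> x0" using s0 x00 by simp
  have "(?c \<circ> h) s0 \<in> cdom \<phi>" unfolding p by (rule cinv_in[OF x0])
  then have "vector_derivative (velocity \<phi> (?c \<circ> h)) (at s0) +
      P \<phi> (cmap \<phi> ((?c \<circ> h) s0)) (velocity \<phi> (?c \<circ> h) s0) = 0"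
    using gP \<phi> s0(1) unfolding geodesic_def by blast
  then have "k *\<^sub>R k *\<^sub>R v' + h2 *\<^sub>R y + P \<phi> x0 (k *\<^sub>R y) = 0"
    unfolding vd2 p cmap_cinv[OF x0] vel[OF s0(1)] s0(2) v0 k_def[symmetric] .
  then have eq: "(k *\<^sub>R k *\<^sub>R v' + h2 *\<^sub>R y + P \<phi> x0 (k *\<^sub>R y)) $ i = 0" for i by simp
  \<comment> \<open>The acceleration is \<open>k^2 * v' + h2 * y\<close>; writing the last term as a
    multiple of \<open>k y\<close> gives the factor \<open>h2 / k\<close>.\<close>
  have "P \<phi> x0 (k *\<^sub>R y) $ i =
    (\<Sum>j\<in>UNIV. \<Sum>l\<in>UNIV. \<Gamma> \<phi> x0 i j l * (k *\<^sub>R y) $ j * (k *\<^sub>R y) $ l) - h2 / k * (k *\<^sub>R y) $ i" for i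
    using eq[of i] k by (simp add: v'_def sum_2 algebra_simps)
  then show ?thesis using k by blast
qed

lemma finsler_chart:
  assumes "finsler_metric A F" "\<phi> \<in> A"
  shows "finsler_chart (in_coords A F \<phi>) (cran \<phi>)"
  using assms open_cran[OF assms(2)] unfolding finsler_chart_def finsler_metric_def by blast

lemma finsler_spray_eq: "finsler_spray A F \<phi> x y = spray_of (in_coords A F \<phi>) x y"
  unfolding finsler_spray_def spray_of_def Let_def ..

lemma torsion_imp_randers_fibre:
  assumes F: "finsler_metric A F" and D: "douglas X A F"
    and N: "affine_connection A N" "transport_preserves X A N F"
    and \<phi>: "\<phi> \<in> A" and x: "x \<in> cran \<phi>" and tors: "N \<phi> x i j k \<noteq> N \<phi> x i k j"
  shows "\<exists>u v w. \<forall>y. y \<noteq> 0 \<longrightarrow> in_coords A F \<phi> x y = sqrt ((u \<bullet> y)\<^sup>2 + (v \<bullet> y)\<^sup>2) + w \<bullet> y"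
proof -
  interpret f: finsler_chart "in_coords A F \<phi>" "cran \<phi>" by (rule finsler_chart[OF F \<phi>])
  obtain \<Gamma> where \<Gamma>: "affine_connection A \<Gamma>" and geo: "\<And>I c. geodesic X A (connection_spray \<Gamma>) I c \<Longrightarrow>
      \<exists>J h. pos_reparam J I h \<and> geodesic X A (finsler_spray A F) J (c \<circ> h)"
    using D unfolding douglas_def by blast
  show ?thesis
  proof (rule f.randers_fibre[where N = "N \<phi> x" and D = "\<Gamma> \<phi> x", OF x _ _ tors])
    show "px l (in_coords A F \<phi>) x y =
        (\<Sum>i\<in>UNIV. \<Sum>k\<in>UNIV. N \<phi> x i l k * y $ k * py i (in_coords A F \<phi>) x y)" if "y \<noteq> 0" for l y
      by (rule transport_pde[OF N \<phi> f.smooth x that])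
    show "\<exists>k>0. \<exists>m. \<forall>i. spray_of (in_coords A F \<phi>) x (k *\<^sub>R y) $ i =
      (\<Sum>j\<in>UNIV. \<Sum>l\<in>UNIV. \<Gamma> \<phi> x i j l * (k *\<^sub>R y) $ j * (k *\<^sub>R y) $ l) - m * (k *\<^sub>R y) $ i"
      if "y \<noteq> 0" for y
      using douglas_pointwise[OF \<Gamma> \<phi> x that geo] unfolding finsler_spray_eq .
  qed
qed

end

section \<open>Randers norms\<close>

text \<open>If \<open>f = sqrt q + l\<close> with \<open>q\<close> quadratic and \<open>l\<close> linear, then \<open>even_sq f = q\<close> and \<open>odd_part f = l\<close>.
  Stating this through the values of \<open>f\<close> makes the condition closed and invariant under linear
  isomorphisms.\<close>

definition even_sq :: "(real^2 \<Rightarrow> real) \<Rightarrow> real^2 \<Rightarrow> real" where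
  "even_sq f y = (if y = 0 then 0 else ((f y + f (- y)) / 2)\<^sup>2)"

definition odd_part :: "(real^2 \<Rightarrow> real) \<Rightarrow> real^2 \<Rightarrow> real" where
  "odd_part f y = (if y = 0 then 0 else (f y - f (- y)) / 2)"

definition randers_norm :: "(real^2 \<Rightarrow> real) \<Rightarrow> bool" where
  "randers_norm f \<longleftrightarrow> (\<forall>u v a b.
     even_sq f (a *\<^sub>R u + b *\<^sub>R v) =
       a\<^sup>2 * even_sq f u + b\<^sup>2 * even_sq f v + a * b * (even_sq f (u + v) - even_sq f u - even_sq f v) \<and>
     odd_part f (a *\<^sub>R u + b *\<^sub>R v) = a * odd_part f u + b * odd_part f v)"

lemma randers_normI:
  assumes "\<And>y. y \<noteq> 0 \<Longrightarrow> f y = sqrt ((u \<bullet> y)\<^sup>2 + (v \<bullet> y)\<^sup>2) + w \<bullet> y"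
  shows "randers_norm f"
proof -
  have e: "even_sq f y = (u \<bullet> y)\<^sup>2 + (v \<bullet> y)\<^sup>2" for y
    using assms[of y] assms[of "- y"] by (simp add: even_sq_def)
  have o: "odd_part f y = w \<bullet> y" for y
    using assms[of y] assms[of "- y"] by (simp add: odd_part_def)
  show ?thesis
    unfolding randers_norm_def e o by (simp add: inner_add_right power2_eq_square algebra_simps)
qed

text \<open>The condition on the kernel makes the exceptional value at 0 in \<open>even_sq\<close>
  and \<open>odd_part\<close> compatible with composition by \<open>L\<close>.\<close>

lemma randers_norm_linear:
  assumes "randers_norm f" "linear L" "\<And>y. L y = 0 \<longleftrightarrow> y = 0"
  shows "randers_norm (\<lambda>y. f (L y))"
proof -
  have e: "even_sq (\<lambda>y. f (L y)) y = even_sq f (L y)" for y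
    using assms(3) by (simp add: even_sq_def linear_neg[OF assms(2)])
  have o: "odd_part (\<lambda>y. f (L y)) y = odd_part f (L y)" for y
    using assms(3) by (simp add: odd_part_def linear_neg[OF assms(2)])
  show ?thesis
    using assms(1) unfolding randers_norm_def e o by (simp add: linear_add[OF assms(2)] linear_cmul[OF assms(2)])
qed

lemma randers_norm_coordinates:
  assumes "randers_norm f"
  shows "even_sq f y = even_sq f (axis 1 1) * (y $ 1)\<^sup>2 + even_sq f (axis 2 1) * (y $ 2)\<^sup>2 +
      (even_sq f (axis 1 1 + axis 2 1) - even_sq f (axis 1 1) - even_sq f (axis 2 1)) * (y $ 1 * y $ 2)"
    "odd_part f y = odd_part f (axis 1 1) * y $ 1 + odd_part f (axis 2 1) * y $ 2"
proof -
  have y: "y = y $ 1 *\<^sub>R axis 1 1 + y $ 2 *\<^sub>R axis 2 1"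
    using exhaust_2 by (auto simp: vec_eq_iff axis_def)
  have r: "even_sq f (a *\<^sub>R u + b *\<^sub>R v) =
       a\<^sup>2 * even_sq f u + b\<^sup>2 * even_sq f v + a * b * (even_sq f (u + v) - even_sq f u - even_sq f v)"
    "odd_part f (a *\<^sub>R u + b *\<^sub>R v) = a * odd_part f u + b * odd_part f v" for u v a b
    using assms unfolding randers_norm_def by blast+
  show "even_sq f y = even_sq f (axis 1 1) * (y $ 1)\<^sup>2 + even_sq f (axis 2 1) * (y $ 2)\<^sup>2 +
      (even_sq f (axis 1 1 + axis 2 1) - even_sq f (axis 1 1) - even_sq f (axis 2 1)) * (y $ 1 * y $ 2)"
    by (subst y, subst r(1)) (simp only: mult_ac)
  show "odd_part f y = odd_part f (axis 1 1) * y $ 1 + odd_part f (axis 2 1) * y $ 2"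
    by (subst y, subst r(2)) (simp only: mult_ac)
qed

lemma smooth_on_matrix:
  fixes M :: "'a::real_normed_vector \<Rightarrow> real^2^2"
  assumes S: "open S" and M: "\<And>i j. smooth_on S (\<lambda>x. M x $ i $ j)"
  shows "smooth_on S M"
proof -
  have "smooth_on S (\<lambda>x. \<Sum>i\<in>UNIV. \<Sum>j\<in>UNIV. M x $ i $ j *\<^sub>R (axis i (axis j 1) :: real^2^2))"
    by (intro smooth_on_sum smooth_on_scaleR smooth_on_const S M)
  moreover have "(\<lambda>x. \<Sum>i\<in>UNIV. \<Sum>j\<in>UNIV. M x $ i $ j *\<^sub>R (axis i (axis j 1) :: real^2^2)) = M"
    by (simp add: fun_eq_iff vec_eq_iff sum_2 forall_2 axis_def)
  ultimately show ?thesis by simp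
qed

context finsler_chart
begin

lemma smooth_slice:
  assumes "y \<noteq> 0"
  shows "smooth_on U (\<lambda>x. f x y)"
proof -
  have "smooth_on U (\<lambda>x. (\<lambda>(x, y). f x y) (x, y))"
    by (rule smooth_on_compose[OF U open_slit[OF U] _ _ smooth])
      (use assms in \<open>auto intro!: smooth_on_Pair smooth_on_ident smooth_on_const U\<close>)
  then show ?thesis by simp
qed

lemma smooth_even_sq: "smooth_on U (\<lambda>x. even_sq (f x) y)"
proof (cases "y = 0")
  case False
  then have "smooth_on U (\<lambda>x. f x y + f x (- y))"
    by (intro smooth_on_add smooth_slice U) auto
  note h = smooth_on_linear[OF bounded_linear_mult_right[of "1/2"] U this]
  have "smooth_on U (\<lambda>x. (1/2 * (f x y + f x (- y))) * (1/2 * (f x y + f x (- y))))"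
    by (rule smooth_on_mult[OF U h h])
  then show ?thesis using False by (simp add: even_sq_def power2_eq_square)
qed (simp add: even_sq_def smooth_on_const U)

lemma smooth_odd_part: "smooth_on U (\<lambda>x. odd_part (f x) y)"
proof (cases "y = 0")
  case False
  then have "smooth_on U (\<lambda>x. f x y + - f x (- y))"
    by (intro smooth_on_add smooth_on_minus smooth_slice U) auto
  from smooth_on_linear[OF bounded_linear_mult_right[of "1/2"] U this]
  show ?thesis using False by (simp add: odd_part_def)
qed (simp add: odd_part_def smooth_on_const U)

text \<open>For fixed vectors and scalars each defining identity equates two continuous functions of
  \<open>x\<close>, so its failure is an open condition; the set is a union of such sets.\<close>

lemma open_not_randers: "open {x \<in> U. \<not> randers_norm (f x)}"
proof -
  have ce: "continuous_on U (\<lambda>x. even_sq (f x) y)" and co: "continuous_on U (\<lambda>x. odd_part (f x) y)" for y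
    using smooth_on_continuous_on smooth_even_sq smooth_odd_part by blast+
  define P where "P u v a b x = even_sq (f x) (a *\<^sub>R u + b *\<^sub>R v) - (a\<^sup>2 * even_sq (f x) u + b\<^sup>2 * even_sq (f x) v
     + a * b * (even_sq (f x) (u + v) - even_sq (f x) u - even_sq (f x) v))" for u v a b x
  define Q where "Q u v a b x = odd_part (f x) (a *\<^sub>R u + b *\<^sub>R v) - (a * odd_part (f x) u + b * odd_part (f x) v)"
    for u v a b x
  have oP: "open (U \<inter> P u v a b -` (- {0}))" for u v a b
    unfolding P_def by (intro continuous_open_preimage continuous_intros ce U)
  have oQ: "open (U \<inter> Q u v a b -` (- {0}))" for u v a b
    unfolding Q_def by (intro continuous_open_preimage continuous_intros co U)
  have "{x \<in> U. \<not> randers_norm (f x)} =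
      (\<Union>u. \<Union>v. \<Union>a. \<Union>b. (U \<inter> P u v a b -` (- {0})) \<union> (U \<inter> Q u v a b -` (- {0})))"
  proof -
    have "randers_norm (f x) \<longleftrightarrow> (\<forall>u v a b. P u v a b x = 0 \<and> Q u v a b x = 0)" for x
      by (simp add: randers_norm_def P_def Q_def)
    then have "x \<in> {x \<in> U. \<not> randers_norm (f x)} \<longleftrightarrow> x \<in> U \<and> (\<exists>u v a b. P u v a b x \<noteq> 0 \<or> Q u v a b x \<noteq> 0)" for x
      by simp
    then show ?thesis by (intro set_eqI) (simp, metis)
  qed
  moreover have "open \<dots>" by (intro open_UN ballI open_Un oP oQ)
  ultimately show ?thesis by simp
qed

text \<open>Positivity of \<open>f\<close> at \<open>y\<close> and \<open>- y\<close> makes the even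
  part positive, so the square root undoes the square in \<open>even_sq\<close>.\<close>

lemma randers_norm_eq:
  assumes x: "x \<in> U" and y: "y \<noteq> 0"
  shows "f x y = sqrt (even_sq (f x) y) + odd_part (f x) y" "even_sq (f x) y > 0"
proof -
  have s: "f x y + f x (- y) > 0" using pos[OF x y] pos[OF x, of "- y"] y by simp
  have "sqrt (even_sq (f x) y) = (f x y + f x (- y)) / 2"
    by (rule real_sqrt_unique) (use s y in \<open>simp_all add: even_sq_def\<close>)
  then show "f x y = sqrt (even_sq (f x) y) + odd_part (f x) y" "even_sq (f x) y > 0"
    using y s by (simp_all add: odd_part_def) (simp_all add: even_sq_def field_simps)
qed

end

section \<open>Propagation of the Randers condition and construction of the global metric and
  1-form\<close>

context surface
begin

text \<open>Every nearby \<open>x\<close> is joined to \<open>x0\<close> by a segment along which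
  parallel transport is a linear isomorphism preserving \<open>F\<close>. The transport map is not
  built: a solution for each initial vector and superposition of solutions are enough to carry the
  identities over.\<close>

lemma randers_norm_nearby:
  assumes \<Gamma>: "affine_connection A \<Gamma>" and tr: "transport_preserves X A \<Gamma> F" and \<phi>: "\<phi> \<in> A"
    and x0: "x0 \<in> cran \<phi>" and rn: "randers_norm (in_coords A F \<phi> x0)"
  shows "\<exists>e>0. \<forall>x\<in>ball x0 e. randers_norm (in_coords A F \<phi> x)"
proof -
  let ?f = "in_coords A F \<phi>"
  obtain \<delta> T where \<delta>: "\<delta> > 0" and T: "T > 0" and fl: "\<forall>x1 w y. dist (x0, 0, 0) (x1, w, y) < \<delta> \<longrightarrow>
    (\<exists>v. v 0 = y \<and> parallel_on_line \<Gamma> \<phi> T x1 w v)"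
    using parallel_flow[OF \<Gamma> \<phi> x0, of 0 0] by blast
  let ?I = "{-T<..<T}"
  \<comment> \<open>Makes \<open>(1 + 2 / T) * e\<close> equal to half of \<open>\<delta>\<close>:
    this half pays for the displacement of base point and direction, the other half for the initial
    vector.\<close>
  define e where "e = \<delta> / (2 * (1 + 2 / T))"
  have T2: "1 + 2 / T > 0" using T by (simp add: add_pos_pos)
  have e: "e > 0" using \<delta> T2 by (simp add: e_def)
  have "randers_norm (?f x)" if x: "x \<in> ball x0 e" for x
  proof -
    \<comment> \<open>With this speed the segment reaches \<open>x0\<close> at time
      \<open>T / 2\<close>, inside the open interval of existence.\<close>
    define w where "w = (2 / T) *\<^sub>R (x0 - x)"
    define rhs where "rhs t y = (parallel_rhs \<Gamma> \<phi> (x + t *\<^sub>R w) w y)"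
      for t and y :: "real^2"
    define sol where "sol v \<longleftrightarrow> smooth_on ?I v \<and> (\<forall>t\<in>?I. (v has_vector_derivative rhs t (v t)) (at t))" for v
    have end_pt: "x + (T / 2) *\<^sub>R w = x0" using T by (simp add: w_def)
    have near: "dist (x0, 0, 0) (x, w, y) < \<delta>" if y: "norm y < \<delta> / 2" for y :: "real^2"
    proof -
      have "dist (x0, 0 :: real^2, 0 :: real^2) (x, w, y) \<le> dist x0 x + (norm w + norm y)"
      proof -
        have "dist (x0, 0 :: real^2, 0 :: real^2) (x, w, y) \<le> dist x0 x + dist (0 :: real^2, 0 :: real^2) (w, y)"
          unfolding dist_Pair_Pair[of x0] by (rule sqrt_sum_squares_le_sum) auto
        also have "dist (0 :: real^2, 0 :: real^2) (w, y) \<le> norm w + norm y"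
          unfolding dist_Pair_Pair using sqrt_sum_squares_le_sum[of "norm w" "norm y"] by simp
        finally show ?thesis by simp
      qed
      also have "norm w = 2 / T * dist x0 x" using T by (simp add: w_def dist_norm)
      also have "dist x0 x + (2 / T * dist x0 x + norm y) = (1 + 2 / T) * dist x0 x + norm y"
        by (simp add: algebra_simps)
      also have "\<dots> < (1 + 2 / T) * e + \<delta> / 2"
        using x y T2 by (intro add_less_le_mono mult_strict_left_mono) auto
      also have "\<dots> = \<delta>" using T2 by (simp add: e_def field_simps)
      finally show ?thesis .
    qed
    have xr: "x + t *\<^sub>R w \<in> cran \<phi>" if "t \<in> ?I" for t
    proof -
      have "dist (x0, 0, 0) (x, w, 0 :: real^2) < \<delta>" using near[of 0] \<delta> by simp
      from fl[rule_format, OF this] show ?thesis using that by blast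
    qed
    have rhs_lin: "rhs t (a *\<^sub>R y + b *\<^sub>R z) = a *\<^sub>R rhs t y + b *\<^sub>R rhs t z" for t a b y z
      by (simp add: rhs_def vec_eq_iff sum_2 algebra_simps)
    have sol_lin: "sol (\<lambda>t. a *\<^sub>R v t + b *\<^sub>R v' t)" if "sol v" "sol v'" for a b v v'
      unfolding sol_def rhs_lin
    proof (intro conjI ballI)
      show "smooth_on ?I (\<lambda>t. a *\<^sub>R v t + b *\<^sub>R v' t)"
        using that unfolding sol_def
        by (intro smooth_on_add smooth_on_linear[OF bounded_linear_scaleR_right] open_greaterThanLessThan) auto
      show "((\<lambda>t. a *\<^sub>R v t + b *\<^sub>R v' t) has_vector_derivative a *\<^sub>R rhs t (v t) + b *\<^sub>R rhs t (v' t)) (at t)"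
        if "t \<in> ?I" for t
        using \<open>sol v\<close> \<open>sol v'\<close> that unfolding sol_def
        by (intro has_vector_derivative_add bounded_linear.has_vector_derivative[OF bounded_linear_scaleR_right]) auto
    qed
    have ex: "\<exists>v. sol v \<and> v 0 = y" for y
    proof -
      \<comment> \<open>The flow provides solutions only for small initial vectors. \<open>r\<close>
        shrinks \<open>y\<close> below that bound, and linearity scales the solution back.\<close>
      define r where "r = \<delta> / (4 * (norm y + 1))"
      have ny: "norm y + 1 > 0" by (simp add: add_nonneg_pos)
      have r: "r > 0" using \<delta> ny by (simp add: r_def)
      have "norm (r *\<^sub>R y) = \<delta> / 4 * (norm y / (norm y + 1))" using r \<delta> by (simp add: r_def)
      also have "\<dots> \<le> \<delta> / 4 * 1" using \<delta> ny by (intro mult_left_mono) (auto simp: divide_le_eq)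
      also have "\<dots> < \<delta> / 2" using \<delta> by simp
      finally have "dist (x0, 0, 0) (x, w, r *\<^sub>R y) < \<delta>" by (rule near)
      from fl[rule_format, OF this] obtain v where v: "v 0 = r *\<^sub>R y" "sol v"
        unfolding sol_def rhs_def by blast
      show ?thesis
        using sol_lin[OF v(2,2), of "1 / r" 0] v(1) r by (intro exI[of _ "\<lambda>t. (1 / r) *\<^sub>R v t + 0 *\<^sub>R v t"]) simp
    qed
    have I: "0 \<in> ?I" "T / 2 \<in> ?I" using T by auto
    have zero: "v 0 = 0 \<longleftrightarrow> v (T / 2) = 0" if "sol v" for v
      using parallel_line(1)[OF \<Gamma> \<phi> T xr, of v 0 "T / 2"] that I unfolding sol_def rhs_def by blast
    have const: "?f x (v 0) = ?f x0 (v (T / 2))" if "sol v" "v 0 \<noteq> 0" for v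
    proof -
      have "(\<lambda>t. ?f (x + t *\<^sub>R w) (v t)) constant_on ?I"
        using parallel_line(2)[OF \<Gamma> \<phi> T xr, of v F] that tr unfolding sol_def rhs_def by blast
      then have "?f (x + 0 *\<^sub>R w) (v 0) = ?f (x + (T / 2) *\<^sub>R w) (v (T / 2))"
        using I unfolding constant_on_def by metis
      then show ?thesis unfolding end_pt by simp
    qed
    \<comment> \<open>\<open>F\<close> need not be reversible, and the even and odd parts involve
      its value at the opposite vector, so invariance is applied to the negated field as
      well.\<close>
    have neg: "?f x (- v 0) = ?f x0 (- v (T / 2))" if "sol v" "v 0 \<noteq> 0" for v
      using const[of "\<lambda>t. (- 1) *\<^sub>R v t + 0 *\<^sub>R v t"] sol_lin[OF that(1,1), of "- 1" 0] that(2) by simp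
    have ev: "even_sq (?f x) (v 0) = even_sq (?f x0) (v (T / 2))"
      and od: "odd_part (?f x) (v 0) = odd_part (?f x0) (v (T / 2))" if "sol v" for v
      using zero[OF that] const[OF that] neg[OF that] by (simp_all add: even_sq_def odd_part_def)
    show ?thesis
      unfolding randers_norm_def
    proof (intro allI)
      fix y z a b
      obtain u where u: "sol u" "u 0 = y" using ex by blast
      obtain v where v: "sol v" "v 0 = z" using ex by blast
      have s: "sol (\<lambda>t. a *\<^sub>R u t + b *\<^sub>R v t)" "sol (\<lambda>t. 1 *\<^sub>R u t + 1 *\<^sub>R v t)"
        by (rule sol_lin[OF u(1) v(1)])+
      show "even_sq (?f x) (a *\<^sub>R y + b *\<^sub>R z) = a\<^sup>2 * even_sq (?f x) y + b\<^sup>2 * even_sq (?f x) z +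
          a * b * (even_sq (?f x) (y + z) - even_sq (?f x) y - even_sq (?f x) z) \<and>
        odd_part (?f x) (a *\<^sub>R y + b *\<^sub>R z) = a * odd_part (?f x) y + b * odd_part (?f x) z"
        using ev[OF u(1)] ev[OF v(1)] ev[OF s(1)] ev[OF s(2)] od[OF u(1)] od[OF v(1)] od[OF s(1)]
          rn[unfolded randers_norm_def, rule_format, of a "u (T / 2)" b "v (T / 2)"]
        unfolding u(2) v(2) by simp
    qed
  qed
  then show ?thesis using e by blast
qed

lemma randers_norm_chart:
  assumes "\<phi> \<in> A" "\<psi> \<in> A" "p \<in> cdom \<phi>" "p \<in> cdom \<psi>" "randers_norm (in_coords A F \<psi> (cmap \<psi> p))"
  shows "randers_norm (in_coords A F \<phi> (cmap \<phi> p))"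
proof -
  have "in_coords A F \<phi> (cmap \<phi> p) = (\<lambda>y. in_coords A F \<psi> (cmap \<psi> p) (jac \<phi> \<psi> (cmap \<phi> p) y))"
    by (rule ext, rule in_coords_change[OF assms(1-4)])
  then show ?thesis
    using randers_norm_linear[OF assms(5) linear_jac[OF assms(1-4)] jac_eq_0_iff[OF assms(1-4)]] by simp
qed

lemma openin_chart_preimage:
  assumes "\<phi> \<in> A" "open W"
  shows "openin X {p \<in> cdom \<phi>. cmap \<phi> p \<in> W}"
proof -
  have "continuous_map (subtopology X (cdom \<phi>)) (top_of_set (cran \<phi>)) (cmap \<phi>)"
    using homeomorphic_imp_continuous_map[OF homeo[OF assms(1)]] .
  from openin_continuous_map_preimage[OF this, of "cran \<phi> \<inter> W"] assms(2)
  have "openin (subtopology X (cdom \<phi>)) {p \<in> topspace (subtopology X (cdom \<phi>)). cmap \<phi> p \<in> cran \<phi> \<inter> W}"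
    by (simp add: openin_open_Int)
  moreover have "{p \<in> topspace (subtopology X (cdom \<phi>)). cmap \<phi> p \<in> cran \<phi> \<inter> W} = {p \<in> cdom \<phi>. cmap \<phi> p \<in> W}"
    using cdom_subset[OF assms(1)] cmap_in[of _ \<phi>] by (simp add: set_eq_iff) blast
  ultimately show ?thesis using openin_trans_full[OF _ openin_cdom[OF assms(1)]] by simp
qed

lemma randers_norm_everywhere:
  assumes conn: "connected_space X" and F: "finsler_metric A F"
    and \<Gamma>: "affine_connection A \<Gamma>" and tr: "transport_preserves X A \<Gamma> F"
    and \<phi>: "\<phi> \<in> A" and x0: "x0 \<in> cran \<phi>" and rn: "randers_norm (in_coords A F \<phi> x0)"
    and \<psi>: "\<psi> \<in> A" and q: "q \<in> cdom \<psi>"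
  shows "randers_norm (in_coords A F \<psi> (cmap \<psi> q))"
proof -
  \<comment> \<open>One chart around the point is enough, since \<open>randers_norm_chart\<close>
    moves the property to any other; the openness of the complement relies on this.\<close>
  define R where "R = {p. \<exists>\<phi>\<in>A. p \<in> cdom \<phi> \<and> randers_norm (in_coords A F \<phi> (cmap \<phi> p))}"
  have cover: "\<exists>\<phi>\<in>A. p \<in> cdom \<phi>" if "p \<in> topspace X" for p
    using manifold that unfolding smooth_manifold_def by blast
  have sub: "R \<subseteq> topspace X" using cdom_subset unfolding R_def by blast
  have "openin X R"
  proof (subst openin_subopen, intro ballI)
    fix p assume "p \<in> R"
    then obtain \<kappa> where \<kappa>: "\<kappa> \<in> A" "p \<in> cdom \<kappa>" "randers_norm (in_coords A F \<kappa> (cmap \<kappa> p))"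
      unfolding R_def by blast
    obtain e where e: "e > 0" "\<And>x. x \<in> ball (cmap \<kappa> p) e \<Longrightarrow> randers_norm (in_coords A F \<kappa> x)"
      using randers_norm_nearby[OF \<Gamma> tr \<kappa>(1) cmap_in[OF \<kappa>(2)] \<kappa>(3)] by blast
    show "\<exists>T. openin X T \<and> p \<in> T \<and> T \<subseteq> R"
    proof (intro exI conjI)
      show "openin X {p' \<in> cdom \<kappa>. cmap \<kappa> p' \<in> ball (cmap \<kappa> p) e}"
        by (rule openin_chart_preimage[OF \<kappa>(1) open_ball])
      show "p \<in> {p' \<in> cdom \<kappa>. cmap \<kappa> p' \<in> ball (cmap \<kappa> p) e}" using \<kappa>(2) e(1) by simp
      show "{p' \<in> cdom \<kappa>. cmap \<kappa> p' \<in> ball (cmap \<kappa> p) e} \<subseteq> R" unfolding R_def using \<kappa>(1) e(2) by blast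
    qed
  qed
  moreover have "openin X (topspace X - R)"
  proof (subst openin_subopen, intro ballI)
    fix p assume p: "p \<in> topspace X - R"
    then obtain \<kappa> where \<kappa>: "\<kappa> \<in> A" "p \<in> cdom \<kappa>" using cover by blast
    interpret f: finsler_chart "in_coords A F \<kappa>" "cran \<kappa>" by (rule finsler_chart[OF F \<kappa>(1)])
    let ?W = "{x \<in> cran \<kappa>. \<not> randers_norm (in_coords A F \<kappa> x)}"
    show "\<exists>T. openin X T \<and> p \<in> T \<and> T \<subseteq> topspace X - R"
    proof (intro exI conjI)
      show "openin X {p' \<in> cdom \<kappa>. cmap \<kappa> p' \<in> ?W}"
        by (rule openin_chart_preimage[OF \<kappa>(1) f.open_not_randers])
      have "\<not> randers_norm (in_coords A F \<kappa> (cmap \<kappa> p))" using p \<kappa> unfolding R_def by blast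
      then show "p \<in> {p' \<in> cdom \<kappa>. cmap \<kappa> p' \<in> ?W}" using \<kappa>(2) cmap_in[OF \<kappa>(2)] by simp
      show "{p' \<in> cdom \<kappa>. cmap \<kappa> p' \<in> ?W} \<subseteq> topspace X - R"
      proof (intro subsetI DiffI)
        fix p' assume p': "p' \<in> {p' \<in> cdom \<kappa>. cmap \<kappa> p' \<in> ?W}"
        then show "p' \<in> topspace X" using cdom_subset[OF \<kappa>(1)] by blast
        show "p' \<notin> R"
        proof
          assume "p' \<in> R"
          then obtain \<kappa>' where "\<kappa>' \<in> A" "p' \<in> cdom \<kappa>'" "randers_norm (in_coords A F \<kappa>' (cmap \<kappa>' p'))"
            unfolding R_def by blast
          from randers_norm_chart[OF \<kappa>(1) this(1) _ this(2,3)] p' show False by blast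
        qed
      qed
    qed
  qed
  then have "closedin X R" using sub by (simp add: closedin_def)
  moreover have "cinv \<phi> x0 \<in> R"
    unfolding R_def using \<phi> cinv_in[OF x0] rn cmap_cinv[OF x0] by auto
  ultimately have "R = topspace X" using conn unfolding connected_space_clopen_in by blast
  then have "q \<in> R" using cdom_subset[OF \<psi>] q by blast
  then show ?thesis unfolding R_def using randers_norm_chart[OF \<psi> _ q] by blast
qed

lemma coord_vec_linear:
  assumes "\<phi> \<in> A" "p \<in> cdom \<phi>"
  shows "coord_vec A \<phi> p (y + z) = (\<lambda>\<kappa>. coord_vec A \<phi> p y \<kappa> + coord_vec A \<phi> p z \<kappa>)"
    "coord_vec A \<phi> p (- y) = (\<lambda>\<kappa>. - coord_vec A \<phi> p y \<kappa>)"
  using linear_add[OF linear_jac[OF assms(1) _ assms(2)]] linear_neg[OF linear_jac[OF assms(1) _ assms(2)]]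
  by (simp_all add: coord_vec_def fun_eq_iff)

text \<open>Metric and 1-form are read off from the values of \<open>F\<close> without charts, hence
  are globally defined. In a chart their coefficients are even and odd parts at fixed vectors, so
  they inherit smoothness from \<open>F\<close>.\<close>

lemma randersI:
  assumes F: "finsler_metric A F"
    and rn: "\<And>\<phi> p. \<phi> \<in> A \<Longrightarrow> p \<in> cdom \<phi> \<Longrightarrow> randers_norm (in_coords A F \<phi> (cmap \<phi> p))"
  shows "randers X A F"
proof -
  define E where "E p v = (if v = (\<lambda>_. 0) then 0 else ((F p v + F p (\<lambda>\<kappa>. - v \<kappa>)) / 2)\<^sup>2)"
    for p and v :: "('m, 2) tvec"
  define \<beta> where "\<beta> p v = (if v = (\<lambda>_. 0) then 0 else (F p v - F p (\<lambda>\<kappa>. - v \<kappa>)) / 2)"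
    for p and v :: "('m, 2) tvec"
  \<comment> \<open>Polarization of the quadratic form given by the squared even part; the
    off-diagonal entries of the matrix \<open>a\<close> below are the same expression at the
    coordinate vectors.\<close>
  define g where "g p v w = (E p (\<lambda>\<kappa>. v \<kappa> + w \<kappa>) - E p v - E p w) / 2"
    for p and v w :: "('m, 2) tvec"
  have E_coord: "E p (coord_vec A \<phi> p y) = even_sq (in_coords A F \<phi> (cmap \<phi> p)) y"
    and \<beta>_coord: "\<beta> p (coord_vec A \<phi> p y) = odd_part (in_coords A F \<phi> (cmap \<phi> p)) y"
    if "\<phi> \<in> A" "p \<in> cdom \<phi>" for \<phi> p y
    unfolding E_def \<beta>_def even_sq_def odd_part_def coord_vec_eq_0_iff[OF that] in_coords_cmap[OF that]
      coord_vec_linear(2)[OF that, symmetric] by (rule refl)+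
  have g_coord: "g p (coord_vec A \<phi> p y) (coord_vec A \<phi> p z) =
      (even_sq (in_coords A F \<phi> (cmap \<phi> p)) (y + z) - even_sq (in_coords A F \<phi> (cmap \<phi> p)) y -
       even_sq (in_coords A F \<phi> (cmap \<phi> p)) z) / 2" if "\<phi> \<in> A" "p \<in> cdom \<phi>" for \<phi> p y z
    unfolding g_def coord_vec_linear(1)[OF that, symmetric] E_coord[OF that] ..
  have rnx: "randers_norm (in_coords A F \<phi> x)" if "\<phi> \<in> A" "x \<in> cran \<phi>" for \<phi> x
    using rn[OF that(1) cinv_in[OF that(2)]] cmap_cinv[OF that(2)] by simp
  have "riemannian_metric A g"
    unfolding riemannian_metric_def
  proof
    fix \<phi> assume \<phi>: "\<phi> \<in> A"
    interpret f: finsler_chart "in_coords A F \<phi>" "cran \<phi>" by (rule finsler_chart[OF F \<phi>])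
    define e where "e x = even_sq (in_coords A F \<phi> x)" for x
    define a :: "real^2 \<Rightarrow> real^2^2" where "a x = vector
      [vector [e x (axis 1 1), (e x (axis 1 1 + axis 2 1) - e x (axis 1 1) - e x (axis 2 1)) / 2],
       vector [(e x (axis 1 1 + axis 2 1) - e x (axis 1 1) - e x (axis 2 1)) / 2, e x (axis 2 1)]]" for x
    have a: "a x $ 1 $ 1 = e x (axis 1 1)" "a x $ 2 $ 2 = e x (axis 2 1)"
      "a x $ 1 $ 2 = (e x (axis 1 1 + axis 2 1) - e x (axis 1 1) - e x (axis 2 1)) / 2"
      "a x $ 2 $ 1 = (e x (axis 1 1 + axis 2 1) - e x (axis 1 1) - e x (axis 2 1)) / 2" for x
      by (simp_all add: a_def)
    have e_eq: "e x y = a x $ 1 $ 1 * (y $ 1)\<^sup>2 + a x $ 2 $ 2 * (y $ 2)\<^sup>2 + 2 * a x $ 1 $ 2 * (y $ 1 * y $ 2)"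
      if "x \<in> cran \<phi>" for x y
      using randers_norm_coordinates(1)[OF rnx[OF \<phi> that], of y] unfolding a e_def by simp
    have az: "y \<bullet> (a x *v z) = a x $ 1 $ 1 * (y $ 1 * z $ 1) + a x $ 2 $ 2 * (y $ 2 * z $ 2) +
        a x $ 1 $ 2 * (y $ 1 * z $ 2 + y $ 2 * z $ 1)" for x y z
      using a(3,4)[of x] by (simp add: inner_vec_def matrix_vector_mult_def sum_2 algebra_simps)
    have se: "smooth_on (cran \<phi>) (\<lambda>x. e x y)" for y unfolding e_def by (rule f.smooth_even_sq)
    have s12: "smooth_on (cran \<phi>) (\<lambda>x. (e x (axis 1 1 + axis 2 1) - e x (axis 1 1) - e x (axis 2 1)) / 2)"
    proof -
      have "smooth_on (cran \<phi>) (\<lambda>x. e x (axis 1 1 + axis 2 1) + - e x (axis 1 1) + - e x (axis 2 1))"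
        by (intro smooth_on_add smooth_on_minus se open_cran \<phi>)
      from smooth_on_linear[OF bounded_linear_mult_right[of "1/2"] open_cran[OF \<phi>] this]
      show ?thesis by simp
    qed
    show "\<exists>a::real^2 \<Rightarrow> real^2^2. smooth_on (cran \<phi>) a \<and>
      (\<forall>x\<in>cran \<phi>. transpose (a x) = a x \<and> (\<forall>z. z \<noteq> 0 \<longrightarrow> z \<bullet> (a x *v z) > 0)) \<and>
      (\<forall>p\<in>cdom \<phi>. \<forall>v\<in>tangent_space A p. \<forall>w\<in>tangent_space A p.
        g p v w = v \<phi> \<bullet> (a (cmap \<phi> p) *v w \<phi>))"
    proof (intro exI[of _ a] conjI ballI allI impI)
      show "smooth_on (cran \<phi>) a"
      proof (rule smooth_on_matrix[OF open_cran[OF \<phi>]])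
        fix i j :: 2
        show "smooth_on (cran \<phi>) (\<lambda>x. a x $ i $ j)"
          using exhaust_2[of i] exhaust_2[of j] by (auto simp: a se s12)
      qed
      fix x assume x: "x \<in> cran \<phi>"
      show "transpose (a x) = a x" using a(3,4)[of x] by (simp add: transpose_def vec_eq_iff forall_2)
      fix z :: "real^2" assume z: "z \<noteq> 0"
      have "z \<bullet> (a x *v z) = e x z" unfolding az e_eq[OF x] by (simp add: power2_eq_square algebra_simps)
      then show "z \<bullet> (a x *v z) > 0" using f.randers_norm_eq(2)[OF x z] by (simp add: e_def)
    next
      fix p v w assume p: "p \<in> cdom \<phi>" and v: "v \<in> tangent_space A p" and w: "w \<in> tangent_space A p"
      have x: "cmap \<phi> p \<in> cran \<phi>" by (rule cmap_in[OF p])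
      have "g p v w = (e (cmap \<phi> p) (v \<phi> + w \<phi>) - e (cmap \<phi> p) (v \<phi>) - e (cmap \<phi> p) (w \<phi>)) / 2"
        using g_coord[OF \<phi> p, of "v \<phi>" "w \<phi>"]
        unfolding tangent_eq_coord_vec[OF \<phi> p v, symmetric] tangent_eq_coord_vec[OF \<phi> p w, symmetric] e_def .
      then show "g p v w = v \<phi> \<bullet> (a (cmap \<phi> p) *v w \<phi>)"
        unfolding az e_eq[OF x] by (simp add: power2_eq_square algebra_simps)
    qed
  qed
  moreover have "one_form A \<beta>"
    unfolding one_form_def
  proof
    fix \<phi> assume \<phi>: "\<phi> \<in> A"
    interpret f: finsler_chart "in_coords A F \<phi>" "cran \<phi>" by (rule finsler_chart[OF F \<phi>])
    define b :: "real^2 \<Rightarrow> real^2" where "b x = (\<chi> i. odd_part (in_coords A F \<phi> x) (axis i 1))" for x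
    show "\<exists>b::real^2 \<Rightarrow> real^2. smooth_on (cran \<phi>) b \<and>
      (\<forall>p\<in>cdom \<phi>. \<forall>v\<in>tangent_space A p. \<beta> p v = b (cmap \<phi> p) \<bullet> v \<phi>)"
    proof (intro exI[of _ b] conjI ballI)
      show "smooth_on (cran \<phi>) b"
        by (rule smooth_on_vec[OF open_cran[OF \<phi>]]) (simp add: b_def f.smooth_odd_part)
      fix p v assume p: "p \<in> cdom \<phi>" and v: "v \<in> tangent_space A p"
      have "\<beta> p v = odd_part (in_coords A F \<phi> (cmap \<phi> p)) (v \<phi>)"
        using \<beta>_coord[OF \<phi> p, of "v \<phi>"] unfolding tangent_eq_coord_vec[OF \<phi> p v, symmetric] .
      also have "\<dots> = b (cmap \<phi> p) \<bullet> v \<phi>"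
        unfolding randers_norm_coordinates(2)[OF rn[OF \<phi> p], of "v \<phi>"]
        by (simp add: b_def inner_vec_def sum_2)
      finally show "\<beta> p v = b (cmap \<phi> p) \<bullet> v \<phi>" .
    qed
  qed
  moreover have "F p v = sqrt (g p v v) + \<beta> p v"
    if p: "p \<in> topspace X" and v: "v \<in> tangent_space A p" and v0: "v \<noteq> (\<lambda>_. 0)" for p v
  proof -
    obtain \<phi> where \<phi>: "\<phi> \<in> A" "p \<in> cdom \<phi>"
      using manifold p unfolding smooth_manifold_def by blast
    interpret f: finsler_chart "in_coords A F \<phi>" "cran \<phi>" by (rule finsler_chart[OF F \<phi>(1)])
    let ?f = "in_coords A F \<phi> (cmap \<phi> p)"
    have vc: "coord_vec A \<phi> p (v \<phi>) = v" using tangent_eq_coord_vec[OF \<phi> v] by (rule sym)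
    have nz: "v \<phi> \<noteq> 0" using coord_vec_eq_0_iff[OF \<phi>, of "v \<phi>"] v0 unfolding vc by simp
    \<comment> \<open>Polarization recovers the form on the diagonal once doubling a vector is known
      to multiply its value by 4; the second decomposition of the doubled vector gives this from
      \<open>randers_norm\<close>.\<close>
    have "even_sq ?f (1 *\<^sub>R v \<phi> + 1 *\<^sub>R v \<phi>) = even_sq ?f (2 *\<^sub>R v \<phi> + 0 *\<^sub>R v \<phi>)"
      by (simp add: scaleR_2)
    also have "\<dots> = 4 * even_sq ?f (v \<phi>)"
      using rn[OF \<phi>, unfolded randers_norm_def, rule_format, of 2 "v \<phi>" 0 "v \<phi>"] by simp
    finally have "g p v v = even_sq ?f (v \<phi>)"
      using g_coord[OF \<phi>, of "v \<phi>" "v \<phi>"] unfolding vc by simp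
    moreover have "\<beta> p v = odd_part ?f (v \<phi>)" using \<beta>_coord[OF \<phi>, of "v \<phi>"] unfolding vc .
    moreover have "F p v = ?f (v \<phi>)" using in_coords_cmap[OF \<phi>, of F "v \<phi>"] unfolding vc by (rule sym)
    ultimately show ?thesis using f.randers_norm_eq(1)[OF cmap_in[OF \<phi>(2)] nz] by simp
  qed
  ultimately show ?thesis unfolding randers_def by blast
qed

end

theorem mainTheorem1:
  fixes X :: "'m topology"
    and A :: "('m, 2) chart set"
    and F :: "'m \<Rightarrow> ('m, 2) tvec \<Rightarrow> real"
  assumes "smooth_manifold X A"
    and "connected_space X"
    and "finsler_metric A F"
    and "douglas X A F"
    and "generalized_berwald X A F"
  shows "berwald X A F \<or> randers X A F"
proof -
  interpret surface X A by unfold_locales (rule assms(1))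
  obtain N where N: "affine_connection A N" "transport_preserves X A N F"
    using assms(5) unfolding generalized_berwald_def by blast
  show ?thesis
  proof (cases "torsion_free A N")
    case True
    then show ?thesis using N unfolding berwald_def by blast
  next
    case False
    then obtain \<phi> x i j k where \<phi>: "\<phi> \<in> A" and x: "x \<in> cran \<phi>" and "N \<phi> x i j k \<noteq> N \<phi> x i k j"
      unfolding torsion_free_def by blast
    then obtain u v w where
      "\<forall>y. y \<noteq> 0 \<longrightarrow> in_coords A F \<phi> x y = sqrt ((u \<bullet> y)\<^sup>2 + (v \<bullet> y)\<^sup>2) + w \<bullet> y"
      using torsion_imp_randers_fibre[OF assms(3,4) N] by blast
    then have "randers_norm (in_coords A F \<phi> x)" by (intro randers_normI) blast
    then have "randers X A F"
      by (intro randersI[OF assms(3)] randers_norm_everywhere[OF assms(2,3) N \<phi> x])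
    then show ?thesis ..
  qed
qed

end
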